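(* Let $f\colon\mathcal{X}\to\mathcal{X}$ be an interval map with an ergodic (invariant) probability measure $\mu$, and assume: (i) $(f,\mathcal{X},\mu)$ has exponential decay of correlations for $\mathrm{BV}$ versus $L^\infty$; (ii) $\mu$ is a Gibbs measure which has a density $h$ with respect to a conformal measure $\nu$, $h$ is an eigenfunction of the associated transfer operator $\mathscr{L}$, which has a spectral gap when acting on functions of bounded variation, and $h$ is the unique (up to scalar multiples) eigenfunction for the eigenvalue of maximal modulus. Let $\tilde{x}\in\mathcal{X}$, $\phi(x)=\psi(\mathrm{dist}(x,\tilde{x}))$ with $\psi(y)\to\infty$ as $y\to0$, and let $(r_n)$ be a non-increasing sequence of positive numbers with $r_n\to0$ such that $n\mapsto n\mu(B(\tilde{x},r_n))$ is non-decreasing. Suppose that the sequence of balls $B(\tilde{x},r_n)$ satisfies the short return times condition: $\sum_n\mu(B(\tilde{x},r_n))=\infty$, and there are $s,\gamma,\sigma\in(0,1)$ with $\gamma+s<1$, $$\sigma>\max\Bigl\{\tfrac12(1+\gamma+s),\,1-\gamma,\,\tfrac13(2+s),\,1-\tfrac s2\Bigr\},$$ $\mu(B(\tilde{x},r_n))=O(n^{-\sigma})$, and $$\sum_{1\le j\le n^s}\mu\bigl(B(\tilde{x},r_n)\cap f^{-j}B(\tilde{x},r_n)\bigr)=O\bigl(n^{-1-\gamma}\bigr).$$ Then: (1) If $\sum_{n=1}^\infty\mu(B(\tilde{x},r_n))e^{-n\mu(B(\tilde{x},r_n))}<\infty$, then $\mu(\mathcal{H}_{\mathrm{ea}})=\mu(\psi(r_n)\le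 M_n\text{ ev.})=1$. (2) If $\sum_{n=1}^\infty\mu(B(\tilde{x},r_n))e^{-n\mu(B(\tilde{x},r_n))}=\infty$, then $\mu(\mathcal{H}_{\mathrm{ea}})=\mu(\psi(r_n)\le M_n\text{ ev.})=0$.
   Context: $\mathcal{X}\subset\mathbb{R}$ is an interval with the usual distance $\mathrm{dist}$, $B(x,r)=\{y\in\mathcal{X}:\mathrm{dist}(x,y)<r\}$. The function $\psi\colon[0,\infty)\to\mathbb{R}\cup\{+\infty\}$ is (strictly) decreasing and continuous. Put $X_i=\phi\circ f^{i-1}$, $i\ge1$, $M_n=\max(X_1,\dots,X_n)$. $(E_n\text{ ev.})$ is the set of points belonging to $E_n$ for all large $n$. With $B_m=B(\tilde{x},r_m)$, $\mathcal{H}_{\mathrm{ea}}=\bigcup_{n\ge1}\bigcap_{m\ge n}\bigcup_{k=0}^{m-1}f^{-k}(B_m)$. Exponential decay of correlations for $\mathrm{BV}$ versus $L^\infty$: there are $C,\tau>0$ such that for all $\varphi_1$ of bounded variation, all bounded measurable $\varphi_2$ and all $j$, $|\int\varphi_1\cdot\varphi_2\circ f^j\,\mathrm{d}\mu-\int\varphi_1\,\mathrm{d}\mu\int\varphi_2\,\mathrm{d}\mu|\le Ce^{-\tau j}\|\varphi_1\|_{\mathrm{BV}}\|\varphi_2\|_\infty$, where $\|\varphi\|_{\mathrm{BV}}=\mathrm{var}(\varphi)+\sup|\varphi|$ and $\mathrm{var}$ is total variation. Gibbs measure, conformal measure, transfer operator: there is a function $g\colon\mathcal{X}\to[0,\infty)$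 (with $\log g$ called the potential) and the transfer operator is $\mathscr{L}\psi(x)=\sum_{f(y)=x}g(y)\psi(y)$. There is a probability measure $\nu$ and $\lambda>0$ such that $\int\mathscr{L}\psi\,\mathrm{d}\nu=\lambda\int\psi\,\mathrm{d}\nu$ (conformality of $\nu$), $\mathrm{d}\mu=h\,\mathrm{d}\nu$, $h$ is of bounded variation and $\mathscr{L}h=\lambda h$. Spectral gap: $\mathscr{L}$ is bounded on the space of functions of bounded variation, $\lambda$ is its eigenvalue of maximal modulus, with eigenspace spanned by $h$, and the rest of the spectrum lies in a disc of radius strictly less than $\lambda$. *)

theory Defs
  imports "HOL-Probability.Probability" "HOL-Library.Landau_Symbols"
begin

section \<open>Functions of bounded variation on a subset of the line\<close>

definition variation_sums :: "real set \<Rightarrow> (real \<Rightarrow> 'a::real_normed_vector) \<Rightarrow> real set" where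
  "variation_sums X \<phi> =
     {(\<Sum>i<n. norm (\<phi> (t (Suc i)) - \<phi> (t i))) | n t. mono_on {..n::nat} t \<and> t ` {..n} \<subseteq> X}"

definition bounded_variation_on :: "real set \<Rightarrow> (real \<Rightarrow> 'a::real_normed_vector) \<Rightarrow> bool" where
  "bounded_variation_on X \<phi> \<longleftrightarrow> bdd_above (variation_sums X \<phi>)"

definition total_variation :: "real set \<Rightarrow> (real \<Rightarrow> 'a::real_normed_vector) \<Rightarrow> real" where
  "total_variation X \<phi> = Sup (variation_sums X \<phi>)"

text \<open>On a nonempty \<open>X\<close> a function of bounded variation is bounded, so for such
  functions both suprema below are genuine.\<close>

definition bv_norm :: "real set \<Rightarrow> (real \<Rightarrow> 'a::real_normed_vector) \<Rightarrow> real" where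
  "bv_norm X \<phi> = total_variation X \<phi> + (SUP x\<in>X. norm (\<phi> x))"

text \<open>A function on \<open>X\<close> is represented by its extension by zero, so that equality of elements
  of the following space is equality of functions on \<open>X\<close>. The scalars are complex because
  the space is used for spectral theory.\<close>

definition bv_space :: "real set \<Rightarrow> (real \<Rightarrow> complex) set" where
  "bv_space X = {\<phi>. bounded_variation_on X \<phi> \<and> (\<forall>x. x \<notin> X \<longrightarrow> \<phi> x = 0)}"

definition bv_bounded_operator ::
  "real set \<Rightarrow> ((real \<Rightarrow> complex) \<Rightarrow> real \<Rightarrow> complex) \<Rightarrow> bool" where
  "bv_bounded_operator X T \<longleftrightarrow>
     (\<forall>\<phi>\<in>bv_space X. T \<phi> \<in> bv_space X) \<and>
     (\<forall>\<phi>\<in>bv_space X. \<forall>\<phi>'\<in>bv_space X. T (\<lambda>x. \<phi> x + \<phi>' x) = (\<lambda>x. T \<phi> x + T \<phi>' x)) \<and>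
     (\<forall>c. \<forall>\<phi>\<in>bv_space X. T (\<lambda>x. c * \<phi> x) = (\<lambda>x. c * T \<phi> x)) \<and>
     (\<exists>K. \<forall>\<phi>\<in>bv_space X. bv_norm X (T \<phi>) \<le> K * bv_norm X \<phi>)"

definition bv_spectrum ::
  "real set \<Rightarrow> ((real \<Rightarrow> complex) \<Rightarrow> real \<Rightarrow> complex) \<Rightarrow> complex set" where
  "bv_spectrum X T =
     {z. \<not> (\<exists>S. bv_bounded_operator X S \<and>
            (\<forall>\<phi>\<in>bv_space X. S (\<lambda>x. z * \<phi> x - T \<phi> x) = \<phi> \<and>
                            (\<lambda>x. z * S \<phi> x - T (S \<phi>) x) = \<phi>))}"


section \<open>Transfer operator, conformal measure, spectral gap\<close>

text \<open>The fibre sums are unconditional sums over possibly infinite fibres; the value \<open>infsum\<close>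
  assigns to a non-summable family is excluded by the summability clause in
  \<open>spectral_gap_on_bv\<close>.\<close>

definition transfer_operator ::
  "real set \<Rightarrow> (real \<Rightarrow> real) \<Rightarrow> (real \<Rightarrow> real) \<Rightarrow> (real \<Rightarrow> 'a::real_normed_vector) \<Rightarrow> real \<Rightarrow> 'a" where
  "transfer_operator X f g \<phi> =
     (\<lambda>x. if x \<in> X then (\<Sum>\<^sub>\<infinity>y\<in>{y\<in>X. f y = x}. g y *\<^sub>R \<phi> y) else 0)"

text \<open>Conformality is tested on functions of bounded variation, the space on which the
  transfer operator acts. As indicators of intervals belong to it, a monotone class argument
  extends the identity to bounded Borel functions.\<close>

definition conformal_measure ::
  "real set \<Rightarrow> (real \<Rightarrow> real) \<Rightarrow> (real \<Rightarrow> real) \<Rightarrow> real \<Rightarrow> real measure \<Rightarrow> bool" where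
  "conformal_measure X f g lam \<nu> \<longleftrightarrow>
     (\<forall>\<phi> :: real \<Rightarrow> real. bounded_variation_on X \<phi> \<longrightarrow>
        (\<integral>x. transfer_operator X f g \<phi> x \<partial>\<nu>) = lam * (\<integral>x. \<phi> x \<partial>\<nu>))"

definition spectral_gap_on_bv ::
  "real set \<Rightarrow> (real \<Rightarrow> real) \<Rightarrow> (real \<Rightarrow> real) \<Rightarrow> real \<Rightarrow> (real \<Rightarrow> real) \<Rightarrow> bool" where
  "spectral_gap_on_bv X f g lam h \<longleftrightarrow>
     (\<forall>x\<in>X. g summable_on {y\<in>X. f y = x}) \<and>
     bv_bounded_operator X (transfer_operator X f g) \<and>
     (\<forall>\<phi>\<in>bv_space X. (\<forall>x\<in>X. transfer_operator X f g \<phi> x = of_real lam * \<phi> x) \<longleftrightarrow>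
                      (\<exists>c. \<forall>x\<in>X. \<phi> x = c * of_real (h x))) \<and>
     (\<exists>\<rho><lam. \<forall>z\<in>bv_spectrum X (transfer_operator X f g) - {of_real lam}. cmod z \<le> \<rho>)"


section \<open>Ergodicity and decay of correlations\<close>

definition ergodic_measure :: "('a \<Rightarrow> 'a) \<Rightarrow> 'a measure \<Rightarrow> bool" where
  "ergodic_measure f M \<longleftrightarrow>
     prob_space M \<and> f \<in> measurable M M \<and> distr M M f = M \<and>
     (\<forall>A\<in>sets M. f -` A \<inter> space M = A \<longrightarrow> measure M A = 0 \<or> measure M A = 1)"

definition exp_decay_bv_Linf :: "(real \<Rightarrow> real) \<Rightarrow> real measure \<Rightarrow> bool" where
  "exp_decay_bv_Linf f M \<longleftrightarrow>
     (\<exists>C>0. \<exists>\<tau>>0. \<forall>\<phi>1 \<phi>2 :: real \<Rightarrow> real. \<forall>j::nat.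
        bounded_variation_on (space M) \<phi>1 \<longrightarrow>
        \<phi>2 \<in> borel_measurable M \<longrightarrow> bounded (\<phi>2 ` space M) \<longrightarrow>
        \<bar>(\<integral>x. \<phi>1 x * \<phi>2 ((f ^^ j) x) \<partial>M) - (\<integral>x. \<phi>1 x \<partial>M) * (\<integral>x. \<phi>2 x \<partial>M)\<bar>
          \<le> C * exp (- \<tau> * real j) * bv_norm (space M) \<phi>1
              * real_of_ereal (esssup M (\<lambda>x. ereal \<bar>\<phi>2 x\<bar>)))"


section \<open>Shrinking balls, maxima and eventually always hitting points\<close>

text \<open>Sequences are indexed by positive integers; the value of \<open>r\<close> at \<open>0\<close> is irrelevant.
  Balls are relative to \<open>X\<close>.\<close>

abbreviation rel_ball :: "real set \<Rightarrow> real \<Rightarrow> real \<Rightarrow> real set" where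
  "rel_ball X x \<rho> \<equiv> ball x \<rho> \<inter> X"

definition short_return_times ::
  "(real \<Rightarrow> real) \<Rightarrow> real measure \<Rightarrow> (nat \<Rightarrow> real set) \<Rightarrow> bool" where
  "short_return_times f M B \<longleftrightarrow>
     \<not> summable (\<lambda>n. measure M (B n)) \<and>
     (\<exists>s \<gamma> \<sigma>. s \<in> {0<..<1} \<and> \<gamma> \<in> {0<..<1} \<and> \<sigma> \<in> {0<..<1} \<and> \<gamma> + s < 1 \<and>
        \<sigma> > Max {(1 + \<gamma> + s) / 2, 1 - \<gamma>, (2 + s) / 3, 1 - s / 2} \<and>
        (\<lambda>n. measure M (B n)) \<in> O(\<lambda>n. real n powr (- \<sigma>)) \<and>
        (\<lambda>n. \<Sum>j | 1 \<le> j \<and> real j \<le> real n powr s. measure M (B n \<inter> (f ^^ j) -` B n))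
          \<in> O(\<lambda>n. real n powr (- 1 - \<gamma>)))"

definition H_ea :: "real set \<Rightarrow> (real \<Rightarrow> real) \<Rightarrow> (nat \<Rightarrow> real set) \<Rightarrow> real set" where
  "H_ea X f B = (\<Union>n\<in>{1..}. \<Inter>m\<in>{n..}. \<Union>k<m. (f ^^ k) -` B m \<inter> X)"

definition running_max ::
  "(real \<Rightarrow> real) \<Rightarrow> (real \<Rightarrow> ereal) \<Rightarrow> nat \<Rightarrow> real \<Rightarrow> ereal" where
  "running_max f \<phi> n x = Max ((\<lambda>i. \<phi> ((f ^^ (i - 1)) x)) ` {1..n})"

definition ev_exceed ::
  "real set \<Rightarrow> (real \<Rightarrow> real) \<Rightarrow> (real \<Rightarrow> ereal) \<Rightarrow> (nat \<Rightarrow> ereal) \<Rightarrow> real set" where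
  "ev_exceed X f \<phi> u = {x\<in>X. eventually (\<lambda>n. u n \<le> running_max f \<phi> n x) sequentially}"

end

theory Submission
  imports Defs "HOL-Real_Asymp.Real_Asymp"
begin

text \<open>Write \<open>p n\<close> for the measure of the ball \<open>B n\<close>. Cutting an orbit of length \<open>n\<close> into blocks of
  length \<open>n powr s\<close> separated by logarithmic gaps, decay of correlations and the short return times
  show that it avoids \<open>B n\<close> with probability about \<open>exp (- n * p n)\<close>, up to a polynomially small
  additive error; the block-by-block argument works with an arbitrary event in the future.
  Along nodes \<open>n\<^sub>k\<close> with \<open>n\<^sub>k\<^sub>+\<^sub>1 - n\<^sub>k\<close> about \<open>1 / p n\<^sub>k\<close> the series of these probabilities is comparable
  to the series of the theorem, and the convergence part is the first Borel--Cantelli lemma.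

  For divergence it suffices, by a zero-one law, to give the event that infinitely many balls are missed
  positive probability, by a second-moment argument. Pairs of nodes that are close are
  treated by the block argument. For distant pairs an additive error does not suffice; there the
  transfer operator of the system with a hole shows that the past has a density of bounded variation
  with exponentially bounded norm, so that a gap proportional to the length of the past
  decorrelates it from the future. Boundedness of the transfer operator and conformality are all that
  is used of the spectral hypotheses.\<close>

section \<open>Nodes of a slowly decreasing sequence\<close>

text \<open>The additive error of the block bound at the earlier node \<open>node j\<close> of a
  pair has no decay in \<open>k\<close>, so it cannot be summed over the later nodes. This obstacle
  dictates how pairs are split, with the threshold \<open>node j * p (node k) = 1\<close>. Above the
  threshold, \<open>k - j\<close> is at most of the order of the square of
  \<open>ln (node k)\<close>, and \<open>node k\<close> is at most polynomial in
  \<open>node j\<close>; a small power of \<open>node j\<close> taken from the error then buys decay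
  in \<open>sqrt (k - j)\<close>. Below it, waiting for a multiple of \<open>node j\<close> steps
  changes the expected number of visits to the later ball only by a bounded amount. A gap of that
  length is therefore affordable, and it beats even a crude exponential bound on the density of the
  orbits that have avoided the hole. Nodes with \<open>level k > 2 * ln (node k)\<close> are
  discarded in the divergence part, as they contribute only a convergent series.\<close>

locale hitting_rates =
  fixes p :: "nat \<Rightarrow> real"
  assumes p_pos: "1 \<le> n \<Longrightarrow> 0 < p n"
    and p_le_1: "p n \<le> 1"
    and p_antimono: "1 \<le> m \<Longrightarrow> m \<le> n \<Longrightarrow> p n \<le> p m"
    and p_scaled_mono: "1 \<le> m \<Longrightarrow> m \<le> n \<Longrightarrow> real m * p m \<le> real n * p n"
begin

text \<open>The product \<open>n * p n\<close> increases by at most \<open>2\<close> from one node to the next, while the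
  sum of \<open>p\<close> between them stays bounded away from \<open>0\<close> and \<open>\<infinity>\<close>.\<close>

primrec node :: "nat \<Rightarrow> nat" where
  "node 0 = 1"
| "node (Suc k) = node k + nat \<lceil>1 / p (node k)\<rceil>"

definition level :: "nat \<Rightarrow> real" where
  "level k = real (node k) * p (node k)"

text \<open>Bounds the quotient of consecutive nodes: the step at a node \<open>n\<close> is at most
  \<open>2 / p n\<close>, and \<open>n * p n \<ge> p 1\<close> turns this into a multiple of
  \<open>n\<close>.\<close>

definition node_ratio :: real where
  "node_ratio = 1 + 2 / p 1"

lemma node_ge_1: "1 \<le> node k"
  by (induction k) auto

lemma p_node_pos: "0 < p (node k)"
  using node_ge_1 p_pos by auto

lemma node_step:
  "1 / p (node k) \<le> real (node (Suc k)) - real (node k)"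
  "real (node (Suc k)) - real (node k) \<le> 2 / p (node k)"
proof -
  have 1: "1 \<le> 1 / p (node k)"
    using p_node_pos[of k] p_le_1[of "node k"] by simp
  have "real (node (Suc k)) - real (node k) = of_int \<lceil>1 / p (node k)\<rceil>"
    using 1 by simp
  moreover have "of_int \<lceil>1 / p (node k)\<rceil> < 1 / p (node k) + 1"
    by linarith
  moreover have "2 / p (node k) = 1 / p (node k) + 1 / p (node k)"
    by simp
  ultimately show "1 / p (node k) \<le> real (node (Suc k)) - real (node k)"
    "real (node (Suc k)) - real (node k) \<le> 2 / p (node k)"
    using 1 by linarith+
qed

declare node.simps(2) [simp del]

lemma node_less_Suc: "node k < node (Suc k)"
proof -
  have "0 < 1 / p (node k)" using p_node_pos[of k] by simp
  then show ?thesis using node_step(1)[of k] by linarith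
qed

lemma strict_mono_node: "strict_mono node"
  using node_less_Suc by (simp add: strict_mono_Suc_iff)

lemma node_mono: "j \<le> k \<Longrightarrow> node j \<le> node k"
  using strict_mono_node by (simp add: strict_mono_less_eq)

lemma node_gt: "k < node k"
proof (induction k)
  case (Suc k)
  then show ?case using node_less_Suc[of k] by linarith
qed simp

lemma level_mono: "j \<le> k \<Longrightarrow> level j \<le> level k"
  unfolding level_def using node_mono node_ge_1 p_scaled_mono by blast

lemma level_ge: "p 1 \<le> level k"
  using level_mono[of 0 k] by (simp add: level_def)

lemma level_pos: "0 < level k"
  using level_ge[of k] p_pos[of 1] by simp

lemma node_ratio_ge_1: "1 \<le> node_ratio"
  unfolding node_ratio_def using p_pos[of 1] by simp

lemma node_Suc_le: "real (node (Suc k)) \<le> node_ratio * real (node k)"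
proof -
  have n: "0 < real (node k)" using node_ge_1[of k] by simp
  have "2 / p (node k) = 2 * real (node k) / level k"
    using n unfolding level_def by (simp add: field_simps)
  also have "\<dots> \<le> 2 * real (node k) / p 1"
    using level_ge[of k] p_pos[of 1] by (intro divide_left_mono) auto
  finally have "2 / p (node k) \<le> 2 / p 1 * real (node k)" by simp
  then show ?thesis
    using node_step(2)[of k] unfolding node_ratio_def by (simp add: algebra_simps)
qed

text \<open>Between two nodes a miss is compared with the time of the earlier node and the ball of
  the later one. The step is at most \<open>2 / p (node k)\<close> and \<open>p\<close> decreases,
  so this mismatch lowers the exponent by at most 2.\<close>

lemma level_le_shifted: "level k - 2 \<le> real (node k) * p (node (Suc k))"
proof -
  have "level k \<le> real (node (Suc k)) * p (node (Suc k))"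
    using level_mono[of k "Suc k"] by (simp add: level_def[of "Suc k"])
  also have "\<dots> = real (node k) * p (node (Suc k)) + (real (node (Suc k)) - real (node k)) * p (node (Suc k))"
    by (simp add: algebra_simps)
  also have "(real (node (Suc k)) - real (node k)) * p (node (Suc k)) \<le> 2 / p (node k) * p (node k)"
    using node_step[of k] p_antimono[OF node_ge_1[of k], of "node (Suc k)"]
      node_mono[of k "Suc k"] p_node_pos[of k] p_node_pos[of "Suc k"]
    by (intro mult_mono) auto
  also have "\<dots> = 2" using p_node_pos[of k] by simp
  finally show ?thesis by simp
qed

text \<open>Monotonicity of \<open>n * p n\<close> prevents \<open>p\<close> from dropping by more
  than the factor by which \<open>n\<close> has grown, and that factor is at most
  \<open>node_ratio\<close> within a block.\<close>

lemma p_between_nodes: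
  assumes "node k \<le> n" "n < node (Suc k)"
  shows "p (node k) / node_ratio \<le> p n"
proof -
  have n: "1 \<le> n" "real n \<le> node_ratio * real (node k)"
    using assms node_ge_1[of k] node_Suc_le[of k] by linarith+
  have "real (node k) * p (node k) \<le> real n * p n"
    using assms node_ge_1 p_scaled_mono by blast
  also have "\<dots> \<le> node_ratio * real (node k) * p n"
    using n p_pos[of n] by (intro mult_right_mono) auto
  finally have "real (node k) * p (node k) \<le> real (node k) * (node_ratio * p n)"
    by (simp add: mult_ac)
  then have "p (node k) \<le> node_ratio * p n"
    using node_ge_1[of k] by simp
  then show ?thesis using node_ratio_ge_1 by (simp add: field_simps)
qed

lemma sum_node_blocks:
  fixes b :: "nat \<Rightarrow> real"
  shows "(\<Sum>k<K. \<Sum>n=node k..<node (Suc k). b n) = (\<Sum>n=1..<node K. b n)"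
proof (induction K)
  case (Suc K)
  have "(\<Sum>n=1..<node K. b n) + (\<Sum>n=node K..<node (Suc K). b n) = (\<Sum>n=1..<node (Suc K). b n)"
    using node_ge_1[of K] node_less_Suc[of K] by (intro sum.atLeastLessThan_concat) simp_all
  then show ?case using Suc by simp
qed simp

text \<open>A condensation principle: the block starting at \<open>node k\<close> has at least
  \<open>1 / p (node k)\<close> indices, on each of which \<open>p n * b n\<close> is at least a
  fixed multiple of \<open>p (node k) * b (node k)\<close>. Each block thus contributes at least a
  constant times \<open>b (node k)\<close>.\<close>

lemma summable_at_nodes:
  fixes b :: "nat \<Rightarrow> real"
  assumes sum: "summable (\<lambda>n. p n * b n)"
    and nn: "\<And>n. 0 \<le> b n" and D: "0 < D"
    and b: "\<And>k n. node k \<le> n \<Longrightarrow> n < node (Suc k) \<Longrightarrow> b (node k) \<le> D * b n"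
  shows "summable (\<lambda>k. b (node k))"
proof (rule summableI_nonneg_bounded)
  fix K
  have nnp: "0 \<le> p n * b n" if "1 \<le> n" for n using that nn p_pos[of n] by simp
  have block: "b (node k) \<le> D * node_ratio * (\<Sum>n=node k..<node (Suc k). p n * b n)" for k
  proof -
    have "b (node k) / (D * node_ratio) = 1 / p (node k) * (p (node k) / node_ratio * (b (node k) / D))"
      using p_node_pos[of k] by simp
    also have "\<dots> \<le> real (card {node k..<node (Suc k)}) * (p (node k) / node_ratio * (b (node k) / D))"
      using node_step(1)[of k] node_less_Suc[of k] nn p_node_pos[of k] node_ratio_ge_1 D
      by (intro mult_right_mono) (auto simp: of_nat_diff)
    also have "\<dots> \<le> (\<Sum>n=node k..<node (Suc k). p n * b n)"
    proof (rule sum_bounded_below)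
      fix n assume "n \<in> {node k..<node (Suc k)}"
      then have n: "node k \<le> n" "n < node (Suc k)" by auto
      show "p (node k) / node_ratio * (b (node k) / D) \<le> p n * b n"
        using p_between_nodes[OF n] b[OF n] nn D p_node_pos[of k] node_ratio_ge_1
          p_pos[of n] n node_ge_1[of k]
        by (intro mult_mono) (auto simp: field_simps)
    qed
    finally show ?thesis using D node_ratio_ge_1 by (simp add: field_simps)
  qed
  have "(\<Sum>k<K. b (node k)) \<le> (\<Sum>k<K. D * node_ratio * (\<Sum>n=node k..<node (Suc k). p n * b n))"
    by (intro sum_mono block)
  also have "\<dots> = D * node_ratio * (\<Sum>n=1..<node K. p n * b n)"
    unfolding sum_distrib_left[symmetric] sum_node_blocks ..
  \<comment> \<open>Nothing makes \<open>p 0\<close> nonnegative, so the term at 0 is masked before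
    partial sums are compared with the series.\<close>
  also have "(\<Sum>n=1..<node K. p n * b n) = (\<Sum>n<node K. if 1 \<le> n then p n * b n else 0)"
    by (subst sum.inter_filter[symmetric]) (auto intro!: sum.cong)
  also have "\<dots> \<le> (\<Sum>n. if 1 \<le> n then p n * b n else 0)"
  proof (rule sum_le_suminf)
    have "summable (\<lambda>n. if 1 \<le> n then p n * b n else 0) \<longleftrightarrow> summable (\<lambda>n. p n * b n)"
      by (rule summable_cong, rule eventually_mono[OF eventually_ge_at_top[of "1::nat"]]) simp
    then show "summable (\<lambda>n. if 1 \<le> n then p n * b n else 0)" using sum by simp
  qed (use nnp in auto)
  finally show "(\<Sum>k<K. b (node k)) \<le> D * node_ratio * (\<Sum>n. if 1 \<le> n then p n * b n else 0)"
    using D node_ratio_ge_1 by simp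
qed (use nn in auto)

text \<open>Within a block \<open>n * p n\<close> exceeds \<open>level k\<close> by at most 2, as
  the block has length at most \<open>2 / p (node k)\<close>; hence the constant
  \<open>exp 2\<close> in the condensation.\<close>

lemma summable_level_exp:
  assumes "summable (\<lambda>n. p n * exp (- real n * p n))"
  shows "summable (\<lambda>k. exp (- level k))"
proof -
  have "exp (- (real (node k) * p (node k))) \<le> exp 2 * exp (- (real n * p n))"
    if n: "node k \<le> n" "n < node (Suc k)" for k n
  proof -
    have "real n * p n \<le> real (node (Suc k)) * p (node k)"
      using n p_antimono[OF node_ge_1 n(1)] p_pos[of n] node_ge_1[of k] by (intro mult_mono) auto
    also have "\<dots> \<le> (real (node k) + 2 / p (node k)) * p (node k)"
      using node_step(2)[of k] p_node_pos[of k] by (intro mult_right_mono) auto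
    also have "\<dots> = real (node k) * p (node k) + 2"
      using p_node_pos[of k] by (simp add: field_simps)
    finally show ?thesis by (simp flip: exp_add)
  qed
  then show ?thesis
    using summable_at_nodes[of "\<lambda>n. exp (- (real n * p n))" "exp 2"] assms
    by (simp add: level_def)
qed

lemma summable_node_powr:
  assumes "summable (\<lambda>n. p n * real n powr (- \<eta>))" "0 \<le> \<eta>"
  shows "summable (\<lambda>k. real (node k) powr (- \<eta>))"
proof (rule summable_at_nodes[where D = "node_ratio powr \<eta>"])
  fix k n assume n: "node k \<le> n" "n < node (Suc k)"
  have pos: "0 < real (node k)" "0 < real n" using node_ge_1[of k] n by auto
  have "real n \<le> node_ratio * real (node k)"
    using n node_Suc_le[of k] by linarith
  then have "real n powr \<eta> \<le> node_ratio powr \<eta> * real (node k) powr \<eta>"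
    using pos assms(2) node_ratio_ge_1 by (metis powr_mono2 powr_mult less_imp_le order_trans zero_le_one)
  then show "real (node k) powr (- \<eta>) \<le> node_ratio powr \<eta> * real n powr (- \<eta>)"
    using pos by (simp add: powr_minus field_simps)
qed (use assms node_ratio_ge_1 in auto)

text \<open>The reverse condensation: a block has at most \<open>2 / p (node k)\<close> indices, and
  its first index has both the largest \<open>p n\<close> and the smallest \<open>n * p n\<close>. A
  block sum is therefore at most \<open>2 * exp (- level k)\<close>.\<close>

lemma not_summable_level_exp:
  assumes "\<not> summable (\<lambda>n. p n * exp (- real n * p n))"
  shows "\<not> summable (\<lambda>k. exp (- level k))"
proof
  assume s: "summable (\<lambda>k. exp (- level k))"
  have block: "(\<Sum>n=node k..<node (Suc k). p n * exp (- real n * p n)) \<le> 2 * exp (- level k)" for k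
  proof -
    have "(\<Sum>n=node k..<node (Suc k). p n * exp (- real n * p n))
        \<le> real (card {node k..<node (Suc k)}) * (p (node k) * exp (- level k))"
    proof (rule sum_bounded_above)
      fix n assume "n \<in> {node k..<node (Suc k)}"
      then have n: "node k \<le> n" "n < node (Suc k)" by auto
      show "p n * exp (- real n * p n) \<le> p (node k) * exp (- level k)"
        using p_antimono[OF node_ge_1 n(1)] p_scaled_mono[OF node_ge_1 n(1)] p_node_pos[of k]
        unfolding level_def by (intro mult_mono) auto
    qed
    also have "\<dots> \<le> 2 / p (node k) * (p (node k) * exp (- level k))"
      using node_step(2)[of k] node_less_Suc[of k] p_node_pos[of k]
      by (intro mult_right_mono) (auto simp: of_nat_diff)
    finally show ?thesis using p_node_pos[of k] by simp
  qed
  define c where "c n = (if 1 \<le> n then p n * exp (- real n * p n) else 0)" for n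
  have c0: "0 \<le> c n" for n using p_pos[of n] by (cases "1 \<le> n") (simp_all add: c_def)
  have "summable c"
  proof (rule summableI_nonneg_bounded)
    fix K
    have "(\<Sum>n<K. c n) \<le> (\<Sum>n<node K. c n)"
      using node_gt[of K] c0 by (intro sum_mono2) auto
    also have "\<dots> = (\<Sum>n=1..<node K. p n * exp (- real n * p n))"
      unfolding c_def by (subst sum.inter_filter[symmetric]) (auto intro!: sum.cong)
    also have "\<dots> \<le> (\<Sum>k<K. 2 * exp (- level k))"
      unfolding sum_node_blocks[symmetric] by (intro sum_mono block)
    also have "\<dots> \<le> (\<Sum>k. 2 * exp (- level k))"
      using s by (intro sum_le_suminf summable_mult) auto
    finally show "(\<Sum>n<K. c n) \<le> (\<Sum>k. 2 * exp (- level k))" .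
  qed (rule c0)
  moreover have "summable c \<longleftrightarrow> summable (\<lambda>n. p n * exp (- real n * p n))"
    by (rule summable_cong, rule eventually_mono[OF eventually_ge_at_top[of "1::nat"]]) (simp add: c_def)
  ultimately show False using assms by simp
qed

text \<open>If \<open>node j * p (node k) > 1\<close>, the node \<open>k\<close> is so close to \<open>j\<close> that
  \<open>node k / node j < level k\<close>; as consecutive nodes between them differ by at least
  \<open>node j / level k\<close>, this forces \<open>(k - j) / level k < level k\<close>.\<close>

lemma close_nodes:
  assumes jk: "j < k" and close: "1 < real (node j) * p (node k)"
  shows "sqrt (real (k - j)) \<le> level k"
    and "sqrt (real (k - j)) / 2 \<le> real (node k - node j) * p (node k)"
proof -
  define u where "u = real (k - j)"
  define a where "a = real (node j)"
  define b where "b = real (node k)"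
  have pos: "0 < a" "0 < b" "0 < p (node k)" "0 < p (node j)" "1 \<le> u"
    using node_ge_1[of j] node_ge_1[of k] p_node_pos jk by (auto simp: u_def a_def b_def)
  \<comment> \<open>As \<open>p\<close> decreases, the lower bound \<open>1 / p (node j)\<close> for
    the step at \<open>j\<close> holds for all later steps as well.\<close>
  have gap: "u / p (node j) \<le> b - a"
  proof -
    have "real i / p (node j) \<le> real (node (j + i)) - real (node j)" for i
    proof (induction i)
      case (Suc i)
      have "1 / p (node j) \<le> 1 / p (node (j + i))"
        using p_antimono[OF node_ge_1 node_mono[of j "j + i"]] p_node_pos
        by (intro divide_left_mono) auto
      then show ?case using Suc node_step(1)[of "j + i"] by (simp add: add_divide_distrib)
    qed simp
    from this[of "k - j"] show ?thesis using jk by (simp add: u_def a_def b_def)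
  qed
  have lev: "level k = b * p (node k)" "level j = a * p (node j)" "level j \<le> level k"
    using jk level_mono[of j k] by (auto simp: level_def a_def b_def)
  have ab: "a \<le> b" using jk node_mono[of j k] by (simp add: a_def b_def)
  have cl: "1 < a * p (node k)" using close by (simp add: a_def)
  \<comment> \<open>Closeness enters as the factor \<open>a * p (node k) > 1\<close>, inserted at
    the end: it turns \<open>b\<close> into \<open>level k * a\<close>, and \<open>a\<close> can be
    cancelled.\<close>
  have "u < (level k)\<^sup>2"
  proof -
    have "u * a \<le> level j * (b - a)"
    proof -
      have "u \<le> (b - a) * p (node j)" using gap pos by (simp add: pos_divide_le_eq)
      then have "u * a \<le> (b - a) * p (node j) * a" using pos by (intro mult_right_mono) auto
      then show ?thesis by (simp add: lev mult_ac)
    qed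
    also have "\<dots> \<le> level k * (b - a)"
      using lev(3) ab by (intro mult_right_mono) auto
    also have "\<dots> < level k * b"
      using pos level_pos[of k] by simp
    also have "\<dots> \<le> level k * (b * (a * p (node k)))"
      using pos cl level_pos[of k] by (intro mult_left_mono) auto
    also have "\<dots> = (level k)\<^sup>2 * a" by (simp add: lev power2_eq_square)
    finally show ?thesis using pos by simp
  qed
  then have su: "sqrt u < level k"
    using level_pos[of k] by (simp add: real_less_lsqrt)
  then show "sqrt (real (k - j)) \<le> level k" by (simp add: u_def)
  have sq: "sqrt u \<le> u" using pos by (simp add: real_le_lsqrt power2_eq_square)
  \<comment> \<open>If \<open>b\<close> is at least \<open>2 * a\<close>, then \<open>b - a\<close>
    is at least half of \<open>b\<close> and the bound on \<open>sqrt u\<close> is enough. Otherwise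
    \<open>p\<close> has at most halved between the two nodes, and counting the \<open>u\<close>
    steps gives \<open>u / 2\<close>.\<close>
  have "sqrt u / 2 \<le> (b - a) * p (node k)"
  proof (cases "2 * a \<le> b")
    case True
    have "sqrt u / 2 \<le> b / 2 * p (node k)" using su by (simp add: lev)
    also have "\<dots> \<le> (b - a) * p (node k)"
      using True pos by (intro mult_right_mono) auto
    finally show ?thesis .
  next
    case False
    have "a * p (node j) \<le> b * p (node k)" using lev by simp
    also have "\<dots> \<le> 2 * a * p (node k)" using False pos by (intro mult_right_mono) auto
    finally have "p (node j) \<le> 2 * p (node k)" using pos by simp
    then have "1 / 2 \<le> p (node k) / p (node j)" using pos by (simp add: field_simps)
    then have "u * (1 / 2) \<le> u * (p (node k) / p (node j))" using pos by (intro mult_left_mono) auto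
    also have "\<dots> = u / p (node j) * p (node k)" by simp
    also have "\<dots> \<le> (b - a) * p (node k)" using gap pos by (intro mult_right_mono) auto
    finally show ?thesis using sq by simp
  qed
  then show "sqrt (real (k - j)) / 2 \<le> real (node k - node j) * p (node k)"
    using jk node_mono[of j k] by (simp add: u_def a_def b_def of_nat_diff)
qed

end

section \<open>A second Borel--Cantelli lemma for correlated events\<close>

context prob_space
begin

text \<open>Cauchy-Schwarz for the counting function \<open>Y\<close> and the indicator of the union
  \<open>U\<close>, on which \<open>Y\<close> is supported.\<close>

lemma chung_erdos:
  assumes E: "\<And>k. k \<in> I \<Longrightarrow> E k \<in> events" and I: "finite I"
  shows "(\<Sum>k\<in>I. prob (E k))\<^sup>2 \<le> prob (\<Union>k\<in>I. E k) * (\<Sum>j\<in>I. \<Sum>k\<in>I. prob (E j \<inter> E k))"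
proof -
  define U where "U = (\<Union>k\<in>I. E k)"
  define Y where "Y x = (\<Sum>k\<in>I. indicator (E k) x :: real)" for x
  have U: "U \<in> events" unfolding U_def using E I by blast
  have [measurable]: "Y \<in> borel_measurable M"
    unfolding Y_def using E by (intro borel_measurable_sum) auto
  have Ys: "(Y x)\<^sup>2 = (\<Sum>j\<in>I. \<Sum>k\<in>I. indicator (E j \<inter> E k) x)" for x
    unfolding Y_def power2_eq_square sum_product by (simp add: indicator_inter_arith)
  have YU: "Y x * indicator U x = Y x" for x
    unfolding Y_def U_def by (cases "x \<in> (\<Union>k\<in>I. E k)") (auto simp: indicator_def)
  have eY: "expectation Y = (\<Sum>k\<in>I. prob (E k))"
    unfolding Y_def using E by (subst Bochner_Integration.integral_sum) (auto simp: less_top[symmetric])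
  have eYs: "expectation (\<lambda>x. (Y x)\<^sup>2) = (\<Sum>j\<in>I. \<Sum>k\<in>I. prob (E j \<inter> E k))"
    unfolding Ys using E
    by (subst Bochner_Integration.integral_sum) 
      (auto intro!: sum.cong Bochner_Integration.integrable_sum simp: Bochner_Integration.integral_sum less_top[symmetric])
  have iYs: "integrable M (\<lambda>x. (Y x)\<^sup>2)"
    unfolding Ys using E by (intro Bochner_Integration.integrable_sum) (auto simp: less_top[symmetric])
  have iY: "integrable M Y"
    unfolding Y_def using E by (intro Bochner_Integration.integrable_sum) (auto simp: less_top[symmetric])
  have iU: "integrable M (indicator U :: _ \<Rightarrow> real)"
    using U by (simp add: less_top[symmetric])
  have eU: "expectation (indicator U) = prob U"
    using sets.sets_into_space[OF U] by (simp add: Int_absorb2)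
  \<comment> \<open>The discriminant form of Cauchy-Schwarz. Below, \<open>c\<close> is the
    minimiser \<open>expectation Y / prob U\<close>, so the case \<open>prob U = 0\<close> is
    separated off.\<close>
  have quad: "0 \<le> expectation (\<lambda>x. (Y x)\<^sup>2) - 2 * c * expectation Y + c\<^sup>2 * prob U" for c
  proof -
    have "0 \<le> expectation (\<lambda>x. (Y x - c * indicator U x)\<^sup>2)" by simp
    also have "(\<lambda>x. (Y x - c * indicator U x)\<^sup>2)
        = (\<lambda>x. (Y x)\<^sup>2 - 2 * c * Y x + c\<^sup>2 * indicator U x)"
    proof
      fix x
      have "(Y x - c * indicator U x)\<^sup>2 = (Y x)\<^sup>2 - 2 * c * (Y x * indicator U x) + c\<^sup>2 * (indicator U x)\<^sup>2"
        by (simp add: power2_eq_square algebra_simps)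
      then show "(Y x - c * indicator U x)\<^sup>2 = (Y x)\<^sup>2 - 2 * c * Y x + c\<^sup>2 * indicator U x"
        unfolding YU by (simp add: indicator_def)
    qed
    also have "expectation \<dots> = expectation (\<lambda>x. (Y x)\<^sup>2) - 2 * c * expectation Y + c\<^sup>2 * prob U"
      using iY iYs iU sets.sets_into_space[OF U] by (simp add: Int_absorb2)
    finally show ?thesis .
  qed
  have "(expectation Y)\<^sup>2 \<le> prob U * expectation (\<lambda>x. (Y x)\<^sup>2)"
  proof (cases "prob U = 0")
    case True
    have "prob (E k) = 0" if "k \<in> I" for k
    proof -
      have "E k \<subseteq> U" using that by (auto simp: U_def)
      then have "prob (E k) \<le> prob U" using U by (intro finite_measure_mono)
      then show ?thesis using True measure_nonneg[of M "E k"] by linarith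
    qed
    then show ?thesis by (simp add: eY True)
  next
    case False
    then have pU: "0 < prob U" by (simp add: zero_less_measure_iff)
    have "0 \<le> prob U * (expectation (\<lambda>x. (Y x)\<^sup>2) - 2 * (expectation Y / prob U) * expectation Y
        + (expectation Y / prob U)\<^sup>2 * prob U)"
      using quad[of "expectation Y / prob U"] pU by (intro mult_nonneg_nonneg) linarith+
    also have "\<dots> = prob U * expectation (\<lambda>x. (Y x)\<^sup>2) - (expectation Y)\<^sup>2"
      using pU by (simp add: field_simps power2_eq_square)
    finally show ?thesis by simp
  qed
  then show ?thesis by (simp add: eY eYs U_def)
qed

text \<open>Here \<open>a\<close> is the main size of the probabilities, \<open>e\<close> a summable
  error, and \<open>d\<close> the excess correlation of a pair as a function of its distance. The
  second-moment bound is applied on every tail with a \<open>\<delta>\<close> that does not depend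
  on where the tail starts, so it survives the passage to the limit superior.\<close>

lemma second_borel_cantelli_correlated:
  fixes a d e :: "nat \<Rightarrow> real"
  assumes E: "\<And>k. E k \<in> events"
    and a: "\<And>k. 0 \<le> a k" "\<not> summable a"
    and e: "\<And>k. 0 \<le> e k" "summable e"
    and d: "\<And>i. 0 \<le> d i" "summable d"
    and c: "0 < c" and C: "0 < C"
    and lower: "\<And>k. c * a k - C * e k \<le> prob (E k)"
    and upper: "\<And>k. prob (E k) \<le> C * (a k + e k)"
    and pair: "\<And>j k. j < k \<Longrightarrow>
      prob (E j \<inter> E k) \<le> C * ((a j + e j) * (a k + e k) + (a j + e j) * d (k - j))"
  shows "0 < prob (\<Inter>K. \<Union>k\<in>{K..}. E k)"
proof -
  define b where "b k = a k + e k" for k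
  \<comment> \<open>The value 1 at distance 0 absorbs the diagonal, where
    \<open>prob (E j \<inter> E j)\<close> is only bounded by \<open>C * b j\<close>.\<close>
  define d' where "d' i = (if i = 0 then 1 else d i)" for i
  define Se where "Se = suminf e"
  define D where "D = suminf d'"
  \<comment> \<open>The quotient of \<open>(c * S / 2) ^ 2\<close>, a lower bound for the squared
    first moment, by the second-moment bound \<open>C * (4 + 4 * D) * S ^ 2\<close>, where
    \<open>S\<close> is the sum of \<open>a\<close> over a long stretch.\<close>
  define \<delta> where "\<delta> = c\<^sup>2 / (4 * (C * (4 + 4 * D)))"
  have b0: "0 \<le> b k" for k using a e by (simp add: b_def)
  have d'0: "0 \<le> d' i" for i using d by (simp add: d'_def)
  have d's: "summable d'"
  proof -
    have "summable d' \<longleftrightarrow> summable d"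
      by (rule summable_cong, rule eventually_mono[OF eventually_ge_at_top[of "1::nat"]])
         (simp add: d'_def)
    then show ?thesis using d by simp
  qed
  have D0: "0 \<le> D" unfolding D_def using d'0 d's by (rule suminf_nonneg[rotated])
  have Se0: "0 \<le> Se" unfolding Se_def using e by (intro suminf_nonneg) auto
  have \<delta>0: "0 < \<delta>" unfolding \<delta>_def using c C D0 by (simp add: zero_less_divide_iff)
  have pair_le: "prob (E j \<inter> E k) \<le> C * (b j * b k + (if j \<le> k then b j * d' (k - j) else 0)
      + (if k \<le> j then b k * d' (j - k) else 0))" for j k
  proof (cases j k rule: linorder_cases)
    case less then show ?thesis using pair[OF less] by (simp add: b_def d'_def)
  next
    case equal
    have "prob (E j) \<le> C * b j" using upper by (simp add: b_def)
    moreover have "0 \<le> C * (b j * b j)" "0 \<le> C * b j" using C b0 by simp_all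
    ultimately show ?thesis using equal by (simp add: d'_def distrib_left)
  next
    case greater then show ?thesis using pair[OF greater] by (simp add: b_def d'_def Int_commute mult.commute[of "a j + e j"])
  qed
  have tail: "(\<Sum>k\<in>{K..<N}. if j \<le> k then d' (k - j) else 0) \<le> D" for j K N
  proof -
    have "(\<Sum>k\<in>{K..<N}. if j \<le> k then d' (k - j) else 0) = (\<Sum>k\<in>{k\<in>{K..<N}. j \<le> k}. d' (k - j))"
      by (rule sum.inter_filter[symmetric]) simp
    also have "\<dots> = (\<Sum>i\<in>(\<lambda>k. k - j) ` {k\<in>{K..<N}. j \<le> k}. d' i)"
      by (subst sum.reindex) (auto simp: inj_on_def)
    also have "\<dots> \<le> D" unfolding D_def using d's d'0 by (intro sum_le_suminf) auto
    finally show ?thesis .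
  qed
  have union: "\<delta> \<le> prob (\<Union>k\<in>{K..}. E k)" for K
  proof -
    \<comment> \<open>\<open>S \<ge> 1\<close> makes linear terms quadratic,
      \<open>S \<ge> Se\<close> gives \<open>T \<le> 2 * S\<close>, and
      \<open>S \<ge> 2 * C * Se / c\<close> lets the errors consume at most half of the first
      moment.\<close>
    obtain N where N: "max 1 (max (2 * C * Se / c) Se) < (\<Sum>k\<in>{K..<N}. a k)"
    proof -
      have ns: "\<not> summable (\<lambda>k. a (k + K))" using a(2) summable_iff_shift[of a K] by simp
      have "\<not> (\<forall>N. (\<Sum>k<N. a (k + K)) \<le> max 1 (max (2 * C * Se / c) Se))"
        using summableI_nonneg_bounded[of "\<lambda>k. a (k + K)"] a(1) ns by metis
      then obtain N where "max 1 (max (2 * C * Se / c) Se) < (\<Sum>k<N. a (k + K))" by (auto simp: not_le)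
      also have "(\<Sum>k<N. a (k + K)) = (\<Sum>k\<in>{K..<N + K}. a k)"
        using sum.shift_bounds_nat_ivl[of a 0 K N] by (simp add: atLeast0LessThan)
      finally show ?thesis using that by blast
    qed
    define I where "I = {K..<N}"
    define S where "S = (\<Sum>k\<in>I. a k)"
    define T where "T = (\<Sum>k\<in>I. b k)"
    have S: "1 \<le> S" "2 * C * Se / c \<le> S" "Se \<le> S" using N by (auto simp: S_def I_def)
    have eI: "(\<Sum>k\<in>I. e k) \<le> Se" unfolding Se_def using e by (intro sum_le_suminf) (auto simp: I_def)
    have T: "T \<le> 2 * S" "0 \<le> T"
      using eI S b0 unfolding T_def b_def sum.distrib S_def[symmetric]
      by (auto intro: add_nonneg_nonneg sum_nonneg a e simp: S_def)
    have low: "c * S / 2 \<le> (\<Sum>k\<in>I. prob (E k))"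
    proof -
      have "c * S - C * Se \<le> (\<Sum>k\<in>I. c * a k - C * e k)"
        using eI C by (simp add: sum_subtractf sum_distrib_left[symmetric] S_def)
      also have "\<dots> \<le> (\<Sum>k\<in>I. prob (E k))" by (intro sum_mono lower)
      also have "c * S - C * Se \<ge> c * S / 2" using S c by (simp add: field_simps)
      finally show ?thesis by simp
    qed
    \<comment> \<open>The pairs on or above the diagonal. By symmetry the others give the same sum,
      and counting the diagonal twice does no harm to an upper bound.\<close>
    define H where "H = (\<Sum>j\<in>I. \<Sum>k\<in>I. if j \<le> k then b j * d' (k - j) else 0)"
    have half: "H \<le> T * D"
    proof -
      have "H
          = (\<Sum>j\<in>I. b j * (\<Sum>k\<in>I. if j \<le> k then d' (k - j) else 0))"
        by (simp add: H_def sum_distrib_left if_distrib cong: if_cong)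
      also have "\<dots> \<le> (\<Sum>j\<in>I. b j * D)"
        using tail b0 unfolding I_def by (intro sum_mono mult_left_mono) auto
      finally show ?thesis by (simp add: T_def sum_distrib_right)
    qed
    have "(\<Sum>j\<in>I. \<Sum>k\<in>I. prob (E j \<inter> E k)) \<le> (\<Sum>j\<in>I. \<Sum>k\<in>I. C * (b j * b k
        + (if j \<le> k then b j * d' (k - j) else 0) + (if k \<le> j then b k * d' (j - k) else 0)))"
      by (intro sum_mono pair_le)
    also have "\<dots> = C * (T * T + H + H)"
    proof -
      have "(\<Sum>j\<in>I. \<Sum>k\<in>I. if k \<le> j then b k * d' (j - k) else 0) = H"
        unfolding H_def by (rule sum.swap)
      then show ?thesis
        by (simp add: H_def sum_distrib_left[symmetric] sum.distrib T_def sum_product)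
    qed
    finally have up1: "(\<Sum>j\<in>I. \<Sum>k\<in>I. prob (E j \<inter> E k)) \<le> C * (T * T + H + H)" .
    have S0: "0 \<le> S" "0 \<le> 2 * S" using S(1) by simp_all
    have "T * T \<le> (2 * S) * (2 * S)"
      by (rule mult_mono[OF T(1) T(1) S0(2) T(2)])
    moreover have "D \<le> S * D" using mult_right_mono[OF S(1) D0] by simp
    then have "T * D \<le> (2 * S) * (S * D)"
      by (rule mult_mono[OF T(1) _ S0(2) D0])
    ultimately have "T * T + H + H \<le> (2 * S) * (2 * S) + (2 * S) * (S * D) + (2 * S) * (S * D)"
      using half by linarith
    also have "\<dots> = (4 + 4 * D) * S\<^sup>2" by (simp add: power2_eq_square algebra_simps)
    finally have "C * (T * T + H + H) \<le> C * ((4 + 4 * D) * S\<^sup>2)"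
      using C by (intro mult_left_mono) simp_all
    then have up: "(\<Sum>j\<in>I. \<Sum>k\<in>I. prob (E j \<inter> E k)) \<le> C * (4 + 4 * D) * S\<^sup>2"
      using up1 by (simp only: mult.assoc)
    have "(c * S / 2)\<^sup>2 \<le> (\<Sum>k\<in>I. prob (E k))\<^sup>2"
      using low c S by (intro power_mono) auto
    also have "\<dots> \<le> prob (\<Union>k\<in>I. E k) * (\<Sum>j\<in>I. \<Sum>k\<in>I. prob (E j \<inter> E k))"
      using E by (intro chung_erdos) (auto simp: I_def)
    also have "\<dots> \<le> prob (\<Union>k\<in>I. E k) * (C * (4 + 4 * D) * S\<^sup>2)"
      using up by (intro mult_left_mono) auto
    finally have "(c\<^sup>2 / 4) * S\<^sup>2 \<le> (prob (\<Union>k\<in>I. E k) * (C * (4 + 4 * D))) * S\<^sup>2"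
      by (simp add: power_mult_distrib power_divide mult_ac)
    then have "c\<^sup>2 / 4 \<le> prob (\<Union>k\<in>I. E k) * (C * (4 + 4 * D))"
      by (rule mult_right_le_imp_le) (use S in simp)
    then have "c\<^sup>2 / 4 / (C * (4 + 4 * D)) \<le> prob (\<Union>k\<in>I. E k)"
      using C D0 by (subst pos_divide_le_eq) simp_all
    then have "\<delta> \<le> prob (\<Union>k\<in>I. E k)" by (simp only: \<delta>_def divide_divide_eq_left)
    also have "\<dots> \<le> prob (\<Union>k\<in>{K..}. E k)"
      using E by (intro finite_measure_mono) (auto simp: I_def)
    finally show ?thesis .
  qed
  have "(\<lambda>K. prob (\<Union>k\<in>{K..}. E k)) \<longlonglongrightarrow> prob (\<Inter>K. \<Union>k\<in>{K..}. E k)"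
    using E by (intro finite_Lim_measure_decseq) (auto simp: decseq_def intro: order_trans)
  then have "\<delta> \<le> prob (\<Inter>K. \<Union>k\<in>{K..}. E k)"
    using union by (intro LIMSEQ_le_const) auto
  with \<delta>0 show ?thesis by linarith
qed

end

section \<open>Avoiding a set for a long time\<close>

text \<open>The past is confined to a class \<open>\<B>\<close> (later the relative balls) whose
  indicators have uniformly bounded variation norm, so that one constant serves all of them. The
  future event \<open>F\<close> is arbitrary, as it enters the decay through its supremum
  norm.\<close>

locale mixing_on_sets = prob_space M for M :: "'a measure" +
  fixes f :: "'a \<Rightarrow> 'a" and \<B> :: "'a set set" and C \<tau> :: real
  assumes f_measurable: "f \<in> measurable M M"
    and f_invariant: "distr M M f = M"
    and \<B>_events: "\<B> \<subseteq> events"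
    and C_nonneg: "0 \<le> C" and \<tau>_pos: "0 < \<tau>"
    and decay: "\<And>B F j. B \<in> \<B> \<Longrightarrow> F \<in> events \<Longrightarrow>
      \<bar>prob (B \<inter> ((f ^^ j) -` F \<inter> space M)) - prob B * prob F\<bar> \<le> C * exp (- \<tau> * real j)"
begin

definition pre :: "nat \<Rightarrow> 'a set \<Rightarrow> 'a set" where
  "pre n F = (f ^^ n) -` F \<inter> space M"

definition miss :: "'a set \<Rightarrow> nat \<Rightarrow> 'a set" where
  "miss B m = {x \<in> space M. \<forall>k<m. (f ^^ k) x \<notin> B}"

lemma funpow_measurable: "(f ^^ n) \<in> measurable M M"
proof (induction n)
  case (Suc n)
  then show ?case using measurable_comp[OF Suc f_measurable] by (simp add: comp_def)
qed (simp add: id_def)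

lemma funpow_in_space: "x \<in> space M \<Longrightarrow> (f ^^ n) x \<in> space M"
  using funpow_measurable by (rule measurable_space)

lemma funpow_invariant: "distr M M (f ^^ n) = M"
proof (induction n)
  case (Suc n)
  have "distr M M (f ^^ Suc n) = distr (distr M M (f ^^ n)) M f"
    using distr_distr[OF f_measurable funpow_measurable] by simp
  then show ?case using Suc f_invariant by (simp add: comp_def)
qed (simp add: id_def distr_id)

lemma pre_event [intro, simp]: "F \<in> events \<Longrightarrow> pre n F \<in> events"
  unfolding pre_def using funpow_measurable by (rule measurable_sets)

lemma prob_pre [simp]: "F \<in> events \<Longrightarrow> prob (pre n F) = prob F"
  unfolding pre_def using measure_distr[OF funpow_measurable, of F n] by (simp add: funpow_invariant)

lemma pre_pre: "pre m (pre n F) = pre (n + m) F"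
  unfolding pre_def by (auto simp: funpow_add funpow_in_space)

lemma pre_0: "F \<subseteq> space M \<Longrightarrow> pre 0 F = F"
  unfolding pre_def by auto

lemma pre_Int: "pre m (F \<inter> G) = pre m F \<inter> pre m G"
  unfolding pre_def by auto

lemma pre_space [simp]: "pre n (space M) = space M"
  by (auto simp: pre_def funpow_in_space)

lemma miss_event [intro, simp]: "B \<in> events \<Longrightarrow> miss B m \<in> events"
proof -
  assume B: "B \<in> events"
  have "miss B m = space M - (\<Union>k<m. pre k B)" unfolding miss_def pre_def by auto
  then show ?thesis using B by auto
qed

lemma miss_0 [simp]: "miss B 0 = space M"
  unfolding miss_def by simp

lemma miss_add: "miss B (m + n) = miss B m \<inter> pre m (miss B n)"
proof -
  have "(\<forall>k<m + n. P k) \<longleftrightarrow> (\<forall>k<m. P k) \<and> (\<forall>k<n. P (k + m))" for P :: "nat \<Rightarrow> bool"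
  proof safe
    fix k assume *: "\<forall>k<m. P k" "\<forall>k<n. P (k + m)" "k < m + n"
    show "P k"
    proof (cases "k < m")
      case False
      then have "k - m < n" "k - m + m = k" using *(3) by auto
      then show ?thesis using *(2) by metis
    qed (use * in auto)
  qed auto
  from this[of "\<lambda>k. (f ^^ k) x \<notin> B" for x] show ?thesis
    unfolding miss_def pre_def by (auto simp: funpow_add funpow_in_space)
qed

lemma miss_Suc: "miss B (Suc j) = miss B j - pre j B"
  unfolding miss_def pre_def by (auto simp: less_Suc_eq)

lemma miss_antimono: "m \<le> n \<Longrightarrow> B \<subseteq> B' \<Longrightarrow> miss B' n \<subseteq> miss B m"
  unfolding miss_def by auto

lemma decay': "B \<in> \<B> \<Longrightarrow> F \<in> events \<Longrightarrow> t \<le> j \<Longrightarrow>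
    \<bar>prob (B \<inter> pre j F) - prob B * prob F\<bar> \<le> C * exp (- \<tau> * real t)"
proof -
  assume a: "B \<in> \<B>" "F \<in> events" "t \<le> j"
  have "C * exp (- \<tau> * real j) \<le> C * exp (- \<tau> * real t)"
    using a C_nonneg \<tau>_pos by (intro mult_left_mono) auto
  then show ?thesis using decay[OF a(1,2), of j] by (simp add: pre_def)
qed

lemma prob_pre_Int_pre:
  assumes "B \<in> events" "F \<in> events" "i \<le> j"
  shows "prob (pre i B \<inter> pre j F) = prob (B \<inter> pre (j - i) F)"
proof -
  have "pre i B \<inter> pre j F = pre i (B \<inter> pre (j - i) F)"
    using assms by (simp add: pre_Int pre_pre)
  moreover have "B \<inter> pre (j - i) F \<in> events" using assms by auto
  ultimately show ?thesis by simp
qed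

text \<open>Bonferroni's inequality within a block of length \<open>q\<close>; the gap \<open>t\<close> decouples the
  future event \<open>F\<close>, about which nothing is known, from the single visits in the block.\<close>

lemma prob_miss_block_le:
  assumes B: "B \<in> \<B>" and F: "F \<in> events"
    and S: "(\<Sum>l\<in>{1..<q}. prob (B \<inter> pre l B)) \<le> S"
  shows "prob (miss B (q + t) \<inter> pre (q + t) F)
    \<le> (1 - real q * prob B) * prob F + real q * (C * exp (- \<tau> * real t) + S)"
proof -
  define G where "G = pre (q + t) F"
  have Be: "B \<in> events" using B \<B>_events by auto
  have G: "G \<in> events" unfolding G_def using F by simp
  have "j \<le> q \<Longrightarrow> prob (miss B j \<inter> G)
    \<le> (1 - real j * prob B) * prob F + real j * (C * exp (- \<tau> * real t) + S)" for j
  proof (induction j)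
    case 0
    have "space M \<inter> G = G" using G sets.sets_into_space by blast
    then show ?case using F by (simp add: G_def)
  next
    case (Suc j)
    have j: "j < q" using Suc.prems by simp
    have hit: "prob B * prob F - C * exp (- \<tau> * real t) \<le> prob (pre j B \<inter> G)"
      using decay'[OF B F, of t "q + t - j"] j prob_pre_Int_pre[OF Be F, of j "q + t"]
      unfolding G_def by (simp add: abs_le_iff algebra_simps)
    \<comment> \<open>A visit at time \<open>j\<close> is either the first one or preceded by
      another at some \<open>i < j\<close>; stationarity turns the latter case into a return after
      \<open>j - i\<close> steps.\<close>
    have "pre j B \<inter> G \<subseteq> (miss B j \<inter> G \<inter> pre j B) \<union> (\<Union>i<j. pre i B \<inter> pre j B)"
      unfolding miss_def pre_def by auto
    then have "prob (pre j B \<inter> G) \<le> prob ((miss B j \<inter> G \<inter> pre j B) \<union> (\<Union>i<j. pre i B \<inter> pre j B))"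
      using Be G by (intro finite_measure_mono) auto
    also have "\<dots> \<le> prob (miss B j \<inter> G \<inter> pre j B) + prob (\<Union>i<j. pre i B \<inter> pre j B)"
      using Be G by (intro measure_Un_le) auto
    also have "prob (\<Union>i<j. pre i B \<inter> pre j B) \<le> (\<Sum>i<j. prob (pre i B \<inter> pre j B))"
      using Be by (intro finite_measure_subadditive_finite) auto
    also have "(\<Sum>i<j. prob (pre i B \<inter> pre j B)) = (\<Sum>i<j. prob (B \<inter> pre (j - i) B))"
      using Be by (intro sum.cong prob_pre_Int_pre) auto
    also have "\<dots> = (\<Sum>l\<in>{1..j}. prob (B \<inter> pre l B))"
      by (rule sum.reindex_bij_witness[where i = "\<lambda>l. j - l" and j = "\<lambda>i. j - i"]) auto
    also have "\<dots> \<le> (\<Sum>l\<in>{1..<q}. prob (B \<inter> pre l B))"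
      using j by (intro sum_mono2) auto
    also note S
    finally have *: "prob (pre j B \<inter> G) \<le> prob (miss B j \<inter> G \<inter> pre j B) + S" by simp
    have "prob (miss B (Suc j) \<inter> G) = prob (miss B j \<inter> G - miss B j \<inter> G \<inter> pre j B)"
      by (rule arg_cong[where f = prob]) (auto simp: miss_Suc)
    also have "\<dots> = prob (miss B j \<inter> G) - prob (miss B j \<inter> G \<inter> pre j B)"
      using Be G by (intro finite_measure_Diff) auto
    also have "\<dots> \<le> (1 - real j * prob B) * prob F + real j * (C * exp (- \<tau> * real t) + S)
        - (prob B * prob F - C * exp (- \<tau> * real t) - S)"
      using Suc hit * by simp
    also have "\<dots> = (1 - real (Suc j) * prob B) * prob F + real (Suc j) * (C * exp (- \<tau> * real t) + S)"
      by (simp add: algebra_simps)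
    finally show ?case .
  qed
  from this[of q] have "prob (miss B q \<inter> G)
    \<le> (1 - real q * prob B) * prob F + real q * (C * exp (- \<tau> * real t) + S)" by simp
  moreover have "prob (miss B (q + t) \<inter> G) \<le> prob (miss B q \<inter> G)"
    using Be G miss_antimono[of q "q + t" B B] by (intro finite_measure_mono) auto
  ultimately show ?thesis by (simp add: G_def)
qed

text \<open>A union bound over all visits in the block. Those in the first \<open>q\<close> steps
  are separated from \<open>F\<close> by the gap; those inside the gap are too close to
  \<open>F\<close> to be decoupled and are charged their full probability.\<close>

lemma prob_miss_block_ge:
  assumes B: "B \<in> \<B>" and F: "F \<in> events"
  shows "(1 - real q * prob B) * prob F - real q * (C * exp (- \<tau> * real t)) - real t * prob B
    \<le> prob (miss B (q + t) \<inter> pre (q + t) F)"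
proof -
  define G where "G = pre (q + t) F"
  have Be: "B \<in> events" using B \<B>_events by auto
  have G: "G \<in> events" unfolding G_def using F by simp
  have "G \<subseteq> (miss B (q + t) \<inter> G) \<union> (\<Union>j<q + t. pre j B \<inter> G)"
    unfolding miss_def pre_def G_def by auto
  then have "prob G \<le> prob ((miss B (q + t) \<inter> G) \<union> (\<Union>j<q + t. pre j B \<inter> G))"
    using Be G by (intro finite_measure_mono) auto
  also have "\<dots> \<le> prob (miss B (q + t) \<inter> G) + prob (\<Union>j<q + t. pre j B \<inter> G)"
    using Be G by (intro measure_Un_le) auto
  also have "prob (\<Union>j<q + t. pre j B \<inter> G) \<le> (\<Sum>j<q + t. prob (pre j B \<inter> G))"
    using Be G by (intro finite_measure_subadditive_finite) auto
  also have "(\<Sum>j<q + t. prob (pre j B \<inter> G)) = (\<Sum>j<q. prob (pre j B \<inter> G)) + (\<Sum>j=q..<q + t. prob (pre j B \<inter> G))"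
    using sum.atLeastLessThan_concat[of 0 q "q + t" "\<lambda>j. prob (pre j B \<inter> G)"] by (simp add: atLeast0LessThan)
  also have "(\<Sum>j<q. prob (pre j B \<inter> G)) \<le> (\<Sum>j<q. prob B * prob F + C * exp (- \<tau> * real t))"
  proof (rule sum_mono)
    fix j assume "j \<in> {..<q}"
    then show "prob (pre j B \<inter> G) \<le> prob B * prob F + C * exp (- \<tau> * real t)"
      using decay'[OF B F, of t "q + t - j"] prob_pre_Int_pre[OF Be F, of j "q + t"]
      unfolding G_def by (simp add: abs_le_iff algebra_simps)
  qed
  also have "(\<Sum>j=q..<q + t. prob (pre j B \<inter> G)) \<le> (\<Sum>j=q..<q + t. prob B)"
  proof (rule sum_mono)
    fix j
    have "prob (pre j B \<inter> G) \<le> prob (pre j B)" using Be by (intro finite_measure_mono) auto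
    then show "prob (pre j B \<inter> G) \<le> prob B" using Be by simp
  qed
  finally have "prob G \<le> prob (miss B (q + t) \<inter> G) + (real q * (prob B * prob F + C * exp (- \<tau> * real t))
      + real t * prob B)" by simp
  then show ?thesis using F by (simp add: G_def algebra_simps)
qed

text \<open>Blocks are peeled off at the front: whatever follows the first block, including
  \<open>F\<close>, is itself the future event for it. This is why the one-block bound is stated for
  arbitrary \<open>F\<close>. The errors merely add up because the factor
  \<open>1 - q * prob B\<close> lies between 0 and 1.\<close>

lemma prob_miss_blocks_le:
  assumes B: "B \<in> \<B>" and F: "F \<in> events" and q: "real q * prob B \<le> 1"
    and S: "(\<Sum>l\<in>{1..<q}. prob (B \<inter> pre l B)) \<le> S"
  shows "prob (miss B (N * (q + t)) \<inter> pre (N * (q + t)) F)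
    \<le> (1 - real q * prob B) ^ N * prob F + real N * (real q * (C * exp (- \<tau> * real t) + S))"
proof (induction N)
  case 0
  then show ?case using F sets.sets_into_space[OF F] by (simp add: pre_0 Int_absorb1)
next
  case (Suc N)
  define e where "e = real q * (C * exp (- \<tau> * real t) + S)"
  define G where "G = miss B (N * (q + t)) \<inter> pre (N * (q + t)) F"
  have Be: "B \<in> events" using B \<B>_events by auto
  have G: "G \<in> events" unfolding G_def using F Be by auto
  have S0: "0 \<le> S" by (rule order_trans[OF sum_nonneg S]) simp
  have e0: "0 \<le> e" unfolding e_def using S0 C_nonneg by simp
  have "miss B (Suc N * (q + t)) \<inter> pre (Suc N * (q + t)) F
      = miss B (q + t) \<inter> pre (q + t) G"
    using miss_add[of B "q + t" "N * (q + t)"] by (simp add: G_def pre_Int pre_pre Int_assoc add.commute)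
  also have "prob \<dots> \<le> (1 - real q * prob B) * prob G + e"
    unfolding e_def by (rule prob_miss_block_le[OF B G S])
  also have "\<dots> \<le> (1 - real q * prob B) * ((1 - real q * prob B) ^ N * prob F + real N * e) + e"
    using Suc q unfolding G_def[symmetric] e_def[symmetric]
    by (intro add_right_mono mult_left_mono) auto
  also have "\<dots> \<le> (1 - real q * prob B) ^ Suc N * prob F + real (Suc N) * e"
    using mult_right_mono[of "1 - real q * prob B" 1 "real N * e"] e0 by (simp add: algebra_simps)
  finally show ?case unfolding e_def .
qed

lemma prob_miss_blocks_ge:
  assumes B: "B \<in> \<B>" and q: "real q * prob B \<le> 1"
  shows "(1 - real q * prob B) ^ N - real N * (real q * (C * exp (- \<tau> * real t)) + real t * prob B)
    \<le> prob (miss B (N * (q + t)))"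
proof (induction N)
  case 0
  then show ?case by (simp add: prob_space)
next
  case (Suc N)
  define e where "e = real q * (C * exp (- \<tau> * real t)) + real t * prob B"
  define G where "G = miss B (N * (q + t))"
  have Be: "B \<in> events" using B \<B>_events by auto
  have G: "G \<in> events" unfolding G_def using Be by auto
  have e0: "0 \<le> e" unfolding e_def using C_nonneg by simp
  have "(1 - real q * prob B) ^ Suc N - real (Suc N) * e
      \<le> (1 - real q * prob B) * ((1 - real q * prob B) ^ N - real N * e) - e"
    using mult_right_mono[of "1 - real q * prob B" 1 "real N * e"] e0 by (simp add: algebra_simps)
  also have "\<dots> \<le> (1 - real q * prob B) * prob G - e"
    using Suc q unfolding G_def[symmetric] e_def[symmetric]
    by (intro diff_right_mono mult_left_mono) auto
  also have "\<dots> \<le> prob (miss B (q + t) \<inter> pre (q + t) G)"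
    using prob_miss_block_ge[OF B G, of q t] by (simp add: e_def)
  also have "miss B (q + t) \<inter> pre (q + t) G = miss B (Suc N * (q + t))"
    using miss_add[of B "q + t" "N * (q + t)"] by (simp add: G_def)
  finally show ?case unfolding e_def .
qed

end

section \<open>Shrinking targets with short return times\<close>

text \<open>The inequalities in \<open>exponents\<close> have separate tasks:
  \<open>s < \<sigma>\<close> makes the expected number of visits in one block small,
  \<open>1 < \<sigma> + s\<close> makes the visits during the gaps negligible, and together with
  \<open>1 < \<sigma> + \<gamma>\<close> it leaves room for an error exponent whose powers are
  summable along the nodes.\<close>

locale short_returns = mixing_on_sets M f \<B> C \<tau>
  for M :: "'a measure" and f \<B> C \<tau> +
  fixes B :: "nat \<Rightarrow> 'a set" and s \<gamma> \<sigma> :: real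
  assumes B_in: "B n \<in> \<B>"
    and B_antimono: "1 \<le> m \<Longrightarrow> m \<le> n \<Longrightarrow> B n \<subseteq> B m"
    and prob_B_pos: "1 \<le> n \<Longrightarrow> 0 < prob (B n)"
    and prob_B_scaled_mono: "1 \<le> m \<Longrightarrow> m \<le> n \<Longrightarrow> real m * prob (B m) \<le> real n * prob (B n)"
    and s01: "0 < s" "s < 1" and \<gamma>01: "0 < \<gamma>" "\<gamma> < 1" and \<sigma>1: "\<sigma> < 1"
    and exponents: "1 < \<sigma> + \<gamma>" "1 < \<sigma> + s" "s < \<sigma>"
    and prob_B_bigo: "(\<lambda>n. prob (B n)) \<in> O(\<lambda>n. real n powr (- \<sigma>))"
    and return_bigo: "(\<lambda>n. \<Sum>j | 1 \<le> j \<and> real j \<le> real n powr s. prob (B n \<inter> pre j (B n)))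
      \<in> O(\<lambda>n. real n powr (- 1 - \<gamma>))"
begin

lemma B_event [intro, simp]: "B n \<in> events"
  using B_in \<B>_events by auto

sublocale hitting_rates "\<lambda>n. prob (B n)"
proof
  fix m n :: nat assume "1 \<le> m" "m \<le> n"
  then show "prob (B n) \<le> prob (B m)"
    by (intro finite_measure_mono B_antimono) auto
qed (use prob_B_pos prob_B_scaled_mono in auto)

text \<open>Blocks are as long as the control of short returns allows; after a gap the mixing error is at
  most a multiple of \<open>n powr (- 2)\<close>.\<close>

definition blk :: "nat \<Rightarrow> nat" where "blk n = nat \<lfloor>real n powr s\<rfloor>"

definition gap :: "nat \<Rightarrow> nat" where "gap n = nat \<lceil>2 / \<tau> * ln (real n)\<rceil>"

text \<open>An error exponent that still gives summability along the nodes.\<close>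

definition \<eta> :: real where "\<eta> = (1 - \<sigma> + min \<gamma> s) / 2"

text \<open>\<open>\<eta>\<close> is the midpoint of \<open>1 - \<sigma>\<close> and
  \<open>min \<gamma> s\<close>, which are in this order by \<open>exponents\<close>.\<close>

lemma \<eta>: "0 < \<eta>" "\<eta> < \<gamma>" "\<eta> < s" "1 < \<sigma> + \<eta>"
  using \<gamma>01 s01 \<sigma>1 exponents unfolding \<eta>_def by (auto simp: min_def field_simps)

lemma blk_bounds:
  assumes "1 \<le> n"
  shows "1 \<le> blk n" "real (blk n) \<le> real n powr s" "real n powr s / 2 \<le> real (blk n)"
    "blk n \<le> n"
proof -
  have 1: "1 \<le> real n powr s" using assms s01 by (simp add: ge_one_powr_ge_zero)
  then show "1 \<le> blk n" "real (blk n) \<le> real n powr s"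
    unfolding blk_def by linarith+
  show "real n powr s / 2 \<le> real (blk n)" proof -
    have "1 \<le> real_of_int \<lfloor>real n powr s\<rfloor>" using 1 by simp
    moreover from this have "real (blk n) = real_of_int \<lfloor>real n powr s\<rfloor>" by (simp add: blk_def)
    ultimately show ?thesis using real_of_int_floor_add_one_gt[of "real n powr s"] by linarith
  qed
  have "real n powr s \<le> real n powr 1" using assms s01 by (intro powr_mono) auto
  then show "blk n \<le> n" using assms \<open>real (blk n) \<le> real n powr s\<close> by simp
qed

lemma gap_bounds:
  assumes "1 \<le> n"
  shows "real (gap n) \<le> 2 / \<tau> * ln (real n) + 1"
    "exp (- \<tau> * real (gap n)) \<le> real n powr (- 2)"
proof -
  have 0: "0 \<le> 2 / \<tau> * ln (real n)" using assms \<tau>_pos by simp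
  then show "real (gap n) \<le> 2 / \<tau> * ln (real n) + 1" unfolding gap_def by linarith
  have "2 / \<tau> * ln (real n) \<le> real (gap n)" using 0 unfolding gap_def by linarith
  then have "2 * ln (real n) \<le> \<tau> * real (gap n)" using \<tau>_pos by (simp add: field_simps)
  then show "exp (- \<tau> * real (gap n)) \<le> real n powr (- 2)" using assms by (simp add: powr_def)
qed

section \<open>Two-sided bounds for missing a single ball\<close>

lemma prob_B_bound:
  obtains D where "0 < D" "\<forall>\<^sub>F n in sequentially. prob (B n) \<le> D * real n powr (- \<sigma>)"
  using prob_B_bigo by (elim landau_o.bigE) auto

lemma return_bound:
  obtains D where "0 < D" "\<forall>\<^sub>F n in sequentially.
    (\<Sum>l\<in>{1..<blk n}. prob (B n \<inter> pre l (B n))) \<le> D * real n powr (- 1 - \<gamma>)"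
proof -
  obtain D where D: "0 < D" "\<forall>\<^sub>F n in sequentially.
      norm (\<Sum>j | 1 \<le> j \<and> real j \<le> real n powr s. prob (B n \<inter> pre j (B n)))
      \<le> D * norm (real n powr (- 1 - \<gamma>))"
    using return_bigo by (elim landau_o.bigE) auto
  have "\<forall>\<^sub>F n in sequentially.
      (\<Sum>l\<in>{1..<blk n}. prob (B n \<inter> pre l (B n))) \<le> D * real n powr (- 1 - \<gamma>)"
    using D(2) eventually_ge_at_top[of 1]
  proof eventually_elim
    case (elim n)
    have "{j. 1 \<le> j \<and> real j \<le> real n powr s} \<subseteq> {..blk n}"
      unfolding blk_def by (auto simp: le_nat_floor)
    then have fin: "finite {j. 1 \<le> j \<and> real j \<le> real n powr s}"
      by (rule finite_subset) simp
    have sub: "{1..<blk n} \<subseteq> {j. 1 \<le> j \<and> real j \<le> real n powr s}"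
      using blk_bounds(2)[OF elim(2)] by auto
    have "(\<Sum>l\<in>{1..<blk n}. prob (B n \<inter> pre l (B n)))
        \<le> (\<Sum>j | 1 \<le> j \<and> real j \<le> real n powr s. prob (B n \<inter> pre j (B n)))"
      by (rule sum_mono2[OF fin sub]) simp
    then show ?case using elim(1) by simp
  qed
  with D(1) show ?thesis using that by blast
qed

text \<open>Both the block length, of order \<open>n powr s\<close>, and the logarithmic gap are
  beaten by \<open>n powr (- \<sigma>)\<close>. The factor \<open>1 - q * prob (B n)\<close> per
  block then stays at least 1/2.\<close>

lemma eventually_block_small: "\<forall>\<^sub>F n in sequentially. real (blk n + gap n) * prob (B n) \<le> 1 / 2"
proof -
  obtain D where D: "0 < D" "\<forall>\<^sub>F n in sequentially. prob (B n) \<le> D * real n powr (- \<sigma>)"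
    by (rule prob_B_bound)
  have "0 < \<sigma> - s" "0 < \<sigma>" using exponents s01 by auto
  then have "((\<lambda>n. D * real n powr - (\<sigma> - s) + (2 / \<tau> * ln (real n) + 1) * (D * real n powr - \<sigma>)) \<longlongrightarrow> 0) sequentially"
    using D(1) \<tau>_pos by (intro tendsto_add_zero; real_asymp)
  then have "\<forall>\<^sub>F n in sequentially. D * real n powr - (\<sigma> - s) + (2 / \<tau> * ln (real n) + 1) * (D * real n powr - \<sigma>) < 1 / 2"
    by (rule order_tendstoD) simp
  then show ?thesis
    using D(2) eventually_ge_at_top[of 1]
  proof eventually_elim
    case (elim n)
    have "real (blk n + gap n) * prob (B n) \<le> (real n powr s + (2 / \<tau> * ln (real n) + 1)) * (D * real n powr - \<sigma>)"
      using elim blk_bounds[of n] gap_bounds[of n] by (intro mult_mono) auto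
    also have "\<dots> = D * real n powr - (\<sigma> - s) + (2 / \<tau> * ln (real n) + 1) * (D * real n powr - \<sigma>)"
      using elim(3) by (simp add: algebra_simps powr_add[symmetric])
    finally show ?case using elim(1) by linarith
  qed
qed

text \<open>About \<open>n / blk n\<close> gaps occur up to time \<open>n\<close>. Their total
  expected number of visits stays bounded, so leaving the gaps uncontrolled changes the exponential
  only by a constant factor.\<close>

lemma eventually_gap_negligible:
  "\<forall>\<^sub>F n in sequentially. real n * prob (B n) * (real (gap n) / real (blk n)) \<le> 1"
proof -
  obtain D where D: "0 < D" "\<forall>\<^sub>F n in sequentially. prob (B n) \<le> D * real n powr (- \<sigma>)"
    by (rule prob_B_bound)
  have "0 < \<sigma> + s - 1" using exponents by auto
  then have "((\<lambda>n. D * 2 * (2 / \<tau> * ln (real n) + 1) * real n powr - (\<sigma> + s - 1)) \<longlongrightarrow> 0) sequentially"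
    using D(1) \<tau>_pos by real_asymp
  then have "\<forall>\<^sub>F n in sequentially. D * 2 * (2 / \<tau> * ln (real n) + 1) * real n powr - (\<sigma> + s - 1) < 1"
    by (rule order_tendstoD) simp
  then show ?thesis
    using D(2) eventually_ge_at_top[of 1]
  proof eventually_elim
    case (elim n)
    have "real (gap n) / real (blk n) \<le> (2 / \<tau> * ln (real n) + 1) / (real n powr s / 2)"
      using elim blk_bounds[of n] gap_bounds[of n] by (intro frac_le) auto
    then have "real n * prob (B n) * (real (gap n) / real (blk n))
        \<le> real n * (D * real n powr (- \<sigma>)) * ((2 / \<tau> * ln (real n) + 1) / (real n powr s / 2))"
      using elim D(1) by (intro mult_mono) auto
    also have "\<dots> = D * 2 * (2 / \<tau> * ln (real n) + 1) * real n powr - (\<sigma> + s - 1)"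
      using elim(3) by (simp add: powr_minus powr_diff powr_add field_simps)
    finally show ?case using elim(1) by linarith
  qed
qed

text \<open>The short returns cost a multiple of \<open>n powr (- 1 - \<gamma>)\<close> for each of
  at most \<open>n\<close> times inside blocks, whence the error \<open>n powr (- \<gamma>)\<close>.
  Time and ball are decoupled (\<open>m \<le> n\<close>) because a ball is later combined with
  shorter orbit segments; \<open>F\<close> is kept for pairs of nodes.\<close>

lemma prob_miss_le:
  obtains A where "1 \<le> A" "\<And>n m F. 1 \<le> n \<Longrightarrow> m \<le> n \<Longrightarrow> F \<in> events \<Longrightarrow>
    prob (miss (B n) m \<inter> pre m F) \<le> A * (exp (- real m * prob (B n)) * prob F + real n powr (- \<gamma>))"
proof -
  obtain D where D: "0 < D" and ev: "\<forall>\<^sub>F n in sequentially.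
      (\<Sum>l\<in>{1..<blk n}. prob (B n \<inter> pre l (B n))) \<le> D * real n powr (- 1 - \<gamma>)"
    by (rule return_bound)
  obtain n0 where n0: "\<And>n. n0 \<le> n \<Longrightarrow>
      (\<Sum>l\<in>{1..<blk n}. prob (B n \<inter> pre l (B n))) \<le> D * real n powr (- 1 - \<gamma>) \<and>
      real (blk n + gap n) * prob (B n) \<le> 1 / 2 \<and>
      real n * prob (B n) * (real (gap n) / real (blk n)) \<le> 1"
    using eventually_conj[OF ev eventually_conj[OF eventually_block_small eventually_gap_negligible]]
    unfolding eventually_sequentially by auto
  \<comment> \<open>The first summand covers what the gaps and the incomplete block take from the
    exponent, the second the additive errors, the third the finitely many small \<open>n\<close>,
    for which the bound is trivial.\<close>
  define A where "A = exp 2 + (C + D) + real n0 powr \<gamma>"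
  have Ae: "exp 2 \<le> A" "C + D \<le> A" "real n0 powr \<gamma> \<le> A"
    using D C_nonneg by (auto simp: A_def)
  have e2: "1 \<le> exp (2::real)" by simp
  have "prob (miss (B n) m \<inter> pre m F) \<le> A * (exp (- real m * prob (B n)) * prob F + real n powr (- \<gamma>))"
    if n: "1 \<le> n" and m: "m \<le> n" and F: "F \<in> events" for n m F
  proof (cases "n0 \<le> n")
    case False
    have "prob (miss (B n) m \<inter> pre m F) \<le> 1" by simp
    also have "1 = real n powr \<gamma> * real n powr (- \<gamma>)" using n by (simp add: powr_add[symmetric])
    also have "\<dots> \<le> real n0 powr \<gamma> * real n powr (- \<gamma>)"
      using False n \<gamma>01 by (intro mult_right_mono powr_mono2) auto
    also have "\<dots> \<le> A * real n powr (- \<gamma>)" using Ae by (intro mult_right_mono) auto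
    also have "\<dots> \<le> A * (exp (- real m * prob (B n)) * prob F + real n powr (- \<gamma>))"
    proof -
      have "0 \<le> A" using Ae e2 by linarith
      then show ?thesis by (intro mult_left_mono) auto
    qed
    finally show ?thesis .
  next
    case True
    define p where "p = prob (B n)"
    define q where "q = blk n"
    define t where "t = gap n"
    define N where "N = m div (q + t)"
    define \<rho> where "\<rho> = m mod (q + t)"
    have p: "0 \<le> p" by (simp add: p_def)
    have q1: "1 \<le> q" using blk_bounds[OF n] by (simp add: q_def)
    have small: "real (q + t) * p \<le> 1 / 2" "real n * p * (real t / real q) \<le> 1"
      using n0[OF True] by (auto simp: p_def q_def t_def)
    have "real q * p \<le> real (q + t) * p" using p by (intro mult_right_mono) auto
    then have qp: "real q * p \<le> 1" using small by linarith
    have m_eq: "m = N * (q + t) + \<rho>" by (simp only: N_def \<rho>_def div_mult_mod_eq)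
    have Nle: "N * (q + t) \<le> m" using m_eq by simp
    have \<rho>: "\<rho> < q + t" using q1 by (simp add: \<rho>_def)
    \<comment> \<open>The avoidance condition is dropped on the incomplete last block of length
      \<open>\<rho>\<close>, which is moved into the future event.\<close>
    have "miss (B n) m \<inter> pre m F \<subseteq> miss (B n) (N * (q + t)) \<inter> pre (N * (q + t)) (pre \<rho> F)"
      unfolding m_eq miss_add pre_pre by (auto simp: add.commute)
    then have "prob (miss (B n) m \<inter> pre m F)
        \<le> prob (miss (B n) (N * (q + t)) \<inter> pre (N * (q + t)) (pre \<rho> F))"
      using F by (intro finite_measure_mono) auto
    also have "\<dots> \<le> (1 - real q * p) ^ N * prob (pre \<rho> F)
        + real N * (real q * (C * exp (- \<tau> * real t) + D * real n powr (- 1 - \<gamma>)))"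
      unfolding p_def using F n0[OF True] qp
      by (intro prob_miss_blocks_le B_in) (auto simp: q_def p_def)
    also have "\<dots> \<le> exp 2 * exp (- real m * p) * prob F + (C + D) * real n powr (- \<gamma>)"
    proof (rule add_mono)
      have "(1 - real q * p) ^ N \<le> exp (- (real q * p)) ^ N"
        using qp exp_ge_add_one_self[of "- (real q * p)"] by (intro power_mono) auto
      also have "\<dots> = exp (- (real N * real q * p))"
        by (simp add: exp_of_nat_mult[symmetric] mult_ac)
      \<comment> \<open>The exponent falls short of \<open>m * p\<close> by the gaps (at most 1) and
        the incomplete block (at most 1/2).\<close>
      also have "\<dots> \<le> exp (2 - real m * p)"
      proof -
        have "real m = real N * real q + real N * real t + real \<rho>"
          using arg_cong[OF m_eq, of real] by (simp add: distrib_left)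
        then have "real m * p = real N * real q * p + real N * real t * p + real \<rho> * p"
          by (simp add: distrib_right)
        moreover have "real \<rho> * p \<le> real (q + t) * p"
          using \<rho> p by (intro mult_right_mono) auto
        moreover have "real N * real t * p \<le> 1"
        proof -
          have "real N * real q \<le> real (N * (q + t))" by (simp add: distrib_left)
          also have "\<dots> \<le> real n" using Nle m by (simp only: of_nat_le_iff)
          finally have "real N \<le> real n / real q" using q1 by (simp add: field_simps)
          then have "real N * (real t * p) \<le> real n / real q * (real t * p)"
            using p by (intro mult_right_mono) auto
          then show ?thesis using small(2) by (simp add: mult_ac)
        qed
        ultimately show ?thesis using small(1) by simp
      qed
      also have "\<dots> = exp 2 * exp (- real m * p)" by (simp add: exp_diff exp_minus field_simps)
      finally show "(1 - real q * p) ^ N * prob (pre \<rho> F) \<le> exp 2 * exp (- real m * p) * prob F"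
        using F by (simp add: mult_right_mono)
    next
      have "real N * real q \<le> real (N * (q + t))" by (simp add: distrib_left)
      also have "\<dots> \<le> real n" using Nle m by (simp only: of_nat_le_iff)
      finally have Nq: "real N * real q \<le> real n" .
      have "real n powr (- 2) \<le> real n powr (- 1 - \<gamma>)" using n \<gamma>01 by (intro powr_mono) auto
      then have "C * exp (- \<tau> * real t) \<le> C * real n powr (- 1 - \<gamma>)"
        using gap_bounds(2)[OF n] C_nonneg unfolding t_def by (intro mult_left_mono) auto
      then have "real N * real q * (C * exp (- \<tau> * real t) + D * real n powr (- 1 - \<gamma>))
          \<le> real n * ((C + D) * real n powr (- 1 - \<gamma>))"
        using Nq C_nonneg D by (intro mult_mono) (auto simp: distrib_right)
      also have "\<dots> = (C + D) * real n powr (- \<gamma>)"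
        using n by (simp add: powr_diff powr_minus field_simps)
      finally show "real N * (real q * (C * exp (- \<tau> * real t) + D * real n powr (- 1 - \<gamma>)))
          \<le> (C + D) * real n powr (- \<gamma>)" by (simp add: mult.assoc)
    qed
    also have "\<dots> \<le> A * (exp (- real m * p) * prob F) + A * real n powr (- \<gamma>)"
      using Ae by (simp add: add_mono mult_right_mono mult.assoc)
    finally show ?thesis by (simp add: p_def distrib_left)
  qed
  moreover have "1 \<le> A" using Ae e2 by linarith
  ultimately show ?thesis using that by blast
qed

text \<open>With \<open>p\<close> for \<open>prob (B n)\<close> and \<open>q\<close> for the block
  length, the logarithmic bound on \<open>n * p\<close> keeps two losses small. The quadratic
  corrections in \<open>ln (1 - q * p)\<close> add up to the order of
  \<open>(n * p) ^ 2 * q / n\<close>, which tends to 0. The visits charged to the gaps are of order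
  \<open>(ln n) ^ 2 * n powr (- s)\<close>, below \<open>n powr (- \<eta>)\<close>.\<close>

lemma prob_miss_ge:
  obtains A where "1 \<le> A" "\<And>n. 1 \<le> n \<Longrightarrow> real n * prob (B n) \<le> 2 * ln (real n) \<Longrightarrow>
    exp (- 2) * exp (- (real n * prob (B n))) - A * real n powr (- \<eta>) \<le> prob (miss (B n) n)"
proof -
  have "0 < s - \<eta>" "0 < 1 - s" using \<eta> s01 by auto
  then have lim: "((\<lambda>n. 8 * (ln (real n) * (2 / \<tau> * ln (real n) + 1)) * real n powr - (s - \<eta>)) \<longlongrightarrow> 0) sequentially"
    "((\<lambda>n. 16 * (ln (real n))\<^sup>2 * real n powr - (1 - s)) \<longlongrightarrow> 0) sequentially"
    using \<tau>_pos by real_asymp+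
  have lims: "\<forall>\<^sub>F n in sequentially. 8 * (ln (real n) * (2 / \<tau> * ln (real n) + 1)) * real n powr - (s - \<eta>) < 1"
    "\<forall>\<^sub>F n in sequentially. 16 * (ln (real n))\<^sup>2 * real n powr - (1 - s) < 1"
    by (rule order_tendstoD[OF lim(1)], simp) (rule order_tendstoD[OF lim(2)], simp)
  obtain n0 where n0: "\<And>n. n0 \<le> n \<Longrightarrow>
      real (blk n + gap n) * prob (B n) \<le> 1 / 2 \<and>
      8 * (ln (real n) * (2 / \<tau> * ln (real n) + 1)) * real n powr - (s - \<eta>) < 1 \<and>
      16 * (ln (real n))\<^sup>2 * real n powr - (1 - s) < 1"
    using eventually_conj[OF eventually_block_small eventually_conj[OF lims]]
    unfolding eventually_sequentially by auto
  define A where "A = 1 + 2 * C + real n0 powr \<eta>"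
  have Ae: "1 + 2 * C \<le> A" "real n0 powr \<eta> \<le> A" "1 \<le> A"
    using C_nonneg by (auto simp: A_def)
  have "exp (- 2) * exp (- (real n * prob (B n))) - A * real n powr (- \<eta>) \<le> prob (miss (B n) n)"
    if n: "1 \<le> n" and small: "real n * prob (B n) \<le> 2 * ln (real n)" for n
  proof (cases "n0 \<le> n")
    case False
    have "exp (- 2) * exp (- (real n * prob (B n))) \<le> 1 * 1"
      by (intro mult_mono) auto
    also have "1 * 1 = real n powr \<eta> * real n powr (- \<eta>)" using n by (simp add: powr_add[symmetric])
    also have "\<dots> \<le> real n0 powr \<eta> * real n powr (- \<eta>)"
      using False n \<eta> by (intro mult_right_mono powr_mono2) auto
    also have "\<dots> \<le> A * real n powr (- \<eta>)" using Ae by (intro mult_right_mono) auto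
    finally have "exp (- 2) * exp (- (real n * prob (B n))) - A * real n powr (- \<eta>) \<le> 0" by linarith
    then show ?thesis using measure_nonneg by (rule order_trans)
  next
    case True
    define p where "p = prob (B n)"
    define q where "q = blk n"
    define t where "t = gap n"
    \<comment> \<open>Rounded up: the blocks cover all times below \<open>n\<close>, and avoiding
      the ball for longer is less likely, which is the right direction for a lower bound.\<close>
    define N where "N = n div (q + t) + 1"
    have p: "0 \<le> p" by (simp add: p_def)
    have q1: "1 \<le> q" "q \<le> n" "real q \<le> real n powr s" "real n powr s / 2 \<le> real q"
      using blk_bounds[OF n] by (auto simp: q_def)
    have Lp: "real (q + t) * p \<le> 1 / 2" using n0[OF True] by (auto simp: p_def q_def t_def)
    have "real q * p \<le> real (q + t) * p" using p by (intro mult_right_mono) auto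
    then have qp: "0 \<le> real q * p" "real q * p \<le> 1 / 2" using Lp p by auto
    have NL: "n \<le> N * (q + t)"
      using dividend_less_div_times[of "q + t" n] q1 by (simp add: N_def)
    have Nq: "real N * real q \<le> real n + real q"
    proof -
      have "(N - 1) * q \<le> (N - 1) * (q + t)" by simp
      also have "\<dots> \<le> n" by (simp add: N_def)
      finally have "N * q \<le> n + q" by (simp add: N_def)
      then show ?thesis by (metis of_nat_add of_nat_le_iff of_nat_mult)
    qed
    then have Nq2: "real N * real q \<le> 2 * real n" using q1 by simp
    then have N2: "real N \<le> 2 * real n / real q" using q1 by (simp add: field_simps)
    have np: "real n * p \<le> 2 * ln (real n)" "0 \<le> real n * p" using small p by (auto simp: p_def)
    have lnn: "0 \<le> ln (real n)" using n by simp
    have main: "exp (- 2) * exp (- (real n * p)) \<le> (1 - real q * p) ^ N"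
    proof -
      have "real N * (2 * (real q * p)\<^sup>2) \<le> 2 * real n / real q * (2 * (real q * p)\<^sup>2)"
        using N2 by (intro mult_right_mono) auto
      also have "\<dots> = 4 * (real n * p)\<^sup>2 * (real q / real n)"
        using q1 n by (simp add: field_simps power2_eq_square)
      also have "\<dots> \<le> 4 * (2 * ln (real n))\<^sup>2 * (real n powr s / real n)"
        using power_mono[OF np, of 2] q1 n by (intro mult_mono divide_right_mono) auto
      also have "\<dots> = 16 * (ln (real n))\<^sup>2 * real n powr - (1 - s)"
        using n by (simp add: powr_diff power_mult_distrib)
      also have "\<dots> \<le> 1" using n0[OF True] by simp
      finally have sq: "real N * (2 * (real q * p)\<^sup>2) \<le> 1" .
      have "real N * (real q * p) \<le> (real n + real q) * p"
        using mult_right_mono[OF Nq p] by (simp add: mult_ac)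
      also have "\<dots> \<le> real n * p + 1" using qp by (simp add: distrib_right)
      \<comment> \<open>One unit pays for the extra block, the other for the quadratic term of the
        logarithm.\<close>
      finally have "- 2 - real n * p \<le> real N * (- (real q * p) - 2 * (real q * p)\<^sup>2)"
        using sq by (simp add: algebra_simps)
      also have "\<dots> \<le> real N * ln (1 - real q * p)"
        using ln_one_minus_pos_lower_bound[of "real q * p"] qp by (intro mult_left_mono) auto
      finally have "exp (- 2 - real n * p) \<le> exp (real N * ln (1 - real q * p))" by simp
      also have "\<dots> = (1 - real q * p) ^ N"
        using qp by (simp add: exp_of_nat_mult)
      finally show ?thesis by (simp add: exp_diff exp_minus field_simps)
    qed
    have err: "real N * (real q * (C * exp (- \<tau> * real t)) + real t * p) \<le> A * real n powr (- \<eta>)"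
    proof -
      have "real N * real q * (C * exp (- \<tau> * real t)) \<le> 2 * real n * (C * real n powr (- 2))"
        using gap_bounds(2)[OF n] C_nonneg unfolding t_def
        by (intro mult_mono[OF Nq2] mult_left_mono) auto
      also have "\<dots> = 2 * C * real n powr (- 1)"
        using n powr_add[of "real n" 1 "- 2"] by simp
      also have "\<dots> \<le> 2 * C * real n powr (- \<eta>)"
        using n \<eta> \<gamma>01 C_nonneg by (intro mult_left_mono powr_mono) auto
      finally have 1: "real N * real q * (C * exp (- \<tau> * real t)) \<le> 2 * C * real n powr (- \<eta>)" .
      have "real N * (real t * p) \<le> 2 * real n / real q * (real t * p)"
        using N2 p by (intro mult_right_mono) auto
      also have "\<dots> = 2 * (real n * p) * real t / real q" by simp
      also have "\<dots> \<le> 2 * (2 * ln (real n)) * (2 / \<tau> * ln (real n) + 1) / (real n powr s / 2)"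
        using np gap_bounds(1)[OF n] q1 n lnn \<tau>_pos unfolding t_def
        by (intro frac_le mult_mono[OF mult_left_mono[OF np(1)]])
          (auto intro!: mult_nonneg_nonneg add_nonneg_nonneg)
      also have "\<dots> = 8 * (ln (real n) * (2 / \<tau> * ln (real n) + 1)) * real n powr - (s - \<eta>) * real n powr (- \<eta>)"
        using n by (simp add: powr_minus powr_diff field_simps)
      also have "\<dots> \<le> 1 * real n powr (- \<eta>)"
        using n0[OF True] by (intro mult_right_mono) auto
      finally have 2: "real N * (real t * p) \<le> real n powr (- \<eta>)" by simp
      have "real N * (real q * (C * exp (- \<tau> * real t)) + real t * p) \<le> (1 + 2 * C) * real n powr (- \<eta>)"
        using 1 2 by (simp add: distrib_left distrib_right mult.assoc)
      also have "\<dots> \<le> A * real n powr (- \<eta>)" using Ae by (intro mult_right_mono) auto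
      finally show ?thesis .
    qed
    have "exp (- 2) * exp (- (real n * p)) - A * real n powr (- \<eta>)
        \<le> (1 - real q * p) ^ N - real N * (real q * (C * exp (- \<tau> * real t)) + real t * p)"
      using main err by linarith
    also have "\<dots> \<le> prob (miss (B n) (N * (q + t)))"
      unfolding p_def using qp by (intro prob_miss_blocks_ge B_in) (simp add: p_def)
    also have "\<dots> \<le> prob (miss (B n) n)"
      using NL by (intro finite_measure_mono miss_antimono) auto
    finally show ?thesis by (simp add: p_def)
  qed
  with Ae(3) show ?thesis using that by blast
qed

text \<open>\<open>prob (B n) * n powr (- \<eta>)\<close> is at most of order
  \<open>n powr (- \<sigma> - \<eta>)\<close>, an exponent below -1; condensation transfers this to
  the nodes.\<close>

lemma summable_node_powr_\<eta>: "summable (\<lambda>k. real (node k) powr (- \<eta>))"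
proof (rule summable_node_powr)
  obtain D where D: "0 < D" "\<forall>\<^sub>F n in sequentially. prob (B n) \<le> D * real n powr (- \<sigma>)"
    by (rule prob_B_bound)
  have "summable (\<lambda>n. D * real n powr (- \<sigma> - \<eta>))"
    using \<eta> by (intro summable_mult) (simp add: summable_real_powr_iff)
  moreover have "\<forall>\<^sub>F n in sequentially. norm (prob (B n) * real n powr (- \<eta>)) \<le> D * real n powr (- \<sigma> - \<eta>)"
    using D(2)
  proof eventually_elim
    case (elim n)
    have "prob (B n) * real n powr (- \<eta>) \<le> D * real n powr (- \<sigma>) * real n powr (- \<eta>)"
      using elim by (intro mult_right_mono) auto
    then show ?case by (simp add: powr_add[symmetric] mult.assoc)
  qed
  ultimately show "summable (\<lambda>n. prob (B n) * real n powr (- \<eta>))"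
    by (rule summable_comparison_test_ev[rotated])
qed (use \<eta> in auto)

text \<open>Only the nodes need checking: for \<open>m\<close> between \<open>node k\<close> and
  \<open>node (Suc k)\<close>, an orbit that meets the smaller ball of \<open>node (Suc k)\<close>
  before the shorter time \<open>node k\<close> also meets \<open>B m\<close> before time
  \<open>m\<close>.\<close>

theorem AE_eventually_hit:
  assumes "summable (\<lambda>n. prob (B n) * exp (- real n * prob (B n)))"
  shows "AE x in M. \<forall>\<^sub>F m in sequentially. \<exists>k<m. (f ^^ k) x \<in> B m"
proof -
  obtain A where A: "1 \<le> A" "\<And>n m F. 1 \<le> n \<Longrightarrow> m \<le> n \<Longrightarrow> F \<in> events \<Longrightarrow>
    prob (miss (B n) m \<inter> pre m F) \<le> A * (exp (- real m * prob (B n)) * prob F + real n powr (- \<gamma>))"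
    by (rule prob_miss_le) blast
  define E where "E k = miss (B (node (Suc k))) (node k)" for k
  have bound: "prob (E k) \<le> A * (exp 2 * exp (- level k) + real (node k) powr (- \<eta>))" for k
  proof -
    have n1: "1 \<le> node k" "1 \<le> node (Suc k)" "node k \<le> node (Suc k)"
      using node_ge_1 node_mono[of k "Suc k"] by auto
    have "prob (E k) = prob (miss (B (node (Suc k))) (node k) \<inter> pre (node k) (space M))"
      by (simp add: E_def Int_absorb2 sets.sets_into_space)
    also have "\<dots> \<le> A * (exp (- real (node k) * prob (B (node (Suc k)))) * prob (space M)
        + real (node (Suc k)) powr (- \<gamma>))"
      using n1 by (intro A) auto
    also have "\<dots> \<le> A * (exp 2 * exp (- level k) + real (node k) powr (- \<eta>))"
    proof (intro mult_left_mono add_mono)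
      show "exp (- real (node k) * prob (B (node (Suc k)))) * prob (space M) \<le> exp 2 * exp (- level k)"
        using level_le_shifted[of k] by (simp add: prob_space exp_add[symmetric])
      have "real (node (Suc k)) powr (- \<gamma>) \<le> real (node k) powr (- \<gamma>)"
        using n1 \<gamma>01 by (intro powr_mono2') auto
      also have "\<dots> \<le> real (node k) powr (- \<eta>)"
        using n1 \<eta> by (intro powr_mono) auto
      finally show "real (node (Suc k)) powr (- \<gamma>) \<le> real (node k) powr (- \<eta>)" .
    qed (use A in simp)
    finally show ?thesis .
  qed
  have "summable (\<lambda>k. A * (exp 2 * exp (- level k) + real (node k) powr (- \<eta>)))"
    using summable_level_exp[OF assms] summable_node_powr_\<eta>
    by (intro summable_mult summable_add)
  then have "summable (\<lambda>k. prob (E k))"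
    by (rule summable_comparison_test'[where N = 0]) (simp add: bound)
  then have "AE x in M. \<forall>\<^sub>F k in sequentially. x \<in> space M - E k"
    by (intro borel_cantelli_AE1) (auto simp: E_def less_top[symmetric])
  then show ?thesis
  proof eventually_elim
    case (elim x)
    then obtain K where K: "\<And>k. K \<le> k \<Longrightarrow> x \<in> space M - E k"
      by (auto simp: eventually_sequentially)
    show ?case unfolding eventually_sequentially
    proof (rule exI[of _ "node K"], intro allI impI)
      fix m assume m: "node K \<le> m"
      have "\<exists>k. m < node k" using node_gt by blast
      define k where "k = (GREATEST k. node k \<le> m)"
      have bd: "\<And>y. node y \<le> m \<Longrightarrow> y \<le> m" using node_gt by (meson less_imp_le order_trans)
      have k1: "node k \<le> m" unfolding k_def using m bd by (rule GreatestI_nat)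
      have k2: "m < node (Suc k)"
      proof (rule ccontr)
        assume "\<not> m < node (Suc k)"
        then have "Suc k \<le> k" unfolding k_def using bd by (intro Greatest_le_nat) auto
        then show False by simp
      qed
      have "K \<le> k" unfolding k_def using m bd by (rule Greatest_le_nat)
      then obtain i where i: "i < node k" "(f ^^ i) x \<in> B (node (Suc k))"
        using K[of k] by (auto simp: E_def miss_def)
      moreover have "B (node (Suc k)) \<subseteq> B m"
        using k1 k2 node_ge_1[of k] by (intro B_antimono) auto
      ultimately show "\<exists>i<m. (f ^^ i) x \<in> B m" using k1 by (intro exI[of _ i]) auto
    qed
  qed
qed

section \<open>Joint misses at two nodes\<close>

lemma summable_exp_sqrt:
  assumes "0 < \<kappa>" shows "summable (\<lambda>i. exp (- \<kappa> * sqrt (real i)))"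
proof (rule summable_comparison_test_bigo)
  show "summable (\<lambda>i. norm (real i powr (- 2)))" by (simp add: summable_real_powr_iff)
  show "(\<lambda>i. exp (- \<kappa> * sqrt (real i))) \<in> O(\<lambda>i. real i powr (- 2))"
    using assms by real_asymp
qed

text \<open>For \<open>u > n\<close> truncated subtraction makes the right-hand side the whole
  space; for distant nodes the gap may indeed overrun the later node.\<close>

lemma miss_subset_pre: "miss B' n \<subseteq> pre u (miss B' (n - u))"
  unfolding miss_def pre_def by (auto simp: funpow_in_space) (metis comp_apply funpow_add less_diff_conv)

text \<open>The error \<open>node j powr (- \<gamma>)\<close> of the block bound does not decay in
  \<open>k\<close>. For a close pair \<open>sqrt (k - j)\<close> is at most logarithmic in
  \<open>node k\<close>, which in turn is at most polynomial in \<open>node j\<close>. Lowering the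
  exponent from \<open>\<gamma>\<close> to \<open>\<eta>\<close> therefore buys the factor
  \<open>exp (- \<kappa> * sqrt (k - j))\<close>.\<close>

lemma prob_miss_pair_close:
  obtains A \<kappa> where "1 \<le> A" "0 < \<kappa>" "\<And>j k. j < k \<Longrightarrow> 1 < real (node j) * prob (B (node k)) \<Longrightarrow>
      level k \<le> 2 * ln (real (node k)) \<Longrightarrow>
      prob (miss (B (node j)) (node j) \<inter> miss (B (node k)) (node k))
      \<le> A * ((exp (- level j) + real (node j) powr (- \<eta>))
          * (exp (- \<kappa> * sqrt (real (k - j))) + real (node k) powr (- \<eta>)))"
proof -
  obtain A where A: "1 \<le> A" "\<And>n m F. 1 \<le> n \<Longrightarrow> m \<le> n \<Longrightarrow> F \<in> events \<Longrightarrow>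
    prob (miss (B n) m \<inter> pre m F) \<le> A * (exp (- real m * prob (B n)) * prob F + real n powr (- \<gamma>))"
    by (rule prob_miss_le) blast
  \<comment> \<open>Fitted to the bound \<open>sqrt (k - j) \<le> 4 * ln (4 * node j)\<close>
    derived below: multiplied by \<open>\<kappa>\<close>, its right-hand side gets the coefficient
    \<open>\<gamma> - \<eta>\<close>.\<close>
  define \<kappa> where "\<kappa> = (\<gamma> - \<eta>) / 4"
  have \<kappa>: "0 < \<kappa>" "\<kappa> \<le> 1 / 2" "4 * \<kappa> = \<gamma> - \<eta>" using \<eta> \<gamma>01 by (auto simp: \<kappa>_def)
  have "prob (miss (B (node j)) (node j) \<inter> miss (B (node k)) (node k))
      \<le> 4 * A\<^sup>2 * ((exp (- level j) + real (node j) powr (- \<eta>))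
          * (exp (- \<kappa> * sqrt (real (k - j))) + real (node k) powr (- \<eta>)))"
    if jk: "j < k" and close: "1 < real (node j) * prob (B (node k))"
      and G: "level k \<le> 2 * ln (real (node k))" for j k
  proof -
    define a where "a = node j"
    define b where "b = node k"
    define u where "u = real (k - j)"
    define F where "F = miss (B b) (b - a)"
    have a1: "1 \<le> a" "1 \<le> b" "a \<le> b" using node_ge_1 node_mono[of j k] jk by (auto simp: a_def b_def)
    note cn = close_nodes[OF jk close, folded a_def b_def u_def]
    have F: "F \<in> events" by (simp add: F_def)
    have pow: "real b powr (- \<gamma>) \<le> real b powr (- \<eta>)" "real a powr (- \<gamma>) \<le> 4 * real a powr (- \<eta>) * exp (- \<kappa> * sqrt u)"
    proof -
      show "real b powr (- \<gamma>) \<le> real b powr (- \<eta>)" using a1 \<eta> by (intro powr_mono) auto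
      have sb: "0 < sqrt (real b)" using a1 by simp
      have lnb: "ln (real b) = 2 * ln (sqrt (real b))" using a1 by (simp add: ln_sqrt)
      have lsb: "ln (sqrt (real b)) \<le> sqrt (real b)" using ln_le_minus_one[OF sb] by simp
      have pb: "real b * prob (B b) = level k" by (simp add: level_def b_def)
      \<comment> \<open>Closeness inserts the factor \<open>a * prob (B b) > 1\<close>. As
        \<open>level k \<le> 2 * ln b \<le> 4 * sqrt b\<close>, one square root of \<open>b\<close>
        then cancels.\<close>
      have "real b \<le> real b * (real a * prob (B b))"
        using close a1 by (simp add: a_def b_def)
      also have "\<dots> = level k * real a" using pb by (simp add: mult_ac)
      also have "\<dots> \<le> 4 * sqrt (real b) * real a"
        using G lnb lsb by (intro mult_right_mono) (auto simp: b_def[symmetric])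
      finally have "sqrt (real b) * sqrt (real b) \<le> sqrt (real b) * (4 * real a)"
        using a1 by (simp add: mult_ac)
      then have sba: "sqrt (real b) \<le> 4 * real a" using sb by (rule mult_left_le_imp_le)
      have "sqrt u \<le> level k" using cn by simp
      also have "\<dots> \<le> 4 * ln (sqrt (real b))" using G lnb by (simp add: b_def)
      also have "ln (sqrt (real b)) \<le> ln (4 * real a)"
        using sba sb a1 by (subst ln_le_cancel_iff) auto
      finally have "\<kappa> * sqrt u \<le> (\<gamma> - \<eta>) * ln (4 * real a)"
        using \<kappa> mult_left_mono[of "sqrt u" "4 * ln (4 * real a)" \<kappa>] by (simp add: mult.assoc[symmetric] mult.commute[of \<kappa>])
      then have "exp (\<kappa> * sqrt u) \<le> (4 * real a) powr (\<gamma> - \<eta>)"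
        using a1 by (simp add: powr_def)
      also have "\<dots> = 4 powr (\<gamma> - \<eta>) * real a powr (\<gamma> - \<eta>)" by (simp add: powr_mult)
      also have "\<dots> \<le> 4 powr 1 * real a powr (\<gamma> - \<eta>)"
        using \<eta> \<gamma>01 by (intro mult_right_mono powr_mono) auto
      finally have "exp (\<kappa> * sqrt u) \<le> 4 * real a powr (\<gamma> - \<eta>)" by simp
      then have "1 \<le> 4 * real a powr (\<gamma> - \<eta>) * exp (- \<kappa> * sqrt u)"
        by (simp add: exp_minus field_simps)
      then have "real a powr (- \<gamma>) * 1 \<le> real a powr (- \<gamma>) * (4 * real a powr (\<gamma> - \<eta>) * exp (- \<kappa> * sqrt u))"
        by (intro mult_left_mono) auto
      also have "\<dots> = 4 * (real a powr (- \<gamma>) * real a powr (\<gamma> - \<eta>)) * exp (- \<kappa> * sqrt u)"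
        by simp
      also have "real a powr (- \<gamma>) * real a powr (\<gamma> - \<eta>) = real a powr (- \<eta>)"
        by (simp add: powr_add[symmetric])
      finally show "real a powr (- \<gamma>) \<le> 4 * real a powr (- \<eta>) * exp (- \<kappa> * sqrt u)" by simp
    qed
    have pF: "prob F \<le> A * (exp (- \<kappa> * sqrt u) + real b powr (- \<eta>))"
    proof -
      have "prob F = prob (miss (B b) (b - a) \<inter> pre (b - a) (space M))"
        by (simp add: F_def Int_absorb2 sets.sets_into_space)
      also have "\<dots> \<le> A * (exp (- real (b - a) * prob (B b)) * prob (space M) + real b powr (- \<gamma>))"
        using a1 by (intro A) auto
      also have "\<dots> \<le> A * (exp (- \<kappa> * sqrt u) + real b powr (- \<eta>))"
      proof -
        have "\<kappa> * sqrt u \<le> 1 / 2 * sqrt u" using \<kappa> by (intro mult_right_mono) (auto simp: u_def)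
        also have "\<dots> \<le> real (b - a) * prob (B b)" using cn by simp
        finally show ?thesis using A pow by (intro mult_left_mono add_mono) (auto simp: prob_space)
      qed
      finally show ?thesis .
    qed
    \<comment> \<open>The later ball is required to be missed only from time \<open>a\<close> on,
      which is an event in the future of the first miss.\<close>
    have "prob (miss (B a) a \<inter> miss (B b) b) \<le> prob (miss (B a) a \<inter> pre a F)"
      using miss_subset_pre[of "B b" b a] unfolding F_def by (intro finite_measure_mono) auto
    also have "\<dots> \<le> A * (exp (- real a * prob (B a)) * prob F + real a powr (- \<gamma>))"
      using a1 F by (intro A) auto
    also have "\<dots> \<le> A * (exp (- level j) * (A * (exp (- \<kappa> * sqrt u) + real b powr (- \<eta>)))
        + 4 * real a powr (- \<eta>) * exp (- \<kappa> * sqrt u))"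
      using A pF pow by (intro mult_left_mono add_mono) (auto simp: level_def a_def)
    also have "\<dots> \<le> A * (4 * A * (exp (- level j) * (exp (- \<kappa> * sqrt u) + real b powr (- \<eta>)))
        + 4 * A * (real a powr (- \<eta>) * (exp (- \<kappa> * sqrt u) + real b powr (- \<eta>))))"
    proof (intro mult_left_mono add_mono)
      have "A * (exp (- level j) * (exp (- \<kappa> * sqrt u) + real b powr (- \<eta>)))
          \<le> 4 * A * (exp (- level j) * (exp (- \<kappa> * sqrt u) + real b powr (- \<eta>)))"
        using A by (intro mult_right_mono) auto
      then show "exp (- level j) * (A * (exp (- \<kappa> * sqrt u) + real b powr (- \<eta>)))
          \<le> 4 * A * (exp (- level j) * (exp (- \<kappa> * sqrt u) + real b powr (- \<eta>)))"
        by (simp only: mult_ac)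
      have "4 * (real a powr (- \<eta>) * exp (- \<kappa> * sqrt u))
          \<le> 4 * A * (real a powr (- \<eta>) * (exp (- \<kappa> * sqrt u) + real b powr (- \<eta>)))"
        using A by (intro mult_mono mult_left_mono) auto
      then show "4 * real a powr (- \<eta>) * exp (- \<kappa> * sqrt u)
          \<le> 4 * A * (real a powr (- \<eta>) * (exp (- \<kappa> * sqrt u) + real b powr (- \<eta>)))"
        by (simp only: mult.assoc)
    qed (use A in simp)
    also have "\<dots> = 4 * A\<^sup>2 * ((exp (- level j) + real a powr (- \<eta>))
        * (exp (- \<kappa> * sqrt u) + real b powr (- \<eta>)))"
      by (simp add: power2_eq_square algebra_simps)
    finally show ?thesis by (simp only: a_def b_def u_def)
  qed
  moreover have "1 \<le> 4 * A\<^sup>2" using A one_le_power[of A 2] by linarith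
  ultimately show ?thesis using that[of "4 * A\<^sup>2" \<kappa>] \<kappa> by blast
qed

text \<open>The gap is long enough to beat \<open>\<Lambda> ^ node j\<close>, yet giving up the
  visits during it costs only a constant factor: its part linear in \<open>node j\<close> is
  controlled by \<open>node j * prob (B (node k)) \<le> 1\<close>, its logarithmic part by
  boundedness of \<open>prob (B n) * ln n\<close>.\<close>

lemma prob_miss_pair_distant:
  assumes C1: "0 \<le> C1" and \<Lambda>: "1 \<le> \<Lambda>"
    and far: "\<And>n m t \<delta> F. F \<in> events \<Longrightarrow> 0 < \<delta> \<Longrightarrow> \<delta> \<le> 1 \<Longrightarrow>
      prob (miss (B n) m \<inter> pre (m + t) F)
      \<le> prob (miss (B n) m) * prob F + C1 * \<Lambda> ^ m * exp (- \<tau> * real t) / \<delta>\<^sup>2 + \<delta>"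
  obtains A where "1 \<le> A" "\<And>j k. j < k \<Longrightarrow> real (node j) * prob (B (node k)) \<le> 1 \<Longrightarrow>
      prob (miss (B (node j)) (node j) \<inter> miss (B (node k)) (node k))
      \<le> A * ((exp (- level j) + real (node j) powr (- \<eta>))
          * (exp (- level k) + real (node k) powr (- \<eta>)))"
proof -
  obtain A where A: "1 \<le> A" "\<And>n m F. 1 \<le> n \<Longrightarrow> m \<le> n \<Longrightarrow> F \<in> events \<Longrightarrow>
    prob (miss (B n) m \<inter> pre m F) \<le> A * (exp (- real m * prob (B n)) * prob F + real n powr (- \<gamma>))"
    by (rule prob_miss_le) blast
  obtain D where D: "0 < D" "\<forall>\<^sub>F n in sequentially. prob (B n) \<le> D * real n powr (- \<sigma>)"
    by (rule prob_B_bound)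
  have "0 < \<sigma>" using exponents s01 by simp
  then have "((\<lambda>n. D * real n powr (- \<sigma>) * ln (real n)) \<longlongrightarrow> 0) sequentially"
    by real_asymp
  then have "\<forall>\<^sub>F n in sequentially. D * real n powr (- \<sigma>) * ln (real n) < 1"
    by (rule order_tendstoD) simp
  from eventually_conj[OF this D(2)] obtain n0 where n0: "\<And>n. n0 \<le> n \<Longrightarrow>
      D * real n powr (- \<sigma>) * ln (real n) < 1 \<and> prob (B n) \<le> D * real n powr (- \<sigma>)"
    unfolding eventually_sequentially by auto
  define Q where "Q = 1 + ln (real (n0 + 1))"
  have Q: "prob (B n) * ln (real n) \<le> Q" if n: "1 \<le> n" for n
  proof (cases "n0 \<le> n")
    case True
    have "prob (B n) * ln (real n) \<le> D * real n powr (- \<sigma>) * ln (real n)"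
      using n0[OF True] n by (intro mult_right_mono) auto
    moreover have "0 \<le> ln (real (n0 + 1))" by simp
    ultimately show ?thesis using n0[OF True] unfolding Q_def by linarith
  next
    case False
    have "prob (B n) * ln (real n) \<le> 1 * ln (real n)" using n by (intro mult_right_mono) auto
    also have "ln (real n) \<le> ln (real (n0 + 1))" using n False by (subst ln_le_cancel_iff) auto
    finally show ?thesis unfolding Q_def by linarith
  qed
  \<comment> \<open>Bounds the expected visits to the later ball up to the end of the gap: at most 1
    before time \<open>node j\<close>, and at most
    \<open>(ln \<Lambda> + 6 * Q) / \<tau> + 1\<close> during the gap.\<close>
  define W where "W = 2 + (ln \<Lambda> + 6 * Q) / \<tau>"
  define A' where "A' = A\<^sup>2 * (exp W + 1) + (C1 + 1)"
  have miss_le: "prob (miss (B n) m) \<le> A * (exp (- real m * prob (B n)) + real n powr (- \<eta>))"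
    if "1 \<le> n" "m \<le> n" for m n
  proof -
    have "prob (miss (B n) m) = prob (miss (B n) m \<inter> pre m (space M))"
      by (simp add: Int_absorb2 sets.sets_into_space)
    also have "\<dots> \<le> A * (exp (- real m * prob (B n)) * prob (space M) + real n powr (- \<gamma>))"
      using that by (intro A) auto
    also have "\<dots> \<le> A * (exp (- real m * prob (B n)) + real n powr (- \<eta>))"
      using A that \<eta> by (intro mult_left_mono add_mono powr_mono) (auto simp: prob_space)
    finally show ?thesis .
  qed
  have "prob (miss (B (node j)) (node j) \<inter> miss (B (node k)) (node k))
      \<le> A' * ((exp (- level j) + real (node j) powr (- \<eta>))
          * (exp (- level k) + real (node k) powr (- \<eta>)))"
    if jk: "j < k" and dist: "real (node j) * prob (B (node k)) \<le> 1" for j k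
  proof -
    define a where "a = node j"
    define b where "b = node k"
    define p where "p = prob (B b)"
    \<comment> \<open>The coefficient 6 leaves \<open>1 / b ^ 6\<close> once
      \<open>\<Lambda> ^ a\<close> is cancelled; division by \<open>\<delta> ^ 2\<close> with
      \<open>\<delta> = 1 / (a * b)\<close> gives \<open>a ^ 2 / b ^ 4\<close>, which is at most
      \<open>1 / (a * b)\<close>.\<close>
    define t where "t = nat \<lceil>(real a * ln \<Lambda> + 6 * ln (real b)) / \<tau>\<rceil>"
    define \<delta> where "\<delta> = 1 / (real a * real b)"
    define F where "F = miss (B b) (b - (a + t))"
    define ej where "ej = real a powr (- \<eta>)"
    define ek where "ek = real b powr (- \<eta>)"
    have e0: "0 \<le> ej" "0 \<le> ek" by (auto simp: ej_def ek_def)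
    have ab: "1 \<le> a" "1 \<le> b" "a \<le> b" using node_ge_1 node_mono[of j k] jk by (auto simp: a_def b_def)
    have p0: "0 \<le> p" by (simp add: p_def)
    have t0: "0 \<le> (real a * ln \<Lambda> + 6 * ln (real b)) / \<tau>"
      using \<Lambda> ab \<tau>_pos by (intro divide_nonneg_pos) auto
    have t: "real t \<le> (real a * ln \<Lambda> + 6 * ln (real b)) / \<tau> + 1"
      "(real a * ln \<Lambda> + 6 * ln (real b)) / \<tau> \<le> real t"
      using t0 unfolding t_def by linarith+
    have tp: "real t * p \<le> W - 1"
    proof -
      have "real t * p \<le> ((real a * ln \<Lambda> + 6 * ln (real b)) / \<tau> + 1) * p"
        using t p0 by (intro mult_right_mono) auto
      also have "\<dots> = (real a * p * ln \<Lambda> + 6 * (p * ln (real b))) / \<tau> + p"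
        by (simp add: field_simps)
      also have "\<dots> \<le> (1 * ln \<Lambda> + 6 * Q) / \<tau> + 1"
        using dist \<Lambda> Q[OF ab(2)] \<tau>_pos
        by (intro add_mono divide_right_mono mult_right_mono mult_left_mono) (auto simp: a_def b_def p_def)
      finally show ?thesis by (simp add: W_def)
    qed
    have pF: "prob F \<le> A * (exp W * exp (- level k) + ek)"
    proof -
      have "real b - real a - real t \<le> real (b - (a + t))" by linarith
      then have "(real b - real a - real t) * p \<le> real (b - (a + t)) * p"
        using p0 by (intro mult_right_mono) auto
      moreover have "real a * p \<le> 1" using dist by (simp add: a_def b_def p_def)
      ultimately have "real b * p - W \<le> real (b - (a + t)) * p"
        using tp by (simp add: algebra_simps)
      then have ex: "exp (- real (b - (a + t)) * p) \<le> exp (W + - level k)"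
        by (simp add: level_def b_def p_def)
      have "prob F \<le> A * (exp (- real (b - (a + t)) * p) + ek)"
        unfolding F_def p_def ek_def using ab by (intro miss_le) auto
      also have "\<dots> \<le> A * (exp W * exp (- level k) + ek)"
        using ex A by (intro mult_left_mono add_right_mono) (auto simp: exp_add[symmetric])
      finally show ?thesis .
    qed
    have pj: "prob (miss (B a) a) \<le> A * (exp (- level j) + ej)"
      using miss_le[of a a] ab by (simp add: level_def a_def ej_def)
    have err: "C1 * \<Lambda> ^ a * exp (- \<tau> * real t) / \<delta>\<^sup>2 + \<delta> \<le> (C1 + 1) * (ej * ek)"
    proof -
      have "- \<tau> * real t \<le> - (real a * ln \<Lambda>) - 6 * ln (real b)"
        using t(2) \<tau>_pos by (simp add: field_simps)
      then have "exp (- \<tau> * real t) \<le> exp (- (real a * ln \<Lambda>) - 6 * ln (real b))"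
        by (simp only: exp_le_cancel_iff)
      also have "\<dots> = 1 / (\<Lambda> ^ a * real b ^ 6)"
      proof -
        have "exp (real a * ln \<Lambda>) = \<Lambda> ^ a" using \<Lambda> by (simp add: exp_of_nat_mult)
        moreover have "exp (6 * ln (real b)) = real b ^ 6"
          using ab exp_of_nat_mult[of 6 "ln (real b)"] by simp
        ultimately show ?thesis by (simp add: exp_diff exp_minus divide_inverse)
      qed
      finally have "\<Lambda> ^ a * exp (- \<tau> * real t) \<le> \<Lambda> ^ a * (1 / (\<Lambda> ^ a * real b ^ 6))"
        using \<Lambda> by (intro mult_left_mono) auto
      also have "\<dots> = 1 / real b ^ 6" using \<Lambda> by simp
      finally have "\<Lambda> ^ a * exp (- \<tau> * real t) / \<delta>\<^sup>2 \<le> 1 / real b ^ 6 / \<delta>\<^sup>2"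
        by (intro divide_right_mono) auto
      also have "\<dots> = (real a) ^ 2 / (real b) ^ 4"
        using ab by (simp add: \<delta>_def field_simps eval_nat_numeral)
      also have "\<dots> \<le> 1 / (real a * real b)"
      proof -
        have "real a ^ 2 * (real a * real b) \<le> real b ^ 2 * (real b * real b)"
          using ab by (intro mult_mono power_mono) auto
        then show ?thesis using ab by (simp add: field_simps eval_nat_numeral)
      qed
      finally have "C1 * (\<Lambda> ^ a * exp (- \<tau> * real t) / \<delta>\<^sup>2) \<le> C1 * (1 / (real a * real b))"
        using C1 by (intro mult_left_mono) auto
      then have "C1 * \<Lambda> ^ a * exp (- \<tau> * real t) / \<delta>\<^sup>2 + \<delta> \<le> (C1 + 1) * (1 / (real a * real b))"
        by (simp add: \<delta>_def add_divide_distrib mult.assoc)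
      also have "1 / (real a * real b) = real a powr (- 1) * real b powr (- 1)"
        using ab by (simp add: powr_minus field_simps)
      also have "(C1 + 1) * (real a powr (- 1) * real b powr (- 1)) \<le> (C1 + 1) * (ej * ek)"
        unfolding ej_def ek_def using ab \<eta> \<gamma>01 C1
        by (intro mult_left_mono mult_mono powr_mono) auto
      finally show ?thesis .
    qed
    have \<delta>1: "0 < \<delta>" "\<delta> \<le> 1"
    proof -
      have "1 * 1 \<le> real a * real b" using ab by (intro mult_mono) auto
      then show "0 < \<delta>" "\<delta> \<le> 1" by (auto simp: \<delta>_def)
    qed
    have "prob (miss (B a) a \<inter> miss (B b) b) \<le> prob (miss (B a) a \<inter> pre (a + t) F)"
      using miss_subset_pre[of "B b" b "a + t"] unfolding F_def by (intro finite_measure_mono) auto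
    also have "\<dots> \<le> prob (miss (B a) a) * prob F + C1 * \<Lambda> ^ a * exp (- \<tau> * real t) / \<delta>\<^sup>2 + \<delta>"
      using \<delta>1 by (intro far) (simp_all add: F_def)
    also have "\<dots> \<le> prob (miss (B a) a) * prob F + (C1 + 1) * (ej * ek)"
      using err by simp
    also have "\<dots> \<le> A * (exp (- level j) + ej) * (A * (exp W * exp (- level k) + ek)) + (C1 + 1) * (ej * ek)"
      using pj pF A e0 by (intro add_right_mono mult_mono) auto
    also have "\<dots> \<le> A\<^sup>2 * (exp W + 1) * ((exp (- level j) + ej) * (exp (- level k) + ek))
        + (C1 + 1) * ((exp (- level j) + ej) * (exp (- level k) + ek))"
    proof (rule add_mono)
      have "exp W * exp (- level k) + ek \<le> (exp W + 1) * (exp (- level k) + ek)"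
        using e0 by (simp add: algebra_simps)
      then have "A\<^sup>2 * (exp (- level j) + ej) * (exp W * exp (- level k) + ek)
          \<le> A\<^sup>2 * (exp (- level j) + ej) * ((exp W + 1) * (exp (- level k) + ek))"
        using e0 by (intro mult_left_mono) auto
      then show "A * (exp (- level j) + ej) * (A * (exp W * exp (- level k) + ek))
          \<le> A\<^sup>2 * (exp W + 1) * ((exp (- level j) + ej) * (exp (- level k) + ek))"
        by (simp only: power2_eq_square mult_ac)
      have "ej * ek \<le> (exp (- level j) + ej) * (exp (- level k) + ek)"
        using e0 by (intro mult_mono) auto
      then show "(C1 + 1) * (ej * ek) \<le> (C1 + 1) * ((exp (- level j) + ej) * (exp (- level k) + ek))"
        using C1 by (intro mult_left_mono) auto
    qed
    also have "\<dots> = A' * ((exp (- level j) + ej) * (exp (- level k) + ek))"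
      by (simp add: A'_def distrib_right)
    finally show ?thesis by (simp only: a_def b_def ej_def ek_def)
  qed
  moreover have "1 \<le> A'"
  proof -
    have "1 * 1 \<le> A\<^sup>2 * (exp W + 1)" using A one_le_power[of A 2] by (intro mult_mono) auto
    then show ?thesis using C1 by (simp add: A'_def)
  qed
  ultimately show ?thesis using that by blast
qed

text \<open>The three estimates for single nodes, close pairs and distant pairs are exactly the
  inputs of the second-moment lemma. The decorrelation \<open>far\<close> is left as a hypothesis,
  to be supplied by the operator with a hole.\<close>

theorem infinitely_often_missed:
  assumes div: "\<not> summable (\<lambda>n. prob (B n) * exp (- real n * prob (B n)))"
    and C1: "0 \<le> C1" and \<Lambda>: "1 \<le> \<Lambda>"
    and far: "\<And>n m t \<delta> F. F \<in> events \<Longrightarrow> 0 < \<delta> \<Longrightarrow> \<delta> \<le> 1 \<Longrightarrow>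
      prob (miss (B n) m \<inter> pre (m + t) F)
      \<le> prob (miss (B n) m) * prob F + C1 * \<Lambda> ^ m * exp (- \<tau> * real t) / \<delta>\<^sup>2 + \<delta>"
  shows "0 < prob (\<Inter>K. \<Union>m\<in>{K..}. miss (B m) m)"
proof -
  obtain A1 where A1: "1 \<le> A1" "\<And>n m F. 1 \<le> n \<Longrightarrow> m \<le> n \<Longrightarrow> F \<in> events \<Longrightarrow>
    prob (miss (B n) m \<inter> pre m F) \<le> A1 * (exp (- real m * prob (B n)) * prob F + real n powr (- \<gamma>))"
    by (rule prob_miss_le) blast
  obtain A2 where A2: "1 \<le> A2" "\<And>n. 1 \<le> n \<Longrightarrow> real n * prob (B n) \<le> 2 * ln (real n) \<Longrightarrow>
    exp (- 2) * exp (- (real n * prob (B n))) - A2 * real n powr (- \<eta>) \<le> prob (miss (B n) n)"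
    by (rule prob_miss_ge) blast
  obtain A3 \<kappa> where A3: "1 \<le> A3" "0 < \<kappa>" "\<And>j k. j < k \<Longrightarrow> 1 < real (node j) * prob (B (node k)) \<Longrightarrow>
      level k \<le> 2 * ln (real (node k)) \<Longrightarrow>
      prob (miss (B (node j)) (node j) \<inter> miss (B (node k)) (node k))
      \<le> A3 * ((exp (- level j) + real (node j) powr (- \<eta>))
          * (exp (- \<kappa> * sqrt (real (k - j))) + real (node k) powr (- \<eta>)))"
    by (rule prob_miss_pair_close) blast
  obtain A4 where A4: "1 \<le> A4" "\<And>j k. j < k \<Longrightarrow> real (node j) * prob (B (node k)) \<le> 1 \<Longrightarrow>
      prob (miss (B (node j)) (node j) \<inter> miss (B (node k)) (node k))
      \<le> A4 * ((exp (- level j) + real (node j) powr (- \<eta>))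
          * (exp (- level k) + real (node k) powr (- \<eta>)))"
    using prob_miss_pair_distant[OF C1 \<Lambda> far] by blast
  define A where "A = A1 + A2 + A3 + A4"
  have A: "0 < A" "A1 \<le> A" "A2 \<le> A" "A3 \<le> A" "A4 \<le> A"
    using A1 A2 A3 A4 by (auto simp: A_def)
  \<comment> \<open>The lower bound and the close-pair bound are stated for logarithmic levels. At
    the discarded nodes \<open>exp (- level k)\<close> is at most
    \<open>real (Suc k) powr (- 2)\<close>, so divergence survives the restriction.\<close>
  define G where "G k \<longleftrightarrow> level k \<le> 2 * ln (real (node k))" for k
  define E where "E k = (if G k then miss (B (node k)) (node k) else {})" for k
  define a where "a k = (if G k then exp (- level k) else 0)" for k
  define e where "e k = real (node k) powr (- \<eta>)" for k
  define d where "d i = exp (- \<kappa> * sqrt (real i))" for i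
  have nonneg: "0 \<le> a k" "0 \<le> e k" "0 \<le> d k" for k
    by (auto simp: a_def e_def d_def)
  have "0 < prob (\<Inter>K. \<Union>k\<in>{K..}. E k)"
  proof (rule second_borel_cantelli_correlated[where a = a and d = d and e = e and c = "exp (- 2)" and C = A])
    show "E k \<in> events" for k by (simp add: E_def)
    show "\<not> summable a"
    proof
      assume s: "summable a"
      have "summable (\<lambda>k. a k + real (Suc k) powr (- 2))"
      proof (rule summable_add[OF s])
        have "summable (\<lambda>k. real k powr (- 2))" by (simp add: summable_real_powr_iff)
        then show "summable (\<lambda>k. real (Suc k) powr (- 2))" by (subst summable_Suc_iff)
      qed
      then have "summable (\<lambda>k. exp (- level k))"
      proof (rule summable_comparison_test'[where N = 0])
        fix k
        have "exp (- level k) \<le> a k + real (Suc k) powr (- 2)"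
        proof (cases "G k")
          case False
          then have "exp (- level k) \<le> exp (- 2 * ln (real (node k)))"
            by (simp add: G_def)
          also have "\<dots> = real (node k) powr (- 2)"
            using node_ge_1[of k] by (simp add: powr_def)
          also have "\<dots> \<le> real (Suc k) powr (- 2)"
            using node_gt[of k] by (intro powr_mono2') auto
          finally show ?thesis using nonneg(1)[of k] by linarith
        qed (simp add: a_def)
        then show "norm (exp (- level k)) \<le> a k + real (Suc k) powr (- 2)" by simp
      qed
      then show False using not_summable_level_exp[OF div] by blast
    qed
    show "summable e" unfolding e_def by (rule summable_node_powr_\<eta>)
    show "summable d" unfolding d_def using A3(2) by (rule summable_exp_sqrt)
    show "exp (- 2) * a k - A * e k \<le> prob (E k)" for k
    proof (cases "G k")
      case True
      have "exp (- 2) * exp (- level k) - A2 * e k \<le> prob (miss (B (node k)) (node k))"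
        using A2(2)[OF node_ge_1, of k] True by (simp add: G_def level_def e_def)
      moreover have "A2 * e k \<le> A * e k" using A nonneg by (intro mult_right_mono) auto
      ultimately show ?thesis using True by (simp add: a_def E_def)
    next
      case False
      then show ?thesis using A nonneg[of k] by (simp add: a_def E_def)
    qed
    show "prob (E k) \<le> A * (a k + e k)" for k
    proof (cases "G k")
      case True
      have "prob (E k) = prob (miss (B (node k)) (node k) \<inter> pre (node k) (space M))"
        using True by (simp add: E_def Int_absorb2 sets.sets_into_space)
      also have "\<dots> \<le> A1 * (exp (- real (node k) * prob (B (node k))) * prob (space M) + real (node k) powr (- \<gamma>))"
        using node_ge_1 by (intro A1) auto
      also have "\<dots> \<le> A * (a k + e k)"
        using A A1 True node_ge_1[of k] \<eta>
        by (intro mult_mono add_mono) (auto simp: prob_space a_def e_def level_def intro!: powr_mono)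
      finally show ?thesis .
    next
      case False
      then show ?thesis using A nonneg[of k] by (simp add: a_def E_def)
    qed
    show "prob (E j \<inter> E k) \<le> A * ((a j + e j) * (a k + e k) + (a j + e j) * d (k - j))" if jk: "j < k" for j k
    proof (cases "G j \<and> G k")
      case True
      then have aE: "a j = exp (- level j)" "a k = exp (- level k)"
        "E j = miss (B (node j)) (node j)" "E k = miss (B (node k)) (node k)"
        by (auto simp: a_def E_def)
      have prods: "0 \<le> (a j + e j) * (a k + e k)" "0 \<le> (a j + e j) * a k" "0 \<le> (a j + e j) * d (k - j)"
        "0 \<le> (a j + e j) * (d (k - j) + e k)"
        using nonneg by simp_all
      show ?thesis
      proof (cases "1 < real (node j) * prob (B (node k))")
        case c: True
        have "prob (E j \<inter> E k) \<le> A3 * ((a j + e j) * (d (k - j) + e k))"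
          using A3(3)[OF jk c] True unfolding aE by (simp add: G_def e_def d_def)
        also have "\<dots> \<le> A * ((a j + e j) * (d (k - j) + e k))"
          using A prods by (intro mult_right_mono)
        also have "\<dots> \<le> A * ((a j + e j) * (a k + e k) + (a j + e j) * d (k - j))"
          using A prods by (intro mult_left_mono) (auto simp: distrib_left)
        finally show ?thesis .
      next
        case c: False
        have "prob (E j \<inter> E k) \<le> A4 * ((a j + e j) * (a k + e k))"
          using A4(2)[OF jk] c unfolding aE by (simp add: e_def)
        also have "\<dots> \<le> A * ((a j + e j) * (a k + e k))"
          using A prods by (intro mult_right_mono)
        also have "\<dots> \<le> A * ((a j + e j) * (a k + e k) + (a j + e j) * d (k - j))"
          using A prods by (intro mult_left_mono) auto
        finally show ?thesis .
      qed
    next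
      case False
      then have "E j \<inter> E k = {}" by (auto simp: E_def)
      then show ?thesis using A nonneg by simp
    qed
  qed (use nonneg A in auto)
  also have "prob (\<Inter>K. \<Union>k\<in>{K..}. E k) \<le> prob (\<Inter>K. \<Union>m\<in>{K..}. miss (B m) m)"
  proof (rule finite_measure_mono)
    show "(\<Inter>K. \<Union>k\<in>{K..}. E k) \<subseteq> (\<Inter>K. \<Union>m\<in>{K..}. miss (B m) m)"
    proof (intro subsetI INT_I)
      fix x K assume "x \<in> (\<Inter>K. \<Union>k\<in>{K..}. E k)"
      then obtain k where k: "K \<le> k" "x \<in> E k" by (metis INT_E UNIV_I UN_E atLeast_iff)
      then have "x \<in> miss (B (node k)) (node k)" by (auto simp: E_def split: if_splits)
      moreover have "K \<le> node k" using k node_gt[of k] by simp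
      ultimately show "x \<in> (\<Union>m\<in>{K..}. miss (B m) m)" by auto
    qed
    show "(\<Inter>K. \<Union>m\<in>{K..}. miss (B m) m) \<in> events"
      by (intro sets.countable_INT' sets.countable_UN') auto
  qed
  finally show ?thesis .
qed

end

section \<open>Functions of bounded variation\<close>

lemma variation_sum_le:
  assumes "bounded_variation_on X \<phi>" "mono_on {..n} t" "t ` {..n} \<subseteq> X"
  shows "(\<Sum>i<n. norm (\<phi> (t (Suc i)) - \<phi> (t i))) \<le> total_variation X \<phi>"
  using assms unfolding bounded_variation_on_def total_variation_def
  by (intro cSup_upper) (auto simp: variation_sums_def)

lemma variation_sums_nonempty:
  assumes "X \<noteq> {}" shows "variation_sums X \<phi> \<noteq> {}"
proof -
  obtain x where "x \<in> X" using assms by blast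
  then have "(\<Sum>i<0. norm (\<phi> ((\<lambda>_. x) (Suc i)) - \<phi> ((\<lambda>_. x) i))) \<in> variation_sums X \<phi>"
    unfolding variation_sums_def by (intro CollectI exI[of _ 0] exI[of _ "\<lambda>_. x"]) (auto simp: mono_on_def)
  then show ?thesis by blast
qed

lemma bounded_variationI:
  assumes "\<And>n t. mono_on {..n} t \<Longrightarrow> t ` {..n} \<subseteq> X \<Longrightarrow>
    (\<Sum>i<n. norm (\<phi> (t (Suc i)) - \<phi> (t i))) \<le> K"
  shows "bounded_variation_on X \<phi>"
  unfolding bounded_variation_on_def using assms
  by (intro bdd_aboveI[of _ K]) (auto simp: variation_sums_def)

lemma total_variation_le:
  assumes "X \<noteq> {}" "\<And>n t. mono_on {..n} t \<Longrightarrow> t ` {..n} \<subseteq> X \<Longrightarrow>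
    (\<Sum>i<n. norm (\<phi> (t (Suc i)) - \<phi> (t i))) \<le> K"
  shows "total_variation X \<phi> \<le> K"
  unfolding total_variation_def using assms(2)
  by (intro cSup_least variation_sums_nonempty assms(1)) (auto simp: variation_sums_def)

lemma norm_diff_le_total_variation:
  assumes bv: "bounded_variation_on X \<phi>" and xy: "x \<in> X" "y \<in> X"
  shows "norm (\<phi> y - \<phi> x) \<le> total_variation X \<phi>"
proof -
  have *: "norm (\<phi> b - \<phi> a) \<le> total_variation X \<phi>" if "a \<le> b" "a \<in> X" "b \<in> X" for a b
    using variation_sum_le[OF bv, of 1 "\<lambda>i. if i = 0 then a else b"] that
    by (auto simp: mono_on_def image_subset_iff split: if_splits)
  show ?thesis
    using *[of x y] *[of y x] xy by (cases "x \<le> y") (auto simp: norm_minus_commute)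
qed

lemma total_variation_nonneg:
  assumes "bounded_variation_on X \<phi>" "X \<noteq> {}"
  shows "0 \<le> total_variation X \<phi>"
  using assms norm_diff_le_total_variation[OF assms(1)] by (metis diff_self equals0I norm_zero)

lemma bdd_above_norm:
  assumes "bounded_variation_on X \<phi>"
  shows "bdd_above ((\<lambda>x. norm (\<phi> x)) ` X)"
proof (cases "X = {}")
  case False
  then obtain x0 where x0: "x0 \<in> X" by blast
  have "norm (\<phi> x) \<le> norm (\<phi> x0) + total_variation X \<phi>" if "x \<in> X" for x
    using norm_diff_le_total_variation[OF assms x0 that] norm_triangle_sub[of "\<phi> x" "\<phi> x0"] by linarith
  then show ?thesis by (intro bdd_aboveI) auto
qed simp

lemma norm_le_SUP:
  assumes "bounded_variation_on X \<phi>" "x \<in> X"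
  shows "norm (\<phi> x) \<le> (SUP x\<in>X. norm (\<phi> x))"
  using bdd_above_norm[OF assms(1)] assms(2) by (rule cSUP_upper[rotated])

lemma SUP_norm_nonneg:
  assumes "bounded_variation_on X \<phi>" "X \<noteq> {}"
  shows "0 \<le> (SUP x\<in>X. norm (\<phi> x))"
  using assms norm_le_SUP[OF assms(1)] by (metis equals0I norm_ge_zero order_trans)

lemma norm_le_bv_norm:
  assumes "bounded_variation_on X \<phi>" "x \<in> X"
  shows "norm (\<phi> x) \<le> bv_norm X \<phi>"
  using norm_le_SUP[OF assms] total_variation_nonneg[OF assms(1)] assms(2)
  unfolding bv_norm_def by force

lemma bv_norm_nonneg:
  assumes "bounded_variation_on X \<phi>" "X \<noteq> {}"
  shows "0 \<le> bv_norm X \<phi>"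
  using total_variation_nonneg[OF assms] SUP_norm_nonneg[OF assms] unfolding bv_norm_def by simp

lemma bv_norm_le:
  assumes "X \<noteq> {}" "\<And>n t. mono_on {..n} t \<Longrightarrow> t ` {..n} \<subseteq> X \<Longrightarrow>
    (\<Sum>i<n. norm (\<phi> (t (Suc i)) - \<phi> (t i))) \<le> K" "\<And>x. x \<in> X \<Longrightarrow> norm (\<phi> x) \<le> L"
  shows "bv_norm X \<phi> \<le> K + L"
  unfolding bv_norm_def
  by (intro add_mono total_variation_le cSUP_least assms)

text \<open>The product rule for differences bounds the variation by the two cross terms. Adding the
  product of the suprema, and the nonnegative product of the variations, completes the product of
  the two norms.\<close>

lemma
  fixes \<phi> \<psi> :: "real \<Rightarrow> real"
  assumes \<phi>: "bounded_variation_on X \<phi>" and \<psi>: "bounded_variation_on X \<psi>" and X: "X \<noteq> {}"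
  shows bounded_variation_mult: "bounded_variation_on X (\<lambda>x. \<phi> x * \<psi> x)"
    and bv_norm_mult_le: "bv_norm X (\<lambda>x. \<phi> x * \<psi> x) \<le> bv_norm X \<phi> * bv_norm X \<psi>"
proof -
  define a where "a = (SUP x\<in>X. norm (\<phi> x))"
  define b where "b = (SUP x\<in>X. norm (\<psi> x))"
  have a: "0 \<le> a" "\<And>x. x \<in> X \<Longrightarrow> \<bar>\<phi> x\<bar> \<le> a"
    using SUP_norm_nonneg[OF \<phi> X] norm_le_SUP[OF \<phi>] by (auto simp: a_def)
  have b: "0 \<le> b" "\<And>x. x \<in> X \<Longrightarrow> \<bar>\<psi> x\<bar> \<le> b"
    using SUP_norm_nonneg[OF \<psi> X] norm_le_SUP[OF \<psi>] by (auto simp: b_def)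
  have v: "(\<Sum>i<n. norm (\<phi> (t (Suc i)) * \<psi> (t (Suc i)) - \<phi> (t i) * \<psi> (t i)))
      \<le> a * total_variation X \<psi> + b * total_variation X \<phi>"
    if t: "mono_on {..n} t" "t ` {..n} \<subseteq> X" for n t
  proof -
    have "(\<Sum>i<n. norm (\<phi> (t (Suc i)) * \<psi> (t (Suc i)) - \<phi> (t i) * \<psi> (t i)))
        \<le> (\<Sum>i<n. a * norm (\<psi> (t (Suc i)) - \<psi> (t i)) + b * norm (\<phi> (t (Suc i)) - \<phi> (t i)))"
    proof (rule sum_mono)
      fix i assume "i \<in> {..<n}"
      then have m: "t (Suc i) \<in> X" "t i \<in> X" using t(2) by (auto simp: image_subset_iff)
      have "\<phi> (t (Suc i)) * \<psi> (t (Suc i)) - \<phi> (t i) * \<psi> (t i)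
          = \<phi> (t (Suc i)) * (\<psi> (t (Suc i)) - \<psi> (t i)) + \<psi> (t i) * (\<phi> (t (Suc i)) - \<phi> (t i))"
        by (simp add: algebra_simps)
      then have "norm (\<phi> (t (Suc i)) * \<psi> (t (Suc i)) - \<phi> (t i) * \<psi> (t i))
          \<le> \<bar>\<phi> (t (Suc i))\<bar> * \<bar>\<psi> (t (Suc i)) - \<psi> (t i)\<bar> + \<bar>\<psi> (t i)\<bar> * \<bar>\<phi> (t (Suc i)) - \<phi> (t i)\<bar>"
        by (metis abs_mult abs_triangle_ineq real_norm_def)
      also have "\<dots> \<le> a * \<bar>\<psi> (t (Suc i)) - \<psi> (t i)\<bar> + b * \<bar>\<phi> (t (Suc i)) - \<phi> (t i)\<bar>"
        using a b m by (intro add_mono mult_right_mono) auto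
      finally show "norm (\<phi> (t (Suc i)) * \<psi> (t (Suc i)) - \<phi> (t i) * \<psi> (t i))
          \<le> a * norm (\<psi> (t (Suc i)) - \<psi> (t i)) + b * norm (\<phi> (t (Suc i)) - \<phi> (t i))" by simp
    qed
    also have "\<dots> = a * (\<Sum>i<n. norm (\<psi> (t (Suc i)) - \<psi> (t i))) + b * (\<Sum>i<n. norm (\<phi> (t (Suc i)) - \<phi> (t i)))"
      by (simp add: sum.distrib sum_distrib_left)
    also have "\<dots> \<le> a * total_variation X \<psi> + b * total_variation X \<phi>"
      using a b t by (intro add_mono mult_left_mono variation_sum_le \<phi> \<psi>)
    finally show ?thesis .
  qed
  show "bounded_variation_on X (\<lambda>x. \<phi> x * \<psi> x)" using v by (rule bounded_variationI)
  have "bv_norm X (\<lambda>x. \<phi> x * \<psi> x) \<le> (a * total_variation X \<psi> + b * total_variation X \<phi>) + a * b"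
    using v a b by (intro bv_norm_le X) (auto simp: abs_mult intro!: mult_mono)
  also have "\<dots> \<le> bv_norm X \<phi> * bv_norm X \<psi>"
    using total_variation_nonneg[OF \<phi> X] total_variation_nonneg[OF \<psi> X]
    unfolding bv_norm_def a_def[symmetric] b_def[symmetric] by (simp add: algebra_simps)
  finally show "bv_norm X (\<lambda>x. \<phi> x * \<psi> x) \<le> bv_norm X \<phi> * bv_norm X \<psi>" .
qed

lemma
  fixes \<phi> :: "real \<Rightarrow> real"
  assumes \<phi>: "bounded_variation_on X \<phi>" and X: "X \<noteq> {}" and c: "0 \<le> c"
  shows bounded_variation_cmult: "bounded_variation_on X (\<lambda>x. c * \<phi> x)"
    and bv_norm_cmult_le: "bv_norm X (\<lambda>x. c * \<phi> x) \<le> c * bv_norm X \<phi>"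
proof -
  have v: "(\<Sum>i<n. norm (c * \<phi> (t (Suc i)) - c * \<phi> (t i))) \<le> c * total_variation X \<phi>"
    if t: "mono_on {..n} t" "t ` {..n} \<subseteq> X" for n t
  proof -
    have "(\<Sum>i<n. norm (c * \<phi> (t (Suc i)) - c * \<phi> (t i))) = c * (\<Sum>i<n. norm (\<phi> (t (Suc i)) - \<phi> (t i)))"
      using c by (simp add: sum_distrib_left abs_mult right_diff_distrib[symmetric])
    also have "\<dots> \<le> c * total_variation X \<phi>"
      using c t by (intro mult_left_mono variation_sum_le \<phi>)
    finally show ?thesis .
  qed
  show "bounded_variation_on X (\<lambda>x. c * \<phi> x)" using v by (rule bounded_variationI)
  have "bv_norm X (\<lambda>x. c * \<phi> x) \<le> c * total_variation X \<phi> + c * (SUP x\<in>X. norm (\<phi> x))"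
    using v norm_le_SUP[OF \<phi>] c by (intro bv_norm_le X) (auto simp: abs_mult intro!: mult_left_mono)
  then show "bv_norm X (\<lambda>x. c * \<phi> x) \<le> c * bv_norm X \<phi>"
    by (simp add: bv_norm_def distrib_left)
qed

text \<open>An interval is the difference of two lower sets.\<close>

lemma variation_indicator_interval:
  fixes t :: "nat \<Rightarrow> real"
  assumes I: "is_interval I" and t: "mono_on {..n} t"
  shows "(\<Sum>i<n. norm (indicator I (t (Suc i)) - indicator I (t i) :: real)) \<le> 2"
proof -
  \<comment> \<open>The downward closure of \<open>I\<close>. By convexity \<open>D - I\<close> is a
    lower set too, and the indicator of a lower set decreases along \<open>t\<close>, so its
    variation telescopes to at most 1.\<close>
  define D where "D = {x. \<exists>y\<in>I. x \<le> y}"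
  have step: "t i \<le> t (Suc i)" if "i < n" for i
    using t that by (auto simp: mono_on_def)
  have lower: "(\<Sum>i<n. norm (indicator L (t (Suc i)) - indicator L (t i) :: real)) \<le> 1"
    if L: "\<And>x y. y \<in> L \<Longrightarrow> x \<le> y \<Longrightarrow> x \<in> L" for L
  proof -
    have "(\<Sum>i<n. norm (indicator L (t (Suc i)) - indicator L (t i) :: real))
        = (\<Sum>i<n. indicator L (t i) - indicator L (t (Suc i)))"
      using L step by (intro sum.cong) (auto simp: indicator_def)
    also have "\<dots> = indicator L (t 0) - indicator L (t n)"
      by (rule sum_lessThan_telescope')
    also have "\<dots> \<le> 1" by (simp add: indicator_def)
    finally show ?thesis .
  qed
  have I': "y \<in> I" if "x \<in> I" "z \<in> I" "x \<le> y" "y \<le> z" for x y z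
    using I that unfolding is_interval_1 by blast
  have "(\<Sum>i<n. norm (indicator I (t (Suc i)) - indicator I (t i) :: real))
      \<le> (\<Sum>i<n. norm (indicator D (t (Suc i)) - indicator D (t i) :: real)
          + norm (indicator (D - I) (t (Suc i)) - indicator (D - I) (t i) :: real))"
    by (intro sum_mono) (auto simp: indicator_def D_def)
  also have "\<dots> \<le> 1 + 1"
    unfolding sum.distrib
    by (intro add_mono lower) (auto simp: D_def intro: order_trans dest: I')
  finally show ?thesis by simp
qed

text \<open>The number 3 is variation at most 2 plus supremum at most 1; it becomes the price of
  each cut by a hole.\<close>

lemma
  fixes X I :: "real set"
  assumes I: "is_interval I" and X: "X \<noteq> {}"
  shows bounded_variation_indicator: "bounded_variation_on X (indicator I :: real \<Rightarrow> real)"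
    and bv_norm_indicator_le: "bv_norm X (indicator I :: real \<Rightarrow> real) \<le> 3"
    and bounded_variation_indicator_compl: "bounded_variation_on X (indicator (- I) :: real \<Rightarrow> real)"
    and bv_norm_indicator_compl_le: "bv_norm X (indicator (- I) :: real \<Rightarrow> real) \<le> 3"
proof -
  have *: "norm (indicator (- I) x - indicator (- I) y :: real) = norm (indicator I x - indicator I y :: real)" for x y
    by (auto simp: indicator_def)
  show "bounded_variation_on X (indicator I :: real \<Rightarrow> real)"
    "bounded_variation_on X (indicator (- I) :: real \<Rightarrow> real)"
    using variation_indicator_interval[OF I] by (auto intro!: bounded_variationI[of _ _ 2] simp: * simp del: real_norm_def)
  have "bv_norm X (indicator I :: real \<Rightarrow> real) \<le> 2 + 1"
    using variation_indicator_interval[OF I] by (intro bv_norm_le X) (auto simp: indicator_def)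
  then show "bv_norm X (indicator I :: real \<Rightarrow> real) \<le> 3" by simp
  have "bv_norm X (indicator (- I) :: real \<Rightarrow> real) \<le> 2 + 1"
    using variation_indicator_interval[OF I] 
    by (intro bv_norm_le X) (auto simp only: *, auto simp: indicator_def)
  then show "bv_norm X (indicator (- I) :: real \<Rightarrow> real) \<le> 3" by simp
qed

text \<open>The map taking \<open>y\<close> to \<open>1 / max y \<delta>\<close> is Lipschitz with
  constant \<open>1 / \<delta> ^ 2\<close>, and bounded by the same number as
  \<open>\<delta> \<le> 1\<close>. It stands in for \<open>1 / h\<close>, which may be
  unbounded.\<close>

lemma
  fixes h :: "real \<Rightarrow> real"
  assumes h: "bounded_variation_on X h" and X: "X \<noteq> {}" and \<delta>: "0 < \<delta>" "\<delta> \<le> 1"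
  shows bounded_variation_inverse_max: "bounded_variation_on X (\<lambda>x. 1 / max (h x) \<delta>)"
    and bv_norm_inverse_max_le: "bv_norm X (\<lambda>x. 1 / max (h x) \<delta>) \<le> (bv_norm X h + 1) / \<delta>\<^sup>2"
proof -
  have lip: "\<bar>1 / max a \<delta> - 1 / max b \<delta>\<bar> \<le> \<bar>a - b\<bar> / \<delta>\<^sup>2" for a b
  proof -
    have pos: "\<delta> \<le> max a \<delta>" "\<delta> \<le> max b \<delta>" "0 < max a \<delta>" "0 < max b \<delta>" using \<delta> by auto
    have "1 / max a \<delta> - 1 / max b \<delta> = (max b \<delta> - max a \<delta>) / (max a \<delta> * max b \<delta>)"
      using pos by (subst diff_frac_eq) auto
    then have "\<bar>1 / max a \<delta> - 1 / max b \<delta>\<bar> = \<bar>max b \<delta> - max a \<delta>\<bar> / (max a \<delta> * max b \<delta>)"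
      using pos by (simp add: abs_mult)
    also have "\<dots> \<le> \<bar>a - b\<bar> / \<delta>\<^sup>2"
      using pos \<delta> unfolding power2_eq_square by (intro frac_le mult_mono mult_pos_pos) auto
    finally show ?thesis .
  qed
  have v: "(\<Sum>i<n. norm (1 / max (h (t (Suc i))) \<delta> - 1 / max (h (t i)) \<delta>)) \<le> total_variation X h / \<delta>\<^sup>2"
    if t: "mono_on {..n} t" "t ` {..n} \<subseteq> X" for n t
  proof -
    have "(\<Sum>i<n. norm (1 / max (h (t (Suc i))) \<delta> - 1 / max (h (t i)) \<delta>))
        \<le> (\<Sum>i<n. norm (h (t (Suc i)) - h (t i)) / \<delta>\<^sup>2)"
      using lip by (intro sum_mono) auto
    also have "\<dots> \<le> total_variation X h / \<delta>\<^sup>2"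
      unfolding sum_divide_distrib[symmetric] using t by (intro divide_right_mono variation_sum_le h) auto
    finally show ?thesis .
  qed
  show "bounded_variation_on X (\<lambda>x. 1 / max (h x) \<delta>)" using v by (rule bounded_variationI)
  have "bv_norm X (\<lambda>x. 1 / max (h x) \<delta>) \<le> total_variation X h / \<delta>\<^sup>2 + 1 / \<delta>\<^sup>2"
  proof (intro bv_norm_le X v)
    fix x
    have "norm (1 / max (h x) \<delta>) \<le> 1 / \<delta>" using \<delta> by (auto intro!: frac_le simp: abs_if)
    also have "\<dots> \<le> 1 / \<delta>\<^sup>2" using \<delta> by (intro frac_le) (auto simp: power2_eq_square mult_left_le)
    finally show "norm (1 / max (h x) \<delta>) \<le> 1 / \<delta>\<^sup>2" .
  qed
  also have "\<dots> \<le> (bv_norm X h + 1) / \<delta>\<^sup>2"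
    unfolding add_divide_distrib[symmetric] using SUP_norm_nonneg[OF h X]
    by (intro divide_right_mono) (auto simp: bv_norm_def)
  finally show "bv_norm X (\<lambda>x. 1 / max (h x) \<delta>) \<le> (bv_norm X h + 1) / \<delta>\<^sup>2" .
qed

text \<open>Jordan decomposition.\<close>

lemma bounded_variation_measurable:
  fixes \<phi> :: "real \<Rightarrow> real"
  assumes bv: "bounded_variation_on X \<phi>"
  shows "\<phi> \<in> borel_measurable (restrict_space borel X)"
proof -
  define V where "V x = total_variation (X \<inter> {..x}) \<phi>" for x
  have incr: "V x + \<bar>\<phi> y - \<phi> x\<bar> \<le> V y" if xy: "x \<in> X" "y \<in> X" "x \<le> y" for x y
  proof -
    have bvy: "bounded_variation_on (X \<inter> {..y}) \<phi>"
      by (rule bounded_variationI[where K = "total_variation X \<phi>"]) (rule variation_sum_le[OF bv]; auto)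
    have "V x \<le> V y - \<bar>\<phi> y - \<phi> x\<bar>"
      unfolding V_def[of x]
    proof (rule total_variation_le)
      show "X \<inter> {..x} \<noteq> {}" using xy by auto
      fix n and t :: "nat \<Rightarrow> real"
      assume t: "mono_on {..n} t" "t ` {..n} \<subseteq> X \<inter> {..x}"
      \<comment> \<open>The partition of the part up to \<open>x\<close> is prolonged by
        \<open>x\<close> and \<open>y\<close>, so that the increment from \<open>x\<close> to
        \<open>y\<close> is counted on top.\<close>
      define u where "u i = (if i \<le> n then t i else if i = Suc n then x else y)" for i
      have tx: "t i \<in> X" "t i \<le> x" if "i \<le> n" for i using t(2) that by auto
      have tm: "t i \<le> t j" if "i \<le> j" "j \<le> n" for i j using t(1) that by (auto simp: mono_on_def)
      have "mono_on {..Suc (Suc n)} u"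
        using tx tm xy by (intro mono_onI) (auto simp: u_def intro: order_trans)
      moreover have "u ` {..Suc (Suc n)} \<subseteq> X \<inter> {..y}"
        using tx xy by (auto simp: u_def intro: order_trans)
      ultimately have "(\<Sum>i<Suc (Suc n). norm (\<phi> (u (Suc i)) - \<phi> (u i))) \<le> V y"
        unfolding V_def by (rule variation_sum_le[OF bvy])
      moreover have "(\<Sum>i<n. norm (\<phi> (u (Suc i)) - \<phi> (u i))) = (\<Sum>i<n. norm (\<phi> (t (Suc i)) - \<phi> (t i)))"
        by (intro sum.cong) (auto simp: u_def)
      ultimately show "(\<Sum>i<n. norm (\<phi> (t (Suc i)) - \<phi> (t i))) \<le> V y - \<bar>\<phi> y - \<phi> x\<bar>"
        by (simp add: u_def)
    qed
    then show ?thesis by simp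
  qed
  have "mono_on X V" "mono_on X (\<lambda>x. V x - \<phi> x)"
    using incr by (auto simp: mono_on_def intro!: mono_onI) (smt (verit) incr)+
  then have "V \<in> borel_measurable (restrict_space borel X)"
    "(\<lambda>x. V x - \<phi> x) \<in> borel_measurable (restrict_space borel X)"
    by (auto intro: borel_measurable_mono_on_fnc)
  then have "(\<lambda>x. V x - (V x - \<phi> x)) \<in> borel_measurable (restrict_space borel X)"
    by (rule borel_measurable_diff)
  then show ?thesis by simp
qed

text \<open>The spectral hypotheses speak of complex functions; this transfers variation and norm to
  the real functions for which conformality and decay of correlations are stated.\<close>

lemma
  fixes \<phi> :: "real \<Rightarrow> real"
  assumes "\<And>x. x \<in> X \<Longrightarrow> \<Phi> x = complex_of_real (\<phi> x)"
  shows bounded_variation_of_real_iff: "bounded_variation_on X \<Phi> \<longleftrightarrow> bounded_variation_on X \<phi>"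
    and bv_norm_of_real: "bv_norm X \<Phi> = bv_norm X \<phi>"
proof -
  have *: "(\<Sum>i<n. norm (\<Phi> (t (Suc i)) - \<Phi> (t i))) = (\<Sum>i<n. norm (\<phi> (t (Suc i)) - \<phi> (t i)))"
    if "t ` {..n} \<subseteq> X" for n :: nat and t
    using that assms by (intro sum.cong) (auto simp: image_subset_iff simp flip: of_real_diff)
  have "variation_sums X \<Phi> = variation_sums X \<phi>"
    unfolding variation_sums_def using * by (intro Collect_cong iff_exI) (auto simp del: real_norm_def)
  moreover have "(SUP x\<in>X. norm (\<Phi> x)) = (SUP x\<in>X. norm (\<phi> x))"
    using assms by (intro SUP_cong) auto
  ultimately show "bounded_variation_on X \<Phi> \<longleftrightarrow> bounded_variation_on X \<phi>"
    "bv_norm X \<Phi> = bv_norm X \<phi>"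
    by (auto simp: bounded_variation_on_def bv_norm_def total_variation_def)
qed

text \<open>If the real family is not summable, neither is the complex one, of which it is the real
  part; both sums then take the default value 0.\<close>

lemma infsum_complex_of_real:
  "(\<Sum>\<^sub>\<infinity>y\<in>A. complex_of_real (u y)) = complex_of_real (infsum u A)"
proof (cases "u summable_on A")
  case True
  then show ?thesis by (intro infsumI has_sum_of_real) (rule has_sum_infsum)
next
  case False
  have "\<not> (\<lambda>y. complex_of_real (u y)) summable_on A"
  proof
    assume "(\<lambda>y. complex_of_real (u y)) summable_on A"
    from summable_on_bounded_linear[OF bounded_linear_Re this] False show False by simp
  qed
  with False show ?thesis by (simp add: infsum_not_exists)
qed

text \<open>A real function is passed to the complex operator through its extension by zero, the
  form that \<open>bv_space\<close> prescribes. The absolute value of the operator bound is taken as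
  the constant, so that it is nonnegative and can be iterated.\<close>

lemma transfer_operator_bv_bound:
  assumes "bv_bounded_operator X (transfer_operator X f g :: (real \<Rightarrow> complex) \<Rightarrow> _)" and X: "X \<noteq> {}"
  obtains K where "0 \<le> K" "\<And>\<phi> :: real \<Rightarrow> real. bounded_variation_on X \<phi> \<Longrightarrow>
    bounded_variation_on X (transfer_operator X f g \<phi>) \<and>
    bv_norm X (transfer_operator X f g \<phi>) \<le> K * bv_norm X \<phi>"
proof -
  let ?L = "transfer_operator X f g :: (real \<Rightarrow> complex) \<Rightarrow> _"
  obtain K where K: "\<And>\<phi>. \<phi> \<in> bv_space X \<Longrightarrow> bv_norm X (?L \<phi>) \<le> K * bv_norm X \<phi>"
    and L: "\<And>\<phi>. \<phi> \<in> bv_space X \<Longrightarrow> ?L \<phi> \<in> bv_space X"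
    using assms unfolding bv_bounded_operator_def by blast
  have "bounded_variation_on X (transfer_operator X f g \<phi>) \<and>
    bv_norm X (transfer_operator X f g \<phi>) \<le> \<bar>K\<bar> * bv_norm X \<phi>"
    if \<phi>: "bounded_variation_on X \<phi>" for \<phi> :: "real \<Rightarrow> real"
  proof -
    define \<Phi> where "\<Phi> x = (if x \<in> X then complex_of_real (\<phi> x) else 0)" for x
    have \<Phi>: "\<Phi> x = complex_of_real (\<phi> x)" if "x \<in> X" for x using that by (simp add: \<Phi>_def)
    have "bounded_variation_on X \<Phi>" using \<phi> bounded_variation_of_real_iff[of X \<Phi> \<phi>, OF \<Phi>] by simp
    then have mem: "\<Phi> \<in> bv_space X" by (auto simp: bv_space_def \<Phi>_def)
    have LL: "?L \<Phi> x = complex_of_real (transfer_operator X f g \<phi> x)" if "x \<in> X" for x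
    proof -
      have "(\<Sum>\<^sub>\<infinity>y\<in>{y\<in>X. f y = x}. g y *\<^sub>R \<Phi> y)
          = (\<Sum>\<^sub>\<infinity>y\<in>{y\<in>X. f y = x}. complex_of_real (g y *\<^sub>R \<phi> y))"
        by (intro infsum_cong) (auto simp: \<Phi>_def scaleR_conv_of_real)
      then show ?thesis by (simp only: transfer_operator_def infsum_complex_of_real that if_True)
    qed
    have "bounded_variation_on X (?L \<Phi>)" using L[OF mem] by (simp add: bv_space_def)
    moreover have "bv_norm X (?L \<Phi>) \<le> \<bar>K\<bar> * bv_norm X \<Phi>"
      using K[OF mem] bv_norm_nonneg[of X \<Phi>] mem X
      by (auto simp: bv_space_def intro: order_trans[OF _ mult_right_mono])
    ultimately show ?thesis
      using bounded_variation_of_real_iff[of X "?L \<Phi>" "transfer_operator X f g \<phi>", OF LL]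
        bv_norm_of_real[of X "?L \<Phi>" "transfer_operator X f g \<phi>", OF LL]
        bv_norm_of_real[of X \<Phi> \<phi>, OF \<Phi>] by simp
  qed
  then show ?thesis using that[of "\<bar>K\<bar>"] by simp
qed

section \<open>The transfer operator of a system with a hole\<close>

locale conformal_transfer = prob_space \<nu> for \<nu> :: "real measure" +
  fixes X :: "real set" and f g :: "real \<Rightarrow> real" and lam K :: real
  assumes X_interval: "is_interval X" and X_nonempty: "X \<noteq> {}"
    and sets_\<nu>: "sets \<nu> = sets (restrict_space borel X)"
    and f_meas: "f \<in> measurable \<nu> \<nu>"
    and g_nonneg: "\<And>y. y \<in> X \<Longrightarrow> 0 \<le> g y"
    and g_summable: "\<And>x. x \<in> X \<Longrightarrow> g summable_on {y\<in>X. f y = x}"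
    and lam_pos: "0 < lam" and K_nonneg: "0 \<le> K"
    and conformal: "conformal_measure X f g lam \<nu>"
    and transfer_bv: "\<And>\<phi> :: real \<Rightarrow> real. bounded_variation_on X \<phi> \<Longrightarrow>
      bounded_variation_on X (transfer_operator X f g \<phi>) \<and>
      bv_norm X (transfer_operator X f g \<phi>) \<le> K * bv_norm X \<phi>"
begin

abbreviation L :: "(real \<Rightarrow> real) \<Rightarrow> real \<Rightarrow> real" where
  "L \<equiv> transfer_operator X f g"

lemma space_\<nu>: "space \<nu> = X"
  using sets_eq_imp_space_eq[OF sets_\<nu>] by (simp add: space_restrict_space)

lemma bv_measurable: "bounded_variation_on X \<phi> \<Longrightarrow> (\<phi> :: real \<Rightarrow> real) \<in> borel_measurable \<nu>"
  using bounded_variation_measurable measurable_cong_sets[OF sets_\<nu> refl] by blast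

text \<open>Writing the fibre sum as an integral over counting measure gives access to linearity and
  dominated convergence on fibres.\<close>

lemma fibre_integral:
  assumes \<phi>: "\<And>y. y \<in> X \<Longrightarrow> \<bar>\<phi> y\<bar> \<le> W" and x: "x \<in> X"
  shows "integrable (count_space {y\<in>X. f y = x}) (\<lambda>y. g y * \<phi> y)"
    and "L \<phi> x = (\<integral>y. g y * \<phi> y \<partial>count_space {y\<in>X. f y = x})"
proof -
  let ?Y = "{y\<in>X. f y = x}"
  have "Infinite_Set_Sum.abs_summable_on g ?Y"
    using g_summable[OF x] abs_summable_equivalent summable_on_iff_abs_summable_on_real by blast
  then have g: "integrable (count_space ?Y) g" by (simp add: Infinite_Set_Sum.abs_summable_on_def)
  show int: "integrable (count_space ?Y) (\<lambda>y. g y * \<phi> y)"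
  proof (rule Bochner_Integration.integrable_bound)
    show "integrable (count_space ?Y) (\<lambda>y. W * g y)" using g by simp
    show "AE y in count_space ?Y. norm (g y * \<phi> y) \<le> norm (W * g y)"
      using \<phi> g_nonneg by (auto simp: AE_count_space abs_mult mult.commute[of _ "\<bar>g _\<bar>"] intro!: mult_left_mono order_trans[OF \<phi>])
  qed simp
  then have "Infinite_Set_Sum.abs_summable_on (\<lambda>y. g y * \<phi> y) ?Y"
    by (simp add: Infinite_Set_Sum.abs_summable_on_def)
  from infsetsum_infsum[OF this] show "L \<phi> x = (\<integral>y. g y * \<phi> y \<partial>count_space ?Y)"
    using x by (simp add: transfer_operator_def infsetsum_def)
qed

lemma one_bv: "bounded_variation_on X (\<lambda>_. 1 :: real)"
  by (rule bounded_variationI[where K = 0]) simp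

lemma L_one_le: "x \<in> X \<Longrightarrow> \<bar>L (\<lambda>_. 1) x\<bar> \<le> bv_norm X (L (\<lambda>_. 1))"
  using norm_le_bv_norm[of X "L (\<lambda>_. 1)" x] transfer_bv[OF one_bv] by simp

text \<open>By positivity of \<open>g\<close>, a function bounded by \<open>W\<close> is transferred
  to at most \<open>W\<close> times the image of the constant 1, which has bounded variation and
  hence is bounded. This supplies the dominating constants below.\<close>

lemma L_bounded:
  assumes \<phi>: "\<And>y. y \<in> X \<Longrightarrow> \<bar>\<phi> y\<bar> \<le> W" and x: "x \<in> X"
  shows "\<bar>L \<phi> x\<bar> \<le> W * bv_norm X (L (\<lambda>_. 1))"
proof -
  let ?Y = "{y\<in>X. f y = x}"
  have W: "0 \<le> W" using \<phi>[OF x] by simp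
  have int: "integrable (count_space ?Y) (\<lambda>y. g y * \<phi> y)"
    and L: "L \<phi> x = (\<integral>y. g y * \<phi> y \<partial>count_space ?Y)"
    using fibre_integral[of \<phi> W x] \<phi> x by blast+
  have "\<bar>L \<phi> x\<bar> \<le> (\<integral>y. \<bar>g y * \<phi> y\<bar> \<partial>count_space ?Y)"
    unfolding L by (rule integral_abs_bound)
  also have "\<dots> \<le> (\<integral>y. W * (g y * 1) \<partial>count_space ?Y)"
  proof (rule integral_mono)
    show "integrable (count_space ?Y) (\<lambda>y. \<bar>g y * \<phi> y\<bar>)" using int by (rule integrable_abs)
    show "integrable (count_space ?Y) (\<lambda>y. W * (g y * 1))"
      using fibre_integral(1)[of "\<lambda>_. 1" 1 x] x by simp
    fix y assume "y \<in> space (count_space ?Y)"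
    then have "\<bar>g y\<bar> * \<bar>\<phi> y\<bar> \<le> g y * W"
      using \<phi>[of y] g_nonneg[of y] by (intro mult_mono) auto
    then show "\<bar>g y * \<phi> y\<bar> \<le> W * (g y * 1)" by (simp add: abs_mult mult_ac)
  qed
  also have "\<dots> = W * L (\<lambda>_. 1) x"
    using fibre_integral(2)[of "\<lambda>_. 1" 1 x] x by simp
  also have "\<dots> \<le> W * bv_norm X (L (\<lambda>_. 1))"
    using L_one_le[OF x] W by (intro mult_left_mono) auto
  finally show ?thesis .
qed

text \<open>A monotone class argument, wanted because \<open>w\<close> times the indicator of a
  preimage under \<open>f\<close> need not be of bounded variation. Measurability is carried through
  the induction: outside the functions of bounded variation it is not known in advance that
  \<open>L\<close> preserves it.\<close>

lemma L_integral_restrict: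
  assumes w: "bounded_variation_on X w" and G: "G \<in> sets \<nu>"
  shows "L (\<lambda>y. w y * indicator G y) \<in> borel_measurable \<nu> \<and>
    (\<integral>x. L (\<lambda>y. w y * indicator G y) x \<partial>\<nu>) = lam * (\<integral>x. w x * indicator G x \<partial>\<nu>)"
    (is "?P G")
proof -
  define W where "W = bv_norm X w"
  have wW: "\<bar>w y\<bar> \<le> W" if "y \<in> X" for y using norm_le_bv_norm[OF w that] by (simp add: W_def)
  have wG: "\<bar>w y * indicator H y\<bar> \<le> W" if "y \<in> X" for y H
    using wW[OF that] by (auto simp: indicator_def)
  have fib: "integrable (count_space {y\<in>X. f y = x}) (\<lambda>y. g y * (w y * indicator H y))"
    "L (\<lambda>y. w y * indicator H y) x = (\<integral>y. g y * (w y * indicator H y) \<partial>count_space {y\<in>X. f y = x})"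
    if "x \<in> X" for x H
    using fibre_integral[of "\<lambda>y. w y * indicator H y" W x] wG that by blast+
  have wm: "w \<in> borel_measurable \<nu>" using w by (rule bv_measurable)
  have iw: "integrable \<nu> (\<lambda>x. w x * indicator H x)" if "H \<in> sets \<nu>" for H
  proof (rule integrable_const_bound[where B = W])
    show "AE x in \<nu>. norm (w x * indicator H x) \<le> W" using wG by (auto simp: space_\<nu>)
    show "(\<lambda>x. w x * indicator H x) \<in> borel_measurable \<nu>" using wm that by measurable
  qed
  have Lb: "\<bar>L (\<lambda>y. w y * indicator H y) x\<bar> \<le> W * bv_norm X (L (\<lambda>_. 1))" if "x \<in> X" for x H
    by (rule L_bounded[OF wG that])
  have iL: "integrable \<nu> (L (\<lambda>y. w y * indicator H y))"
    if "L (\<lambda>y. w y * indicator H y) \<in> borel_measurable \<nu>" for H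
    using Lb that by (intro integrable_const_bound[where B = "W * bv_norm X (L (\<lambda>_. 1))"]) (auto simp: space_\<nu>)
  have bvP: "?P H" if "bounded_variation_on X (\<lambda>y. w y * indicator H y)" for H
    using that conformal transfer_bv[OF that] by (auto simp: conformal_measure_def intro: bv_measurable)
  have PX: "?P X"
  proof -
    have "bounded_variation_on X (\<lambda>y. w y * indicator X y)"
      using w by (intro bounded_variation_mult bounded_variation_indicator X_interval X_nonempty)
    then show ?thesis by (rule bvP)
  qed
  \<comment> \<open>Lower rays in \<open>X\<close> form an intersection-stable generator; as they
    are intervals, their indicators have bounded variation.\<close>
  let ?E = "(\<inter>) X ` range (\<lambda>a. {..a})"
  have gen: "sets \<nu> = sigma_sets X ?E"
  proof -
    have "sets \<nu> = (\<inter>) X ` sets borel" by (simp add: sets_\<nu> sets_restrict_space)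
    also have "sets borel = sigma_sets UNIV (range (\<lambda>a::real. {..a}))"
      by (simp add: borel_eq_atMost)
    also have "(\<inter>) X ` sigma_sets UNIV (range (\<lambda>a. {..a})) = sigma_sets X ?E"
    proof (rule sigma_sets_Int)
      have "X \<in> sets borel" using X_interval
        by (rule real_interval_borel_measurable)
      then show "X \<in> sigma_sets UNIV (range (\<lambda>a. {..a}))" by (simp add: borel_eq_atMost)
    qed simp
    finally show ?thesis .
  qed
  \<comment> \<open>One combination lemma serves both induction steps: \<open>c = - 1\<close> for
    complements and \<open>c = 1\<close> for disjoint unions.\<close>
  have comb: "?P H"
    if P: "?P H1" "?P H2" and H: "H1 \<in> sets \<nu>" "H2 \<in> sets \<nu>"
      and eq: "\<And>y. y \<in> X \<Longrightarrow> indicator H y = indicator H1 y + c * (indicator H2 y :: real)" for H H1 H2 and c :: real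
  proof -
    have Leq: "L (\<lambda>y. w y * indicator H y) = (\<lambda>x. L (\<lambda>y. w y * indicator H1 y) x + c * L (\<lambda>y. w y * indicator H2 y) x)"
    proof
      fix x
      show "L (\<lambda>y. w y * indicator H y) x = L (\<lambda>y. w y * indicator H1 y) x + c * L (\<lambda>y. w y * indicator H2 y) x"
      proof (cases "x \<in> X")
        case True
        have "L (\<lambda>y. w y * indicator H y) x
            = (\<integral>y. g y * (w y * indicator H1 y) + c * (g y * (w y * indicator H2 y)) \<partial>count_space {y\<in>X. f y = x})"
          unfolding fib(2)[OF True] using eq
          by (intro Bochner_Integration.integral_cong) (auto simp: algebra_simps)
        also have "\<dots> = L (\<lambda>y. w y * indicator H1 y) x + c * L (\<lambda>y. w y * indicator H2 y) x"
          unfolding fib(2)[OF True] using fib(1)[OF True]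
          by (subst Bochner_Integration.integral_add) auto
        finally show ?thesis .
      qed (simp add: transfer_operator_def)
    qed
    have "(\<integral>x. w x * indicator H x \<partial>\<nu>) = (\<integral>x. w x * indicator H1 x + c * (w x * indicator H2 x) \<partial>\<nu>)"
      using eq by (intro Bochner_Integration.integral_cong) (auto simp: space_\<nu> algebra_simps)
    also have "\<dots> = (\<integral>x. w x * indicator H1 x \<partial>\<nu>) + c * (\<integral>x. w x * indicator H2 x \<partial>\<nu>)"
      using iw[OF H(1)] iw[OF H(2)] by (subst Bochner_Integration.integral_add) auto
    finally have R: "(\<integral>x. w x * indicator H x \<partial>\<nu>)
        = (\<integral>x. w x * indicator H1 x \<partial>\<nu>) + c * (\<integral>x. w x * indicator H2 x \<partial>\<nu>)" .
    have i: "integrable \<nu> (L (\<lambda>y. w y * indicator H1 y))" "integrable \<nu> (\<lambda>x. c * L (\<lambda>y. w y * indicator H2 y) x)"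
      by (rule iL[OF conjunct1[OF P(1)]])
        (rule integrable_mult_right[OF iL[OF conjunct1[OF P(2)]]])
    have "(\<integral>x. L (\<lambda>y. w y * indicator H y) x \<partial>\<nu>)
        = (\<integral>x. L (\<lambda>y. w y * indicator H1 y) x \<partial>\<nu>) + c * (\<integral>x. L (\<lambda>y. w y * indicator H2 y) x \<partial>\<nu>)"
      unfolding Leq by (subst Bochner_Integration.integral_add[OF i]) simp
    also have "\<dots> = lam * (\<integral>x. w x * indicator H x \<partial>\<nu>)"
      unfolding R conjunct2[OF P(1)] conjunct2[OF P(2)] by (simp add: distrib_left)
    finally have "(\<integral>x. L (\<lambda>y. w y * indicator H y) x \<partial>\<nu>) = lam * (\<integral>x. w x * indicator H x \<partial>\<nu>)" .
    moreover have "L (\<lambda>y. w y * indicator H y) \<in> borel_measurable \<nu>"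
      unfolding Leq by (intro borel_measurable_add borel_measurable_integrable i)
    ultimately show ?thesis by (rule conjI[rotated])
  qed
  have "Int_stable ?E"
  proof (rule Int_stableI)
    fix A B assume "A \<in> ?E" "B \<in> ?E"
    then obtain a b where "A = X \<inter> {..a}" "B = X \<inter> {..b}" by auto
    then have "A \<inter> B = X \<inter> {..min a b}" by auto
    then show "A \<inter> B \<in> ?E" by blast
  qed
  moreover have "?E \<subseteq> Pow X" by auto
  moreover have "G \<in> sigma_sets X ?E" using G gen by simp
  ultimately show ?thesis
  proof (induction rule: sigma_sets_induct_disjoint)
    case (basic A)
    then obtain a where "A = X \<inter> {..a}" by auto
    then have "is_interval A" using X_interval by (auto intro: is_interval_Int)
    then show ?case
      using w by (intro bvP bounded_variation_mult bounded_variation_indicator X_nonempty)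
  next
    case empty
    show ?case
      using w by (intro bvP bounded_variation_mult bounded_variation_indicator X_nonempty) auto
  next
    case (compl A)
    have A: "A \<in> sets \<nu>" "X \<in> sets \<nu>" using compl(1) gen sets.top[of \<nu>] by (simp_all add: space_\<nu>)
    have "indicator (X - A) y = indicator X y + (- 1) * (indicator A y :: real)" if "y \<in> X" for y
      using that by (simp add: indicator_def)
    then show ?case by (rule comb[OF PX compl(2) A(2,1)])
  next
    case (union A)
    have A: "A i \<in> sets \<nu>" for i using union(2) gen by auto
    \<comment> \<open>The partial unions increase to the countable union. The limit is taken by
      dominated convergence at two levels, on each fibre and under \<open>\<nu>\<close>.\<close>
    define U where "U n = (\<Union>i<n. A i)" for n :: nat
    have Us: "U n \<in> sets \<nu>" for n using A by (auto simp: U_def)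
    have PU: "?P (U n)" for n
    proof (induction n)
      case 0
      show ?case
        using w by (intro bvP bounded_variation_mult bounded_variation_indicator X_nonempty) (auto simp: U_def)
    next
      case (Suc n)
      have "A n \<inter> A i = {}" if "i < n" for i
        using disjoint_family_onD[OF union(1), of n i] that by simp
      then have disj: "A n \<inter> U n = {}" unfolding U_def by blast
      have "U (Suc n) = U n \<union> A n" unfolding U_def by (simp add: lessThan_Suc Un_commute)
      then have "indicator (U (Suc n)) y = indicator (U n) y + 1 * (indicator (A n) y :: real)" for y
        using disj by (auto simp: indicator_def)
      then show ?case by (rule comb[OF Suc union(3)[of n] Us A])
    qed
    have PU1: "L (\<lambda>y. w y * indicator (U n) y) \<in> borel_measurable \<nu>" for n
      using PU by (rule conjunct1)
    have PU2: "(\<integral>x. L (\<lambda>y. w y * indicator (U n) y) x \<partial>\<nu>) = lam * (\<integral>x. w x * indicator (U n) x \<partial>\<nu>)" for n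
      using PU by (rule conjunct2)
    have lim: "(\<lambda>n. indicator (U n) y :: real) \<longlonglongrightarrow> indicator (\<Union> (range A)) y" for y
      unfolding U_def by (rule LIMSEQ_indicator_UN)
    have limL: "(\<lambda>n. L (\<lambda>y. w y * indicator (U n) y) x) \<longlonglongrightarrow> L (\<lambda>y. w y * indicator (\<Union> (range A)) y) x"
      if x: "x \<in> X" for x
      unfolding fib(2)[OF x]
    proof (rule integral_dominated_convergence[where w = "\<lambda>y. W * (g y * 1)"])
      show "integrable (count_space {y\<in>X. f y = x}) (\<lambda>y. W * (g y * 1))"
        using fibre_integral(1)[of "\<lambda>_. 1" 1 x] x by simp
      show "AE y in count_space {y\<in>X. f y = x}. (\<lambda>n. g y * (w y * indicator (U n) y)) \<longlonglongrightarrow> g y * (w y * indicator (\<Union> (range A)) y)"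
        by (intro AE_I2 tendsto_intros lim)
      show "AE y in count_space {y\<in>X. f y = x}. norm (g y * (w y * indicator (U n) y)) \<le> W * (g y * 1)" for n
      proof (rule AE_I2)
        fix y assume "y \<in> space (count_space {y\<in>X. f y = x})"
        then have "\<bar>g y\<bar> * \<bar>w y * indicator (U n) y\<bar> \<le> g y * W"
          using wG[of y "U n"] g_nonneg[of y] by (intro mult_mono) auto
        then show "norm (g y * (w y * indicator (U n) y)) \<le> W * (g y * 1)"
          by (simp add: abs_mult mult_ac)
      qed
    qed auto
    have meas: "L (\<lambda>y. w y * indicator (\<Union> (range A)) y) \<in> borel_measurable \<nu>"
      by (rule borel_measurable_LIMSEQ_metric[where f = "\<lambda>n. L (\<lambda>y. w y * indicator (U n) y)"])
        (use PU1 limL in \<open>auto simp: space_\<nu>\<close>)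
    have "(\<lambda>n. \<integral>x. L (\<lambda>y. w y * indicator (U n) y) x \<partial>\<nu>)
        \<longlonglongrightarrow> (\<integral>x. L (\<lambda>y. w y * indicator (\<Union> (range A)) y) x \<partial>\<nu>)"
      by (rule integral_dominated_convergence[where w = "\<lambda>_. W * bv_norm X (L (\<lambda>_. 1))"])
        (use PU1 limL Lb meas in \<open>auto simp: space_\<nu>\<close>)
    moreover have "(\<lambda>n. \<integral>x. w x * indicator (U n) x \<partial>\<nu>) \<longlonglongrightarrow> (\<integral>x. w x * indicator (\<Union> (range A)) x \<partial>\<nu>)"
    proof (rule integral_dominated_convergence[where w = "\<lambda>_. W"])
      show "(\<lambda>x. w x * indicator (\<Union> (range A)) x) \<in> borel_measurable \<nu>"
        using iw[of "\<Union> (range A)"] A by auto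
      show "(\<lambda>x. w x * indicator (U n) x) \<in> borel_measurable \<nu>" for n
        using iw[of "U n"] Us by auto
      show "AE x in \<nu>. (\<lambda>n. w x * indicator (U n) x) \<longlonglongrightarrow> w x * indicator (\<Union> (range A)) x"
        by (intro AE_I2 tendsto_intros lim)
    qed (use wG in \<open>auto simp: space_\<nu>\<close>)
    then have "(\<lambda>n. lam * (\<integral>x. w x * indicator (U n) x \<partial>\<nu>)) \<longlonglongrightarrow> lam * (\<integral>x. w x * indicator (\<Union> (range A)) x \<partial>\<nu>)"
      by (intro tendsto_intros)
    ultimately have "(\<integral>x. L (\<lambda>y. w y * indicator (\<Union> (range A)) y) x \<partial>\<nu>) = lam * (\<integral>x. w x * indicator (\<Union> (range A)) x \<partial>\<nu>)"
      unfolding PU2 by (rule LIMSEQ_unique)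
    with meas show ?case by (rule conjI)
  qed
qed

text \<open>On the fibre over \<open>x\<close> the indicator of the preimage of \<open>F\<close> is
  the constant \<open>indicator F x\<close>, so it can be pulled out of \<open>L\<close>.\<close>

lemma L_duality:
  assumes w: "bounded_variation_on X w" and F: "F \<in> sets \<nu>"
  shows "(\<integral>x. L w x * indicator F x \<partial>\<nu>) = lam * (\<integral>x. w x * indicator F (f x) \<partial>\<nu>)"
proof -
  let ?G = "f -` F \<inter> X"
  have G: "?G \<in> sets \<nu>" using measurable_sets[OF f_meas F] by (simp add: space_\<nu>)
  have "L (\<lambda>y. w y * indicator ?G y) x = L w x * indicator F x" if "x \<in> X" for x
  proof -
    have "(\<Sum>\<^sub>\<infinity>y\<in>{y\<in>X. f y = x}. g y *\<^sub>R (w y * indicator ?G y))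
        = (\<Sum>\<^sub>\<infinity>y\<in>{y\<in>X. f y = x}. (g y *\<^sub>R w y) * indicator F x)"
      by (intro infsum_cong) (auto simp: indicator_def)
    also have "\<dots> = (\<Sum>\<^sub>\<infinity>y\<in>{y\<in>X. f y = x}. g y *\<^sub>R w y) * indicator F x"
      by (cases "x \<in> F") auto
    finally show ?thesis by (simp add: transfer_operator_def that)
  qed
  then have "(\<integral>x. L w x * indicator F x \<partial>\<nu>) = (\<integral>x. L (\<lambda>y. w y * indicator ?G y) x \<partial>\<nu>)"
    by (intro Bochner_Integration.integral_cong) (auto simp: space_\<nu>)
  also have "\<dots> = lam * (\<integral>x. w x * indicator ?G x \<partial>\<nu>)"
    using L_integral_restrict[OF w G] by simp
  also have "(\<integral>x. w x * indicator ?G x \<partial>\<nu>) = (\<integral>x. w x * indicator F (f x) \<partial>\<nu>)"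
    by (intro Bochner_Integration.integral_cong) (auto simp: space_\<nu> indicator_def)
  finally show ?thesis .
qed

end

text \<open>Tested on the set where \<open>v < u\<close>, the inequality of integrals forces that
  set to be null.\<close>

lemma AE_le_of_set_integral_le:
  fixes u v :: "'a \<Rightarrow> real"
  assumes u: "integrable M u" and v: "integrable M v"
    and le: "\<And>F. F \<in> sets M \<Longrightarrow> (\<integral>x. u x * indicator F x \<partial>M) \<le> (\<integral>x. v x * indicator F x \<partial>M)"
  shows "AE x in M. u x \<le> v x"
proof -
  define F where "F = {x \<in> space M. v x < u x}"
  have [measurable]: "u \<in> borel_measurable M" "v \<in> borel_measurable M" using u v by auto
  have F: "F \<in> sets M" unfolding F_def by measurable
  have iu: "integrable M (\<lambda>x. u x * indicator F x)" using integrable_mult_indicator[OF F u] by (simp add: mult.commute)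
  have iv: "integrable M (\<lambda>x. v x * indicator F x)" using integrable_mult_indicator[OF F v] by (simp add: mult.commute)
  have nn: "AE x in M. 0 \<le> u x * indicator F x - v x * indicator F x"
    by (auto simp: F_def indicator_def)
  have "(\<integral>x. u x * indicator F x - v x * indicator F x \<partial>M) \<le> 0"
    using le[OF F] iu iv by simp
  moreover have "0 \<le> (\<integral>x. u x * indicator F x - v x * indicator F x \<partial>M)"
    using nn by (rule integral_nonneg_AE)
  ultimately have "(\<integral>x. u x * indicator F x - v x * indicator F x \<partial>M) = 0" by linarith
  then have "AE x in M. u x * indicator F x - v x * indicator F x = 0"
    using integral_nonneg_eq_0_iff_AE[OF Bochner_Integration.integrable_diff[OF iu iv] nn] by simp
  then show ?thesis
  proof (rule AE_mp, intro AE_I2 impI)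
    fix x assume "x \<in> space M" "u x * indicator F x - v x * indicator F x = 0"
    then show "u x \<le> v x" by (auto simp: F_def indicator_def split: if_splits)
  qed
qed

section \<open>Mass that avoids a hole\<close>

context conformal_transfer
begin

text \<open>Mass in the hole is deleted before it is transferred. With an empty hole the factor
  \<open>1 / lam\<close> makes the operator preserve the \<open>\<nu>\<close>-integrals of functions
  of bounded variation.\<close>

definition open_op :: "real set \<Rightarrow> (real \<Rightarrow> real) \<Rightarrow> real \<Rightarrow> real" where
  "open_op B w = (\<lambda>x. 1 / lam * L (\<lambda>y. w y * indicator (- B) y) x)"

text \<open>The counterpart of \<open>miss B m \<inter> pre m F\<close> over the reference measure
  \<open>\<nu>\<close>, which is not assumed to be invariant.\<close>

definition avoid :: "real set \<Rightarrow> nat \<Rightarrow> real set \<Rightarrow> real set" where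
  "avoid B m F = {x \<in> X. (\<forall>k<m. (f ^^ k) x \<notin> B) \<and> (f ^^ m) x \<in> F}"

text \<open>Cutting out an interval multiplies the norm by at most 3. The resulting bound may grow
  exponentially under iteration, which the long gaps between distant nodes can afford.\<close>

lemma open_op_bv:
  assumes B: "is_interval B" and w: "bounded_variation_on X w"
  shows "bounded_variation_on X (open_op B w) \<and> bv_norm X (open_op B w) \<le> 3 * K / lam * bv_norm X w"
proof -
  define u where "u = (\<lambda>y. w y * indicator (- B) y)"
  have u: "bounded_variation_on X u"
    unfolding u_def by (intro bounded_variation_mult w bounded_variation_indicator_compl B X_nonempty)
  have "bv_norm X u \<le> bv_norm X w * bv_norm X (indicator (- B) :: real \<Rightarrow> real)"
    unfolding u_def by (intro bv_norm_mult_le w bounded_variation_indicator_compl B X_nonempty)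
  also have "\<dots> \<le> bv_norm X w * 3"
    by (intro mult_left_mono bv_norm_indicator_compl_le bv_norm_nonneg w B X_nonempty)
  finally have nu: "bv_norm X u \<le> 3 * bv_norm X w" by simp
  have Lu: "bounded_variation_on X (L u)" "bv_norm X (L u) \<le> K * bv_norm X u"
    using transfer_bv[OF u] by auto
  have "bv_norm X (\<lambda>x. 1 / lam * L u x) \<le> 1 / lam * bv_norm X (L u)"
    using Lu lam_pos by (intro bv_norm_cmult_le X_nonempty) auto
  also have "\<dots> \<le> 1 / lam * (K * (3 * bv_norm X w))"
    using lam_pos K_nonneg nu order_trans[OF Lu(2) mult_left_mono[OF nu K_nonneg]]
    by (intro mult_left_mono) auto
  finally have "bv_norm X (\<lambda>x. 1 / lam * L u x) \<le> 3 * K / lam * bv_norm X w" by (simp add: mult_ac)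
  moreover have "bounded_variation_on X (\<lambda>x. 1 / lam * L u x)"
    using Lu lam_pos by (intro bounded_variation_cmult X_nonempty) auto
  moreover have "open_op B w = (\<lambda>x. 1 / lam * L u x)" by (simp add: open_op_def u_def)
  ultimately show ?thesis by simp
qed

lemma open_op_iterate_bv:
  assumes B: "is_interval B" and w: "bounded_variation_on X w"
  shows "bounded_variation_on X ((open_op B ^^ m) w) \<and>
    bv_norm X ((open_op B ^^ m) w) \<le> (3 * K / lam) ^ m * bv_norm X w"
proof (induction m)
  case (Suc m)
  have c: "0 \<le> 3 * K / lam" using K_nonneg lam_pos by simp
  have "bv_norm X (open_op B ((open_op B ^^ m) w)) \<le> 3 * K / lam * bv_norm X ((open_op B ^^ m) w)"
    using open_op_bv[OF B conjunct1[OF Suc]] by simp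
  also have "\<dots> \<le> 3 * K / lam * ((3 * K / lam) ^ m * bv_norm X w)"
    using Suc c by (intro mult_left_mono) auto
  finally show ?case using open_op_bv[OF B conjunct1[OF Suc]] by (simp add: mult.assoc)
qed (use w in simp)

lemma funpow_meas: "(f ^^ k) \<in> measurable \<nu> \<nu>"
proof (induction k)
  case (Suc k)
  then show ?case using measurable_comp[OF Suc f_meas] by (simp add: comp_def)
qed (simp add: id_def)

lemma preimage_sets: "F \<in> sets \<nu> \<Longrightarrow> {x \<in> X. (f ^^ k) x \<in> F} \<in> sets \<nu>"
  using measurable_sets[OF funpow_meas[of k], of F]
  by (simp add: space_\<nu> vimage_def Int_def conj_commute)

lemma avoid_sets:
  assumes "B \<in> sets \<nu>" "F \<in> sets \<nu>" shows "avoid B m F \<in> sets \<nu>"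
proof -
  have "avoid B m F = {x \<in> X. (f ^^ m) x \<in> F} - (\<Union>k<m. {x \<in> X. (f ^^ k) x \<in> B})"
    by (auto simp: avoid_def)
  then show ?thesis using preimage_sets assms by auto
qed

lemma avoid_Suc: "x \<in> X \<Longrightarrow> x \<in> avoid B (Suc m) F \<longleftrightarrow> x \<notin> B \<and> f x \<in> avoid B m F"
  using measurable_space[OF f_meas, of x]
  by (auto simp: avoid_def space_\<nu> funpow_swap1 less_Suc_eq_0_disj)

text \<open>Iterates of the transfer operator of the system with a hole \<open>B\<close> carry the mass that has
  avoided \<open>B\<close>.\<close>

lemma open_op_iterate_integral:
  assumes B: "is_interval B" "B \<in> sets \<nu>" and F: "F \<in> sets \<nu>"
  shows "bounded_variation_on X w \<Longrightarrow>
    (\<integral>x. w x * indicator (avoid B m F) x \<partial>\<nu>) = (\<integral>x. (open_op B ^^ m) w x * indicator F x \<partial>\<nu>)"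
proof (induction m arbitrary: w)
  case 0
  show ?case by (intro Bochner_Integration.integral_cong) (auto simp: avoid_def indicator_def space_\<nu>)
next
  case (Suc m)
  define u where "u = (\<lambda>y. w y * indicator (- B) y)"
  have u: "bounded_variation_on X u"
    unfolding u_def by (intro bounded_variation_mult Suc.prems bounded_variation_indicator_compl B X_nonempty)
  have op: "open_op B w = (\<lambda>x. 1 / lam * L u x)" by (simp add: open_op_def u_def)
  \<comment> \<open>The condition at time 0 is put into \<open>u\<close>; the remaining ones concern
    \<open>f x\<close>, so that duality applies.\<close>
  have "(\<integral>x. w x * indicator (avoid B (Suc m) F) x \<partial>\<nu>) = (\<integral>x. u x * indicator (avoid B m F) (f x) \<partial>\<nu>)"
    by (intro Bochner_Integration.integral_cong) (auto simp: u_def indicator_def space_\<nu> avoid_Suc)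
  also have "\<dots> = 1 / lam * (\<integral>x. L u x * indicator (avoid B m F) x \<partial>\<nu>)"
    using L_duality[OF u avoid_sets[OF B(2) F, of m]] lam_pos by simp
  also have "\<dots> = (\<integral>x. open_op B w x * indicator (avoid B m F) x \<partial>\<nu>)"
    unfolding op by (subst integral_mult_right_zero[symmetric]) (simp only: mult.assoc)
  also have "\<dots> = (\<integral>x. (open_op B ^^ m) (open_op B w) x * indicator F x \<partial>\<nu>)"
    using open_op_bv[OF B(1) Suc.prems] by (intro Suc.IH) simp
  finally show ?case by (simp only: funpow_Suc_right comp_apply)
qed

lemma bv_integrable:
  assumes "bounded_variation_on X (u :: real \<Rightarrow> real)"
  shows "integrable \<nu> u"
  using norm_le_bv_norm[OF assms] bv_measurable[OF assms]
  by (intro integrable_const_bound[where B = "bv_norm X u"]) (auto simp: space_\<nu>)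

lemma bv_integrable_indicator:
  assumes "bounded_variation_on X (u :: real \<Rightarrow> real)" "F \<in> sets \<nu>"
  shows "integrable \<nu> (\<lambda>x. u x * indicator F x)"
  using integrable_mult_indicator[OF assms(2) bv_integrable[OF assms(1)]] by (simp add: mult.commute)

text \<open>The mass \<open>w\<close> that has avoided \<open>B\<close> for \<open>m\<close> steps is of bounded variation, but decay of correlations
  is stated for densities with respect to \<open>h d\<nu>\<close>, and \<open>w / h\<close> need not be of bounded
  variation. It is replaced by \<open>w / max h \<delta>\<close>, which changes integrals by at most \<open>\<delta>\<close> as \<open>w \<le> h\<close>.\<close>

lemma avoid_decorrelation:
  assumes h: "bounded_variation_on X h" and h_nn: "AE x in \<nu>. 0 \<le> h x"
    and M: "M = density \<nu> (\<lambda>x. ennreal (h x))" "prob_space M" "distr M M f = M"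
    and decay: "\<And>\<phi> F j. bounded_variation_on X \<phi> \<Longrightarrow> F \<in> sets \<nu> \<Longrightarrow>
      \<bar>(\<integral>x. \<phi> x * indicator F ((f ^^ j) x) \<partial>M) - (\<integral>x. \<phi> x \<partial>M) * measure M F\<bar>
      \<le> C * exp (- \<tau> * real j) * bv_norm X (\<phi> :: real \<Rightarrow> real)"
    and C: "0 \<le> C" and \<delta>: "0 < \<delta>" "\<delta> \<le> 1"
    and B: "is_interval B" "B \<in> sets \<nu>" and F: "F \<in> sets \<nu>"
  shows "measure M (avoid B m {x \<in> X. (f ^^ t) x \<in> F}) \<le> measure M (avoid B m X) * measure M F
    + C * bv_norm X h * (bv_norm X h + 1) * (max 1 (3 * K / lam)) ^ m * exp (- \<tau> * real t) / \<delta>\<^sup>2 + \<delta>"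
proof -
  interpret M: prob_space M by (rule M(2))
  define w where "w = (open_op B ^^ m) h"
  define v where "v = (\<lambda>x. 1 / max (h x) \<delta>)"
  define \<phi> where "\<phi> = (\<lambda>x. w x * v x)"
  have hm: "h \<in> borel_measurable \<nu>" using h by (rule bv_measurable)
  have sM: "sets M = sets \<nu>" "space M = X" using M(1) by (auto simp: space_\<nu>)
  have Xs: "X \<in> sets \<nu>" using sets.top[of \<nu>] by (simp add: space_\<nu>)
  have w: "bounded_variation_on X w" "bv_norm X w \<le> (3 * K / lam) ^ m * bv_norm X h"
    using open_op_iterate_bv[OF B(1) h] by (auto simp: w_def)
  have v: "bounded_variation_on X v" "bv_norm X v \<le> (bv_norm X h + 1) / \<delta>\<^sup>2"
    unfolding v_def using bounded_variation_inverse_max[OF h X_nonempty \<delta>] bv_norm_inverse_max_le[OF h X_nonempty \<delta>] by auto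
  have \<phi>: "bounded_variation_on X \<phi>" unfolding \<phi>_def by (intro bounded_variation_mult w v X_nonempty)
  have h0: "0 \<le> bv_norm X h" by (rule bv_norm_nonneg[OF h X_nonempty])
  have n\<phi>: "bv_norm X \<phi> \<le> (max 1 (3 * K / lam)) ^ m * bv_norm X h * ((bv_norm X h + 1) / \<delta>\<^sup>2)"
  proof -
    have "bv_norm X \<phi> \<le> bv_norm X w * bv_norm X v"
      unfolding \<phi>_def by (intro bv_norm_mult_le w v X_nonempty)
    also have "\<dots> \<le> (max 1 (3 * K / lam)) ^ m * bv_norm X h * ((bv_norm X h + 1) / \<delta>\<^sup>2)"
    proof (intro mult_mono v)
      have "(3 * K / lam) ^ m \<le> (max 1 (3 * K / lam)) ^ m"
        using K_nonneg lam_pos by (intro power_mono) auto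
      then show "bv_norm X w \<le> (max 1 (3 * K / lam)) ^ m * bv_norm X h"
        using w(2) h0 by (meson mult_right_mono order_trans)
      show "0 \<le> bv_norm X v" by (rule bv_norm_nonneg[OF v(1) X_nonempty])
    qed (use h0 in auto)
    finally show ?thesis .
  qed
  have int_M: "(\<integral>x. u x \<partial>M) = (\<integral>x. h x * u x \<partial>\<nu>)" if "u \<in> borel_measurable \<nu>" for u :: "real \<Rightarrow> real"
    unfolding M(1) using that hm h_nn by (subst integral_density) auto
  have meas_M: "measure M S = (\<integral>x. h x * indicator S x \<partial>\<nu>)" if S: "S \<in> sets \<nu>" for S
  proof -
    have "measure M S = (\<integral>x. indicator S x \<partial>M)"
      using S sets.sets_into_space[OF S] sM by (simp add: Int_absorb2 space_\<nu>)
    also have "\<dots> = (\<integral>x. h x * indicator S x \<partial>\<nu>)" using S by (intro int_M) auto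
    finally show ?thesis .
  qed
  have w_int: "(\<integral>x. w x * indicator G x \<partial>\<nu>) = measure M (avoid B m G)" if G: "G \<in> sets \<nu>" for G
    using open_op_iterate_integral[OF B G h, of m] meas_M[OF avoid_sets[OF B(2) G, of m]] by (simp add: w_def)
  have inv: "measure M {x \<in> X. (f ^^ k) x \<in> G} = measure M G" if G: "G \<in> sets \<nu>" for k G
  proof (induction k)
    case 0
    have "{x \<in> X. x \<in> G} = G" using sets.sets_into_space[OF G] by (auto simp: space_\<nu>)
    then show ?case by simp
  next
    case (Suc k)
    have "measure M {x \<in> X. (f ^^ Suc k) x \<in> G} = measure M (f -` {x \<in> X. (f ^^ k) x \<in> G} \<inter> space M)"
      using measurable_space[OF f_meas] sM by (intro arg_cong[where f = "measure M"]) (auto simp: funpow_swap1 space_\<nu>)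
    also have "\<dots> = measure (distr M M f) {x \<in> X. (f ^^ k) x \<in> G}"
      using preimage_sets[OF G] sM f_meas measurable_cong_sets[OF sM(1) sM(1)]
      by (intro measure_distr[symmetric]) auto
    finally show ?case using Suc M(3) by simp
  qed
  \<comment> \<open>On every measurable set \<open>w\<close> integrates to a probability, namely
    that of avoiding the hole and landing in the set.\<close>
  have w0: "AE x in \<nu>. 0 \<le> w x"
    by (rule AE_le_of_set_integral_le[OF _ bv_integrable[OF w(1)]]) (simp_all add: w_int)
  \<comment> \<open>Without a hole the mass landing in \<open>G\<close> would be
    \<open>measure M G\<close> by invariance, and a hole only removes mass.\<close>
  have wh: "AE x in \<nu>. w x \<le> h x"
  proof (intro AE_le_of_set_integral_le bv_integrable w h)
    fix G assume G: "G \<in> sets \<nu>"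
    have "measure M (avoid B m G) \<le> measure M {x \<in> X. (f ^^ m) x \<in> G}"
      using preimage_sets[OF G] sM by (intro M.finite_measure_mono) (auto simp: avoid_def)
    then show "(\<integral>x. w x * indicator G x \<partial>\<nu>) \<le> (\<integral>x. h x * indicator G x \<partial>\<nu>)"
      using w_int[OF G] inv[OF G] meas_M[OF G] by simp
  qed
  define H where "H = {x \<in> X. (f ^^ t) x \<in> F}"
  have H: "H \<in> sets \<nu>" unfolding H_def by (rule preimage_sets[OF F])
  have \<phi>m: "\<phi> \<in> borel_measurable \<nu>" using \<phi> by (rule bv_measurable)
  have ih\<phi>: "integrable \<nu> (\<lambda>x. h x * \<phi> x)"
    by (intro bv_integrable bounded_variation_mult h \<phi> X_nonempty)
  have ih\<phi>H: "integrable \<nu> (\<lambda>x. h x * \<phi> x * indicator H x)"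
    by (intro bv_integrable_indicator bounded_variation_mult h \<phi> X_nonempty H)
  have "measure M (avoid B m H) = (\<integral>x. w x * indicator H x \<partial>\<nu>)" using w_int[OF H] by simp
  also have "\<dots> \<le> (\<integral>x. h x * \<phi> x * indicator H x + \<delta> \<partial>\<nu>)"
  proof (rule integral_mono_AE)
    show "AE x in \<nu>. w x * indicator H x \<le> h x * \<phi> x * indicator H x + \<delta>"
      using w0 wh h_nn
    proof eventually_elim
      case (elim x)
      \<comment> \<open>Where \<open>h x \<ge> \<delta>\<close> the quotient is exact; elsewhere
        \<open>w x \<le> h x < \<delta>\<close>.\<close>
      have "w x \<le> h x * \<phi> x + \<delta>"
      proof (cases "\<delta> \<le> h x")
        case True
        then have "h x * \<phi> x = w x" using \<delta> by (simp add: \<phi>_def v_def max_def)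
        then show ?thesis using \<delta> by simp
      next
        case False
        have "0 \<le> h x * \<phi> x" using elim \<delta> by (simp add: \<phi>_def v_def)
        then show ?thesis using False elim by simp
      qed
      then show ?case using \<delta> by (auto simp: indicator_def)
    qed
    show "integrable \<nu> (\<lambda>x. w x * indicator H x)" by (intro bv_integrable_indicator w H)
    show "integrable \<nu> (\<lambda>x. h x * \<phi> x * indicator H x + \<delta>)" using ih\<phi>H by simp
  qed
  also have "\<dots> = (\<integral>x. h x * \<phi> x * indicator H x \<partial>\<nu>) + \<delta>"
    using ih\<phi>H by (simp add: prob_space)
  also have "(\<integral>x. h x * \<phi> x * indicator H x \<partial>\<nu>) = (\<integral>x. \<phi> x * indicator H x \<partial>M)"
    using \<phi>m H by (subst int_M) (auto simp: mult.assoc)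
  also have "\<dots> = (\<integral>x. \<phi> x * indicator F ((f ^^ t) x) \<partial>M)"
    by (intro Bochner_Integration.integral_cong) (auto simp: H_def sM indicator_def)
  also have "\<dots> \<le> (\<integral>x. \<phi> x \<partial>M) * measure M F + C * exp (- \<tau> * real t) * bv_norm X \<phi>"
    using decay[OF \<phi> F, of t] by (simp add: abs_le_iff)
  also have "(\<integral>x. \<phi> x \<partial>M) = (\<integral>x. h x * \<phi> x \<partial>\<nu>)" by (rule int_M[OF \<phi>m])
  also have "(\<integral>x. h x * \<phi> x \<partial>\<nu>) * measure M F \<le> measure M (avoid B m X) * measure M F"
  proof (rule mult_right_mono)
    have "(\<integral>x. h x * \<phi> x \<partial>\<nu>) \<le> (\<integral>x. w x \<partial>\<nu>)"
    proof (rule integral_mono_AE[OF ih\<phi> bv_integrable[OF w(1)]])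
      show "AE x in \<nu>. h x * \<phi> x \<le> w x"
        using w0 wh h_nn
      proof eventually_elim
        case (elim x)
        have "h x * v x \<le> 1" using \<delta> by (auto simp: v_def divide_le_eq_1 less_max_iff_disj)
        then have "w x * (h x * v x) \<le> w x" using elim by (simp add: mult_left_le)
        then show ?case by (simp add: \<phi>_def mult_ac)
      qed
    qed
    also have "\<dots> = (\<integral>x. w x * indicator X x \<partial>\<nu>)"
      by (intro Bochner_Integration.integral_cong) (auto simp: space_\<nu>)
    also have "\<dots> = measure M (avoid B m X)" by (rule w_int[OF Xs])
    finally show "(\<integral>x. h x * \<phi> x \<partial>\<nu>) \<le> measure M (avoid B m X)" .
  qed simp
  also have "C * exp (- \<tau> * real t) * bv_norm X \<phi>
      \<le> C * exp (- \<tau> * real t) * ((max 1 (3 * K / lam)) ^ m * bv_norm X h * ((bv_norm X h + 1) / \<delta>\<^sup>2))"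
    using n\<phi> C by (intro mult_left_mono) auto
  also have "\<dots> = C * bv_norm X h * (bv_norm X h + 1) * (max 1 (3 * K / lam)) ^ m * exp (- \<tau> * real t) / \<delta>\<^sup>2"
    by simp
  finally show ?thesis by (simp add: H_def)
qed

end

section \<open>The dichotomy\<close>

context mixing_on_sets
begin

text \<open>A set that is almost forward invariant is almost invariant, hence agrees up to a null set with
  the set of points visiting it infinitely often, which is strictly invariant.\<close>

lemma zero_one:
  assumes ergodic: "\<And>A. A \<in> events \<Longrightarrow> f -` A \<inter> space M = A \<Longrightarrow> prob A = 0 \<or> prob A = 1"
    and H: "H \<in> events" and fwd: "AE x in M. x \<in> H \<longrightarrow> f x \<in> H"
  shows "prob H = 0 \<or> prob H = 1"
proof -
  have pH: "pre 1 H \<in> events" "prob (pre 1 H) = prob H" using H by auto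
  \<comment> \<open>\<open>H\<close> lies in its preimage up to a null set, and both have the same
    measure, so they differ by a null set only.\<close>
  have "prob (H \<inter> pre 1 H) = prob H"
    using fwd H pH sets.sets_into_space[OF H]
    by (intro finite_measure_eq_AE) (auto simp: pre_def elim!: eventually_mono)
  then have "prob (pre 1 H - H \<inter> pre 1 H) = 0"
    using H pH by (subst finite_measure_Diff) auto
  then have "AE x in M. x \<notin> pre 1 H - H \<inter> pre 1 H"
    using H pH by (intro AE_not_in) (auto simp: null_sets_def emeasure_eq_measure)
  then have inv: "AE x in M. f x \<in> H \<longleftrightarrow> x \<in> H"
    using fwd AE_space by eventually_elim (auto simp: pre_def)
  \<comment> \<open>Invariance of the measure carries the exceptional null set along the
    orbit.\<close>
  have "AE x in M. (f ^^ Suc n) x \<in> H \<longleftrightarrow> (f ^^ n) x \<in> H" for n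
  proof -
    have "AE x in distr M M (f ^^ n). f x \<in> H \<longleftrightarrow> x \<in> H"
      unfolding funpow_invariant by (rule inv)
    then show ?thesis using AE_distrD[OF funpow_measurable] by fastforce
  qed
  then have "AE x in M. \<forall>n. (f ^^ Suc n) x \<in> H \<longleftrightarrow> (f ^^ n) x \<in> H"
    by (simp only: AE_all_countable) blast
  then have all: "AE x in M. \<forall>n. (f ^^ n) x \<in> H \<longleftrightarrow> x \<in> H"
  proof (rule AE_mp, intro AE_I2 impI allI)
    fix x n assume *: "\<forall>n. (f ^^ Suc n) x \<in> H \<longleftrightarrow> (f ^^ n) x \<in> H"
    show "(f ^^ n) x \<in> H \<longleftrightarrow> x \<in> H"
      by (induction n) (use * in auto)
  qed
  define A where "A = (\<Inter>N. \<Union>n\<in>{N..}. pre n H)"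
  have A: "A \<in> events" unfolding A_def using H by (intro sets.countable_INT' sets.countable_UN') auto
  have A_iff: "x \<in> A \<longleftrightarrow> x \<in> space M \<and> (\<forall>N. \<exists>n\<ge>N. (f ^^ n) x \<in> H)" for x
    by (auto simp: A_def pre_def)
  have shift: "(\<forall>N. \<exists>n\<ge>N. P (Suc n)) \<longleftrightarrow> (\<forall>N. \<exists>n\<ge>N. P n)" for P :: "nat \<Rightarrow> bool"
  proof (intro iffI allI)
    fix N assume "\<forall>N. \<exists>n\<ge>N. P (Suc n)"
    then obtain n where "N \<le> n" "P (Suc n)" by blast
    then show "\<exists>n\<ge>N. P n" by (intro exI[of _ "Suc n"]) simp
  next
    fix N assume "\<forall>N. \<exists>n\<ge>N. P n"
    then obtain n where "Suc N \<le> n" "P n" by blast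
    then show "\<exists>n\<ge>N. P (Suc n)" by (cases n) auto
  qed
  have "f -` A \<inter> space M = A"
  proof (intro set_eqI)
    fix x
    have "f x \<in> space M" if "x \<in> space M" using that by (rule measurable_space[OF f_measurable])
    then show "x \<in> f -` A \<inter> space M \<longleftrightarrow> x \<in> A"
      using shift[of "\<lambda>n. (f ^^ n) x \<in> H"] by (auto simp: A_iff funpow_swap1)
  qed
  then have "prob A = 0 \<or> prob A = 1" using ergodic[OF A] by simp
  moreover have "prob A = prob H"
  proof (rule finite_measure_eq_AE[OF _ A H])
    show "AE x in M. x \<in> A \<longleftrightarrow> x \<in> H"
      using all AE_space
    proof eventually_elim
      case (elim x)
      then show ?case unfolding A_iff by blast
    qed
  qed
  ultimately show ?thesis by simp
qed

end

lemma H_ea_eq: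
  "H_ea X f B = {x \<in> X. \<forall>\<^sub>F m in sequentially. \<exists>k<m. (f ^^ k) x \<in> B m}"
proof (intro set_eqI iffI)
  fix x assume "x \<in> H_ea X f B"
  then obtain n where "\<And>m. n \<le> m \<Longrightarrow> x \<in> (\<Union>k<m. (f ^^ k) -` B m \<inter> X)"
    by (auto simp: H_ea_def)
  moreover from this[of n] have "x \<in> X" by blast
  ultimately show "x \<in> {x \<in> X. \<forall>\<^sub>F m in sequentially. \<exists>k<m. (f ^^ k) x \<in> B m}"
    unfolding eventually_sequentially by blast
next
  fix x assume "x \<in> {x \<in> X. \<forall>\<^sub>F m in sequentially. \<exists>k<m. (f ^^ k) x \<in> B m}"
  then obtain n where "x \<in> X" "\<And>m. n \<le> m \<Longrightarrow> \<exists>k<m. (f ^^ k) x \<in> B m"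
    unfolding eventually_sequentially by blast
  then have "x \<in> (\<Inter>m\<in>{max 1 n..}. \<Union>k<m. (f ^^ k) -` B m \<inter> X)" by fastforce
  then show "x \<in> H_ea X f B"
    unfolding H_ea_def by (rule UN_I[rotated]) simp
qed

text \<open>As \<open>\<psi>\<close> is strictly decreasing, reaching the level
  \<open>\<psi> (r n)\<close> means coming within distance \<open>r n\<close>, equality included.
  Exceedances thus correspond to closed balls, whereas the targets are open ones.\<close>

lemma ev_exceed_eq:
  assumes anti: "strict_antimono_on {0..} \<psi>" and r: "\<And>n. 1 \<le> n \<Longrightarrow> 0 < r n"
    and \<phi>: "\<And>x. \<phi> x = \<psi> (dist x xt)"
  shows "ev_exceed X f \<phi> (\<lambda>n. \<psi> (r n) :: ereal)
    = {x \<in> X. \<forall>\<^sub>F n in sequentially. \<exists>k<n. dist ((f ^^ k) x) xt \<le> r n}"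
proof -
  have \<psi>: "\<psi> b \<le> \<psi> a \<longleftrightarrow> a \<le> b" if "0 \<le> a" "0 \<le> b" for a b :: real
    using anti that unfolding monotone_on_def by (metis atLeast_iff leD le_less linorder_le_less_linear)
  have "\<psi> (r n) \<le> running_max f \<phi> n x \<longleftrightarrow> (\<exists>k<n. dist ((f ^^ k) x) xt \<le> r n)" if n: "1 \<le> n" for n x
  proof -
    have "\<psi> (r n) \<le> running_max f \<phi> n x \<longleftrightarrow> (\<exists>i\<in>{1..n}. \<psi> (r n) \<le> \<phi> ((f ^^ (i - 1)) x))"
      unfolding running_max_def using n by (subst Max_ge_iff) auto
    also have "\<dots> \<longleftrightarrow> (\<exists>i\<in>{1..n}. dist ((f ^^ (i - 1)) x) xt \<le> r n)"
      using r[OF n] by (simp add: \<phi> \<psi>)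
    also have "\<dots> \<longleftrightarrow> (\<exists>k<n. dist ((f ^^ k) x) xt \<le> r n)"
    proof
      assume "\<exists>i\<in>{1..n}. dist ((f ^^ (i - 1)) x) xt \<le> r n"
      then obtain i where "i \<in> {1..n}" "dist ((f ^^ (i - 1)) x) xt \<le> r n" by blast
      then show "\<exists>k<n. dist ((f ^^ k) x) xt \<le> r n" by (intro exI[of _ "i - 1"]) auto
    next
      assume "\<exists>k<n. dist ((f ^^ k) x) xt \<le> r n"
      then obtain k where "k < n" "dist ((f ^^ k) x) xt \<le> r n" by blast
      then show "\<exists>i\<in>{1..n}. dist ((f ^^ (i - 1)) x) xt \<le> r n" by (intro bexI[of _ "Suc k"]) auto
    qed
    finally show ?thesis .
  qed
  then have "(\<forall>\<^sub>F n in sequentially. \<psi> (r n) \<le> running_max f \<phi> n x)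
      \<longleftrightarrow> (\<forall>\<^sub>F n in sequentially. \<exists>k<n. dist ((f ^^ k) x) xt \<le> r n)" for x
    by (intro eventually_cong eventually_mono[OF eventually_ge_at_top[of 1]]) auto
  then show ?thesis by (simp add: ev_exceed_def)
qed

text \<open>The essential supremum of an indicator is at most 1, so a single constant serves all
  events.\<close>

lemma exp_decay_indicator:
  assumes M: "prob_space M" and decay: "exp_decay_bv_Linf f M" and ne: "space M \<noteq> {}"
  obtains C \<tau> where "0 < C" "0 < \<tau>"
    "\<And>\<phi> F j. bounded_variation_on (space M) \<phi> \<Longrightarrow> F \<in> sets M \<Longrightarrow>
      \<bar>(\<integral>x. \<phi> x * indicator F ((f ^^ j) x) \<partial>M) - (\<integral>x. \<phi> x \<partial>M) * measure M F\<bar>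
      \<le> C * exp (- \<tau> * real j) * bv_norm (space M) (\<phi> :: real \<Rightarrow> real)"
proof -
  interpret prob_space M by (rule M)
  obtain C \<tau> where C: "0 < C" "0 < \<tau>"
    and d: "\<And>\<phi>1 \<phi>2 :: real \<Rightarrow> real. \<And>j. bounded_variation_on (space M) \<phi>1 \<Longrightarrow>
        \<phi>2 \<in> borel_measurable M \<Longrightarrow> bounded (\<phi>2 ` space M) \<Longrightarrow>
        \<bar>(\<integral>x. \<phi>1 x * \<phi>2 ((f ^^ j) x) \<partial>M) - (\<integral>x. \<phi>1 x \<partial>M) * (\<integral>x. \<phi>2 x \<partial>M)\<bar>
          \<le> C * exp (- \<tau> * real j) * bv_norm (space M) \<phi>1
              * real_of_ereal (esssup M (\<lambda>x. ereal \<bar>\<phi>2 x\<bar>))"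
    using decay unfolding exp_decay_bv_Linf_def by blast
  have "\<bar>(\<integral>x. \<phi> x * indicator F ((f ^^ j) x) \<partial>M) - (\<integral>x. \<phi> x \<partial>M) * measure M F\<bar>
      \<le> C * exp (- \<tau> * real j) * bv_norm (space M) \<phi>"
    if \<phi>: "bounded_variation_on (space M) \<phi>" and F: "F \<in> sets M" for \<phi> :: "real \<Rightarrow> real" and F j
  proof -
    have "esssup M (\<lambda>x. ereal \<bar>indicator F x :: real\<bar>) \<le> 1"
      using F by (intro esssup_I) (auto simp: indicator_def)
    then have e: "real_of_ereal (esssup M (\<lambda>x. ereal \<bar>indicator F x :: real\<bar>)) \<le> 1"
      by (cases "esssup M (\<lambda>x. ereal \<bar>indicator F x :: real\<bar>)") auto
    have "bounded ((indicator F :: real \<Rightarrow> real) ` space M)"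
      by (rule bounded_subset[of "{0, 1}"]) (auto simp: indicator_def)
    moreover have "(\<integral>x. indicator F x \<partial>M) = measure M F"
      using sets.sets_into_space[OF F] by (simp add: Int_absorb2)
    ultimately have "\<bar>(\<integral>x. \<phi> x * indicator F ((f ^^ j) x) \<partial>M) - (\<integral>x. \<phi> x \<partial>M) * measure M F\<bar>
      \<le> C * exp (- \<tau> * real j) * bv_norm (space M) \<phi> * real_of_ereal (esssup M (\<lambda>x. ereal \<bar>indicator F x :: real\<bar>))"
      using d[OF \<phi>, of "indicator F" j] F by simp
    also have "\<dots> \<le> C * exp (- \<tau> * real j) * bv_norm (space M) \<phi> * 1"
      using e C bv_norm_nonneg[OF \<phi> ne] by (intro mult_left_mono) auto
    finally show ?thesis by simp
  qed
  with C show ?thesis using that by blast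
qed

theorem theorem3p2:
  fixes X :: "real set" and f :: "real \<Rightarrow> real" and \<mu> \<nu> :: "real measure"
    and g h :: "real \<Rightarrow> real" and lam :: real
    and xt :: real and \<psi> :: "real \<Rightarrow> ereal" and \<phi> :: "real \<Rightarrow> ereal" and r :: "nat \<Rightarrow> real"
  assumes "is_interval X"
    and "f \<in> X \<rightarrow> X"
    and "sets \<mu> = sets (restrict_space borel X)"
    and "ergodic_measure f \<mu>"
    and "exp_decay_bv_Linf f \<mu>"
    and "\<And>y. y \<in> X \<Longrightarrow> 0 \<le> g y"
    and "prob_space \<nu>" and "sets \<nu> = sets (restrict_space borel X)"
    and "0 < lam"
    and "conformal_measure X f g lam \<nu>"
    and "bounded_variation_on X h"
    and "AE x in \<nu>. 0 \<le> h x"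
    and "\<mu> = density \<nu> (\<lambda>x. ennreal (h x))"
    and "\<And>x. x \<in> X \<Longrightarrow> transfer_operator X f g h x = lam * h x"
    and "spectral_gap_on_bv X f g lam h"
    and "xt \<in> X"
    and "strict_antimono_on {0..} \<psi>" and "continuous_on {0..} \<psi>"
    and "\<And>y. 0 \<le> y \<Longrightarrow> \<psi> y \<noteq> - \<infinity>"
    and "(\<psi> \<longlongrightarrow> \<infinity>) (at_right 0)"
    and "\<And>x. \<phi> x = \<psi> (dist x xt)"
    and "\<And>n. 1 \<le> n \<Longrightarrow> 0 < r n"
    and "\<And>m n. 1 \<le> m \<Longrightarrow> m \<le> n \<Longrightarrow> r n \<le> r m"
    and "r \<longlonglongrightarrow> 0"
    and "\<And>m n. 1 \<le> m \<Longrightarrow> m \<le> n \<Longrightarrow>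
           real m * measure \<mu> (rel_ball X xt (r m)) \<le> real n * measure \<mu> (rel_ball X xt (r n))"
    and "short_return_times f \<mu> (\<lambda>n. rel_ball X xt (r n))"
  shows "(summable (\<lambda>n. measure \<mu> (rel_ball X xt (r n)) * exp (- real n * measure \<mu> (rel_ball X xt (r n))))
            \<longrightarrow> measure \<mu> (H_ea X f (\<lambda>n. rel_ball X xt (r n))) = 1
                \<and> measure \<mu> (ev_exceed X f \<phi> (\<lambda>n. \<psi> (r n))) = 1)
       \<and> (\<not> summable (\<lambda>n. measure \<mu> (rel_ball X xt (r n)) * exp (- real n * measure \<mu> (rel_ball X xt (r n))))
            \<longrightarrow> measure \<mu> (H_ea X f (\<lambda>n. rel_ball X xt (r n))) = 0
                \<and> measure \<mu> (ev_exceed X f \<phi> (\<lambda>n. \<psi> (r n))) = 0)"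
proof -
  define B where "B n = rel_ball X xt (r n)" for n
  define \<B> where "\<B> = range (\<lambda>\<rho>. rel_ball X xt \<rho>)"
  note sets_\<mu> = assms(3) and ergodic = assms(4) and sets_\<nu> = assms(8) and gap = assms(15) and xt = assms(16)
    and anti = assms(17) and r_pos = assms(22) and r_mono = assms(23) and r_lim = assms(24)
    and scaled = assms(25) and short = assms(26)
  have X: "X \<noteq> {}" using xt by blast
  have sp: "space \<mu> = X" using sets_eq_imp_space_eq[OF sets_\<mu>] by (simp add: space_restrict_space)
  have \<mu>\<nu>: "sets \<mu> = sets \<nu>" using sets_\<mu> sets_\<nu> by simp
  have \<mu>: "prob_space \<mu>" "f \<in> measurable \<mu> \<mu>" "distr \<mu> \<mu> f = \<mu>"
    and inv01: "\<And>A. A \<in> sets \<mu> \<Longrightarrow> f -` A \<inter> space \<mu> = A \<Longrightarrow> measure \<mu> A = 0 \<or> measure \<mu> A = 1"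
    using ergodic by (auto simp: ergodic_measure_def)
  interpret \<mu>: prob_space \<mu> by (rule \<mu>(1))
  obtain C \<tau> where C: "0 < C" "0 < \<tau>"
    and decay: "\<And>\<phi> F j. bounded_variation_on X \<phi> \<Longrightarrow> F \<in> sets \<mu> \<Longrightarrow>
      \<bar>(\<integral>x. \<phi> x * indicator F ((f ^^ j) x) \<partial>\<mu>) - (\<integral>x. \<phi> x \<partial>\<mu>) * measure \<mu> F\<bar>
      \<le> C * exp (- \<tau> * real j) * bv_norm X (\<phi> :: real \<Rightarrow> real)"
    using exp_decay_indicator[OF \<mu>(1) assms(5)] X unfolding sp by blast
  obtain K where K: "0 \<le> K" "\<And>\<phi> :: real \<Rightarrow> real. bounded_variation_on X \<phi> \<Longrightarrow>
    bounded_variation_on X (transfer_operator X f g \<phi>) \<and>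
    bv_norm X (transfer_operator X f g \<phi>) \<le> K * bv_norm X \<phi>"
    using transfer_operator_bv_bound[of X f g] gap X unfolding spectral_gap_on_bv_def by metis
  have f_\<nu>: "f \<in> measurable \<nu> \<nu>" using \<mu>(2) measurable_cong_sets[OF \<mu>\<nu> \<mu>\<nu>] by simp
  interpret ct: conformal_transfer \<nu> X f g lam K
    using assms(1,6,7,9,10) X sets_\<nu> f_\<nu> K gap
    by (intro conformal_transfer.intro conformal_transfer_axioms.intro) (auto simp: spectral_gap_on_bv_def)
  have interval: "is_interval D \<and> D \<in> sets \<mu>" if "D \<in> \<B>" for D
  proof -
    obtain \<rho> where D: "D = rel_ball X xt \<rho>" using \<open>D \<in> \<B>\<close> by (auto simp: \<B>_def)
    have "is_interval D"
      unfolding D using assms(1) by (auto simp: is_interval_convex_1 intro: convex_Int)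
    moreover have "D \<in> sets \<mu>" unfolding D sets_\<mu> sets_restrict_space by auto
    ultimately show ?thesis ..
  qed
  have set_decay: "\<bar>measure \<mu> (D \<inter> ((f ^^ j) -` F \<inter> space \<mu>)) - measure \<mu> D * measure \<mu> F\<bar> \<le> 3 * C * exp (- \<tau> * real j)"
    if D: "is_interval D" "D \<in> sets \<mu>" and F: "F \<in> sets \<mu>" for D F j
  proof -
    have "(\<integral>x. indicator D x * indicator F ((f ^^ j) x) \<partial>\<mu>) = (\<integral>x. indicator (D \<inter> ((f ^^ j) -` F \<inter> space \<mu>)) x \<partial>\<mu> :: real)"
      by (intro Bochner_Integration.integral_cong) (auto simp: indicator_def)
    also have "\<dots> = measure \<mu> (D \<inter> ((f ^^ j) -` F \<inter> space \<mu>))"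
      using sets.sets_into_space[OF D(2)] by (simp add: Int_assoc)
    finally have 1: "(\<integral>x. indicator D x * indicator F ((f ^^ j) x) \<partial>\<mu>) = measure \<mu> (D \<inter> ((f ^^ j) -` F \<inter> space \<mu>))" .
    have 2: "(\<integral>x. indicator D x \<partial>\<mu>) = measure \<mu> D"
      using sets.sets_into_space[OF D(2)] by (simp add: Int_absorb2)
    have "\<bar>measure \<mu> (D \<inter> ((f ^^ j) -` F \<inter> space \<mu>)) - measure \<mu> D * measure \<mu> F\<bar>
        \<le> C * exp (- \<tau> * real j) * bv_norm X (indicator D :: real \<Rightarrow> real)"
      using decay[OF bounded_variation_indicator[OF D(1) X] F, of j] unfolding 1 2 .
    also have "\<dots> \<le> C * exp (- \<tau> * real j) * 3"
      using C by (intro mult_left_mono bv_norm_indicator_le D X) auto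
    finally show ?thesis by simp
  qed
  interpret mx: mixing_on_sets \<mu> f \<B> "3 * C" \<tau>
    using \<mu> C interval set_decay by unfold_locales auto
  have B_sub: "B n \<subseteq> X" for n by (auto simp: B_def)
  have B_in: "B n \<in> \<B>" for n by (auto simp: B_def \<B>_def)
  have B_sets: "B n \<in> sets \<mu>" for n using interval[OF B_in] by blast
  have B_anti: "B n \<subseteq> B m" if "1 \<le> m" "m \<le> n" for m n
    using r_mono[OF that] by (auto simp: B_def)
  obtain s \<gamma> \<sigma> where ex: "s \<in> {0<..<1}" "\<gamma> \<in> {0<..<1}" "\<sigma> \<in> {0<..<1}"
      "\<sigma> > Max {(1 + \<gamma> + s) / 2, 1 - \<gamma>, (2 + s) / 3, 1 - s / 2}"
    and bigo: "(\<lambda>n. measure \<mu> (B n)) \<in> O(\<lambda>n. real n powr (- \<sigma>))"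
      "(\<lambda>n. \<Sum>j | 1 \<le> j \<and> real j \<le> real n powr s. measure \<mu> (B n \<inter> (f ^^ j) -` B n))
          \<in> O(\<lambda>n. real n powr (- 1 - \<gamma>))"
    using short unfolding short_return_times_def B_def by blast
  have div: "\<not> summable (\<lambda>n. measure \<mu> (B n))"
    using short unfolding short_return_times_def B_def by blast
  have ret: "B n \<inter> mx.pre j (B n) = B n \<inter> (f ^^ j) -` B n" for n j
    using B_sub by (auto simp: mx.pre_def sp)
  \<comment> \<open>By nesting, a null ball would make all later balls null and the series of
    measures convergent.\<close>
  have B_pos: "0 < measure \<mu> (B n)" if n: "1 \<le> n" for n
  proof (rule ccontr)
    assume "\<not> 0 < measure \<mu> (B n)"
    then have "measure \<mu> (B n) = 0" using measure_nonneg[of \<mu> "B n"] by linarith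
    then have "measure \<mu> (B m) = 0" if "n \<le> m" for m
      using \<mu>.finite_measure_mono[OF B_anti[OF n that] B_sets] measure_nonneg[of \<mu> "B m"] by linarith
    then have "\<forall>\<^sub>F m in sequentially. measure \<mu> (B m) = 0"
      unfolding eventually_sequentially by blast
    then have "summable (\<lambda>m. measure \<mu> (B m)) \<longleftrightarrow> summable (\<lambda>m. 0 :: real)"
      by (rule summable_cong)
    then show False using div by simp
  qed
  \<comment> \<open>The conditions \<open>exponents\<close> follow from the maximum:
    \<open>1 - \<gamma>\<close> gives \<open>1 < \<sigma> + \<gamma>\<close>,
    \<open>1 - s / 2\<close> gives \<open>1 < \<sigma> + s\<close>, and \<open>(2 + s) / 3\<close>
    exceeds \<open>s\<close>.\<close>
  interpret sr: short_returns \<mu> f \<B> "3 * C" \<tau> B s \<gamma> \<sigma>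
  proof unfold_locales
    show "real m * \<mu>.prob (B m) \<le> real n * \<mu>.prob (B n)" if "1 \<le> m" "m \<le> n" for m n
      using scaled[OF that] by (simp add: B_def)
    show "(\<lambda>n. \<Sum>j | 1 \<le> j \<and> real j \<le> real n powr s. measure \<mu> (B n \<inter> mx.pre j (B n)))
        \<in> O(\<lambda>n. real n powr (- 1 - \<gamma>))"
      unfolding ret by (rule bigo(2))
  qed (use ex bigo B_in B_anti B_pos in auto)

  \<comment> \<open>Absence of atoms\<close>
  have singleton_sets: "{y} \<in> sets \<mu>" if "y \<in> X" for y
    unfolding sets_\<mu> sets_restrict_space by (rule image_eqI[of _ _ "{y}"]) (use that in auto)
  \<comment> \<open>For a point of mass \<open>a > 0\<close>, the part of \<open>{y}\<close> that is
    back at \<open>y\<close> at time \<open>j\<close> is all or nothing, so decay of correlations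
    brings \<open>a\<close> or 0 arbitrarily close to \<open>a * a\<close>; this leaves only
    \<open>a = 1\<close>. An atom of full mass would lie in every ball of positive measure, yet the
    balls become small.\<close>
  have nonatomic: "measure \<mu> {y} = 0" if y: "y \<in> X" for y
  proof (rule ccontr)
    define a where "a = measure \<mu> {y}"
    assume "measure \<mu> {y} \<noteq> 0"
    then have a: "0 < a" "a \<le> 1" by (auto simp: a_def zero_less_measure_iff)
    have ys: "{y} \<in> sets \<mu>" by (rule singleton_sets[OF y])
    have a1: "a = 1"
    proof (rule ccontr)
      assume "a \<noteq> 1"
      then have "a < 1" using a(2) by linarith
      then have "0 < a * (1 - a)" using a(1) by (intro mult_pos_pos) linarith+
      moreover have "0 < a * a" using a(1) by (rule mult_pos_pos[OF _ a(1)])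
      ultimately have pos: "0 < min (a * a) (a * (1 - a))" by linarith
      have "((\<lambda>j. 3 * C * exp (- \<tau> * real j)) \<longlongrightarrow> 0) sequentially"
        using C by real_asymp
      then have "\<forall>\<^sub>F j in sequentially. 3 * C * exp (- \<tau> * real j) < min (a * a) (a * (1 - a))"
        using pos by (rule order_tendstoD)
      then obtain j where j: "3 * C * exp (- \<tau> * real j) < min (a * a) (a * (1 - a))"
        by (auto simp: eventually_sequentially)
      have d: "\<bar>measure \<mu> ({y} \<inter> ((f ^^ j) -` {y} \<inter> space \<mu>)) - a * a\<bar> \<le> 3 * C * exp (- \<tau> * real j)"
        unfolding a_def using ys by (intro set_decay) (auto simp: is_interval_1)
      show False
      proof (cases "(f ^^ j) y = y")
        case True
        then have "{y} \<inter> ((f ^^ j) -` {y} \<inter> space \<mu>) = {y}" using y by (auto simp: sp)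
        then have "a - a * a \<le> 3 * C * exp (- \<tau> * real j)"
          using d unfolding a_def by (simp add: abs_le_iff)
        moreover have "3 * C * exp (- \<tau> * real j) < a - a * a"
          using j by (simp add: right_diff_distrib)
        ultimately show False by linarith
      next
        case False
        then have "{y} \<inter> ((f ^^ j) -` {y} \<inter> space \<mu>) = {}" by auto
        then show False using d j by simp
      qed
    qed
    have "1 \<le> measure \<mu> (B n)" if n: "1 \<le> n" for n
    proof -
      have "y \<in> B n"
      proof (rule ccontr)
        assume "y \<notin> B n"
        then have "measure \<mu> (B n) + measure \<mu> {y} = measure \<mu> (B n \<union> {y})"
          using B_sets ys by (intro \<mu>.finite_measure_Union[symmetric]) auto
        then show False
          using B_pos[OF n] a1 \<mu>.prob_le_1[of "B n \<union> {y}"] unfolding a_def by linarith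
      qed
      then have "measure \<mu> {y} \<le> measure \<mu> (B n)" using B_sets by (intro \<mu>.finite_measure_mono) auto
      then show ?thesis using a1 by (simp add: a_def)
    qed
    moreover have "\<exists>n\<ge>1. measure \<mu> (B n) \<le> 1 / 2"
    proof -
      obtain n where n: "1 \<le> n" "real (sr.blk n + sr.gap n) * measure \<mu> (B n) \<le> 1 / 2"
        using eventually_conj[OF eventually_ge_at_top[of 1] sr.eventually_block_small]
        by (auto simp: eventually_sequentially)
      have "1 * measure \<mu> (B n) \<le> real (sr.blk n + sr.gap n) * measure \<mu> (B n)"
        using sr.blk_bounds(1)[OF n(1)] by (intro mult_right_mono) auto
      then show ?thesis using n by auto
    qed
    ultimately show False by force
  qed

  \<comment> \<open>Comparison of open and closed balls, and the zero-one law\<close>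
  define H where "H = {x \<in> X. \<forall>\<^sub>F m in sequentially. \<exists>k<m. (f ^^ k) x \<in> B m}"
  define E where "E = {x \<in> X. \<forall>\<^sub>F m in sequentially. \<exists>k<m. dist ((f ^^ k) x) xt \<le> r m}"
  have eventually_sets: "{x \<in> X. \<forall>\<^sub>F m in sequentially. \<exists>k<m. (f ^^ k) x \<in> D m} \<in> sets \<mu>"
    if D: "\<And>m. D m \<in> sets \<mu>" for D
  proof -
    have "{x \<in> X. \<forall>\<^sub>F m in sequentially. \<exists>k<m. (f ^^ k) x \<in> D m} = (\<Union>n. \<Inter>m\<in>{n..}. \<Union>k<m. mx.pre k (D m)) \<inter> X"
      by (auto simp: eventually_sequentially mx.pre_def sp) blast+
    moreover have "X \<in> sets \<mu>" using sets.top[of \<mu>] by (simp add: sp)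
    moreover have "(\<Union>n. \<Inter>m\<in>{n..}. \<Union>k<m. mx.pre k (D m)) \<in> sets \<mu>"
      using D by (intro sets.countable_UN' sets.countable_INT' mx.pre_event) auto
    ultimately show ?thesis by (simp only: sets.Int)
  qed
  have H: "H \<in> sets \<mu>" unfolding H_def by (rule eventually_sets[OF B_sets])
  have E_eq: "E = {x \<in> X. \<forall>\<^sub>F m in sequentially. \<exists>k<m. (f ^^ k) x \<in> cball xt (r m) \<inter> X}"
    using mx.funpow_in_space by (auto simp: E_def dist_commute sp)
  have E: "E \<in> sets \<mu>"
    unfolding E_eq
  proof (rule eventually_sets)
    show "cball xt (r m) \<inter> X \<in> sets \<mu>" for m
      unfolding sets_\<mu> sets_restrict_space by (rule image_eqI[of _ _ "cball xt (r m)"]) auto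
  qed
  have H_ea: "H_ea X f (\<lambda>n. rel_ball X xt (r n)) = H"
    unfolding H_ea_eq H_def B_def ..
  have ev: "ev_exceed X f \<phi> (\<lambda>n. \<psi> (r n)) = E"
    unfolding E_def by (rule ev_exceed_eq[OF anti r_pos assms(21)])
  have not_orbit: "AE x in \<mu>. (f ^^ k) x \<noteq> y" if "y \<in> X" for k y
  proof -
    have ys: "{y} \<in> sets \<mu>" by (rule singleton_sets[OF that])
    then have "mx.pre k {y} \<in> null_sets \<mu>"
      using nonatomic[OF that] by (auto simp: null_sets_def \<mu>.emeasure_eq_measure)
    then have "AE x in \<mu>. x \<notin> mx.pre k {y}" by (rule AE_not_in)
    then show ?thesis using AE_space by eventually_elim (auto simp: mx.pre_def)
  qed
  \<comment> \<open>Open and closed balls differ at most at the two points \<open>xt - r m\<close>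
    and \<open>xt + r m\<close>, and almost no orbit ever meets one of these countably many
    points.\<close>
  have "measure \<mu> E = measure \<mu> H"
  proof (rule \<mu>.finite_measure_eq_AE[OF _ E H])
    have "AE x in \<mu>. (f ^^ k) x \<noteq> y" if "y \<in> {xt - r m, xt + r m}" for k m y
    proof (cases "y \<in> X")
      case False
      then show ?thesis using mx.funpow_in_space sp by (intro AE_I2) auto
    qed (rule not_orbit)
    then have "AE x in \<mu>. (f ^^ k) x \<noteq> xt - r m \<and> (f ^^ k) x \<noteq> xt + r m" for k m by auto
    then have "AE x in \<mu>. \<forall>k m. (f ^^ k) x \<noteq> xt - r m \<and> (f ^^ k) x \<noteq> xt + r m"
      by (simp only: AE_all_countable) blast
    then show "AE x in \<mu>. x \<in> E \<longleftrightarrow> x \<in> H"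
      using AE_space
    proof eventually_elim
      case (elim x)
      have "dist ((f ^^ k) x) xt \<le> r m \<longleftrightarrow> (f ^^ k) x \<in> B m" for k m
        using elim(1)[rule_format, of k m] mx.funpow_in_space[OF elim(2), of k]
        by (auto simp: B_def sp dist_real_def abs_if split: if_splits)
      then show ?case by (simp add: E_def H_def)
    qed
  qed
  moreover have "measure \<mu> H = 0 \<or> measure \<mu> H = 1"
  proof (rule mx.zero_one[OF inv01 H])
    \<comment> \<open>Almost every \<open>x\<close> differs from \<open>xt\<close>, so for large
      \<open>m\<close> it lies outside the ball itself; the hitting time is then positive, and the
      orbit of \<open>f x\<close> hits one step earlier.\<close>
    show "AE x in \<mu>. x \<in> H \<longrightarrow> f x \<in> H"
      using not_orbit[OF xt, of 0] AE_space
    proof eventually_elim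
      case (elim x)
      have away: "\<forall>\<^sub>F m in sequentially. r m < dist xt x"
        using r_lim elim by (intro order_tendstoD) auto
      have step: "\<exists>k<m. (f ^^ k) (f x) \<in> B m" if far: "r m < dist xt x" and hit: "\<exists>k<m. (f ^^ k) x \<in> B m" for m
      proof -
        obtain k where k: "k < m" "(f ^^ k) x \<in> B m" using hit by blast
        then have "k \<noteq> 0" using far by (auto simp: B_def intro: Nat.gr0I)
        then obtain i where "k = Suc i" by (cases k) auto
        then show ?thesis using k by (intro exI[of _ i]) (auto simp: funpow_swap1)
      qed
      have "\<forall>\<^sub>F m in sequentially. \<exists>k<m. (f ^^ k) (f x) \<in> B m" if "x \<in> H"
      proof -
        have "\<forall>\<^sub>F m in sequentially. \<exists>k<m. (f ^^ k) x \<in> B m" using that by (simp add: H_def)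
        with away show ?thesis by eventually_elim (rule step)
      qed
      moreover have "f x \<in> X" using assms(2) elim sp by auto
      ultimately show ?case by (auto simp: H_def)
    qed
  qed
  moreover have "measure \<mu> H = 1" if "summable (\<lambda>n. measure \<mu> (B n) * exp (- real n * measure \<mu> (B n)))"
  proof -
    have "AE x in \<mu>. x \<in> H"
      using sr.AE_eventually_hit[OF that] AE_space by eventually_elim (auto simp: H_def sp)
    then show ?thesis using \<mu>.prob_eq_1[OF H] by simp
  qed
  moreover have "measure \<mu> H \<noteq> 1" if "\<not> summable (\<lambda>n. measure \<mu> (B n) * exp (- real n * measure \<mu> (B n)))"
  proof -
    \<comment> \<open>Points that miss infinitely many balls lie outside \<open>H\<close>; once
      their set has positive measure, the value 1 for \<open>H\<close> is ruled out and the zero-one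
      law gives 0.\<close>
    define Z where "Z = (\<Inter>N. \<Union>m\<in>{N..}. mx.miss (B m) m)"
    have Z: "Z \<in> sets \<mu>"
      unfolding Z_def using B_sets by (intro sets.countable_INT' sets.countable_UN') auto
    define c where "c = bv_norm X h"
    have c: "0 \<le> c" unfolding c_def by (rule bv_norm_nonneg[OF assms(11) X])
    have "0 < measure \<mu> Z" unfolding Z_def
    proof (rule sr.infinitely_often_missed[OF that, where ?C1.0 = "C * c * (c + 1)" and \<Lambda> = "max 1 (3 * K / lam)"])
      fix n m t \<delta> F assume F: "F \<in> sets \<mu>" and \<delta>: "0 < \<delta>" "\<delta> \<le> (1 :: real)"
      have "ct.avoid (B n) m {x \<in> X. (f ^^ t) x \<in> F} = mx.miss (B n) m \<inter> mx.pre (m + t) F"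
        using mx.funpow_in_space
        by (auto simp: ct.avoid_def mx.miss_def mx.pre_def sp funpow_add add.commute[of m])
      moreover have "ct.avoid (B n) m X = mx.miss (B n) m"
        using mx.funpow_in_space by (auto simp: ct.avoid_def mx.miss_def sp)
      ultimately show "measure \<mu> (mx.miss (B n) m \<inter> mx.pre (m + t) F)
          \<le> measure \<mu> (mx.miss (B n) m) * measure \<mu> F
            + C * c * (c + 1) * max 1 (3 * K / lam) ^ m * exp (- \<tau> * real t) / \<delta>\<^sup>2 + \<delta>"
        using ct.avoid_decorrelation[OF assms(11,12,13) \<mu>(1,3), of C \<tau> \<delta> "B n" F m t]
          decay C \<delta> F interval[OF B_in, of n] unfolding \<mu>\<nu> c_def by simp
    qed (use c C in auto)
    moreover have "Z \<inter> H = {}"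
    proof (intro equals0I)
      fix x assume x: "x \<in> Z \<inter> H"
      then obtain N where N: "\<And>m. N \<le> m \<Longrightarrow> \<exists>k<m. (f ^^ k) x \<in> B m"
        by (auto simp: H_def eventually_sequentially)
      obtain m where "N \<le> m" "x \<in> mx.miss (B m) m" using x by (auto simp: Z_def)
      then show False using N[of m] by (auto simp: mx.miss_def)
    qed
    then have "measure \<mu> (Z \<union> H) = measure \<mu> Z + measure \<mu> H"
      using Z H by (intro \<mu>.finite_measure_Union) auto
    ultimately show ?thesis using \<mu>.prob_le_1[of "Z \<union> H"] by linarith
  qed
  ultimately show ?thesis unfolding H_ea ev unfolding B_def[symmetric] by auto
qed

end
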